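(* Let $n,m\ge 1$, let $K=(K_{ij})\in L^\infty(\mathcal T)^{m\times n}$ and $L=(L_{ij})\in L^\infty(\mathcal T)^{m\times m}$ be the solution of the kernel equations given in the context, and consider the system, for $t\ge 0$, $x\in(0,1)$, $$u_t(t,x)+\Lambda^+u_x(t,x)=\Sigma^{++}u(t,x)+\Sigma^{+-}v(t,x),$$ $$v_t(t,x)-\Lambda^-v_x(t,x)=\Sigma^{-+}u(t,x)+\Sigma^{--}v(t,x),$$ with boundary conditions $$u(t,0)=Q_0v(t,0),\qquad v(t,1)=R_1u(t,1)+U(t),$$ and the feedback control law $$U(t)=-R_1u(t,1)+\int_0^1\big[K(1,\xi)u(t,\xi)+L(1,\xi)v(t,\xi)\big]d\xi .$$ Then for any initial condition $(u_0,v_0)\in (L^\infty(0,1))^{n+m}$ the zero equilibrium is reached in finite time $t_F$, where $$t_F:=\frac1{\lambda_1}+\sum_{j=1}^m\frac1{\mu_j},$$ that is, $u(t,\cdot)=0$ and $v(t,\cdot)=0$ for all $t\ge t_F$.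
   Context: Setting. $u=(u_1,\dots,u_n)^T$, $v=(v_1,\dots,v_m)^T$; $\Lambda^+=\mathrm{diag}(\lambda_1,\dots,\lambda_n)$, $\Lambda^-=\mathrm{diag}(\mu_1,\dots,\mu_m)$ with $-\mu_1<\dots<-\mu_m<0<\lambda_1\le\dots\le\lambda_n$. The real constant matrices are $\Sigma^{++}=(\sigma^{++}_{ij})\in\mathbb R^{n\times n}$, $\Sigma^{+-}=(\sigma^{+-}_{ij})\in\mathbb R^{n\times m}$, $\Sigma^{-+}=(\sigma^{-+}_{ij})\in\mathbb R^{m\times n}$, $\Sigma^{--}=(\sigma^{--}_{ij})\in\mathbb R^{m\times m}$, $Q_0=(q_{ij})\in\mathbb R^{n\times m}$, $R_1=(\rho_{ij})\in\mathbb R^{m\times n}$. Standing assumption: $\sigma^{--}_{jj}=0$ for $j=1,\dots,m$. Solutions of the PDEs are understood in the usual weak sense (integration along characteristics). Kernel equations. $\mathcal T=\{(x,\xi):0\le\xi\le x\le1\}$. On $\mathcal T$: $\mu_i\partial_xK_{ij}-\lambda_j\partial_\xi K_{ij}=\sum_{k=1}^n\sigma^{++}_{kj}K_{ik}+\sum_{p=1}^m\sigma^{-+}_{pj}L_{ip}$ for $1\le i\le m$, $1\le j\le n$; $\mu_i\partial_xL_{ij}+\mu_j\partial_\xi L_{ij}=\sum_{p=1}^m\sigma^{--}_{pj}L_{ip}+\sum_{k=1}^n\sigma^{+-}_{kj}K_{ik}$ for $1\le i,j\le m$; with boundary conditions $K_{ij}(x,x)=k_{ij}:=-\frac{\sigma^{-+}_{ij}}{\mu_i+\lambda_j}$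 ($1\le i\le m$, $1\le j\le n$); $L_{ij}(x,x)=l_{ij}:=-\frac{\sigma^{--}_{ij}}{\mu_i-\mu_j}$ ($i\ne j$); $\mu_jL_{ij}(x,0)=\sum_{k=1}^n\lambda_kK_{ik}(x,0)q_{kj}$ ($1\le i\le j\le m$); $L_{ij}(1,\xi)=l_{ij}$ ($1\le j<i\le m$). This system has a unique solution in $L^\infty(\mathcal T)$ (in the sense of integration along characteristics, each component being integrated from the part of $\partial\mathcal T$ where its boundary value is prescribed), with boundary traces in $L^\infty(0,1)$; $K$ and $L$ denote this solution. *)

theory Defs
  imports "HOL-Analysis.Analysis"
begin

text \<open>
  Vectors and matrices are functions of indices ranging over \<open>{1..n}\<close> and \<open>{1..m}\<close>; values at other
  indices are irrelevant. Elements of \<open>L\<^sup>\<infinity>\<close> are represented by functions, all pointwise conditions on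
  them being imposed almost everywhere.
\<close>

definition Linf :: "'a::euclidean_space set \<Rightarrow> ('a \<Rightarrow> real) \<Rightarrow> bool" where
  "Linf S f \<longleftrightarrow> f \<in> borel_measurable (lebesgue_on S) \<and>
                (\<exists>C. AE x in lebesgue_on S. \<bar>f x\<bar> \<le> C)"

text \<open>
  Weak form of \<open>d \<bullet> \<nabla>f = g\<close> on a closed convex planar set \<open>D\<close>: the equation is integrated along almost
  every line of direction \<open>d\<close> (the property of \<open>p\<close> below depends only on the line through \<open>p\<close>). The
  identity reaches up to the end points of the chord cut out by \<open>D\<close>. Hence, on the parts of the
  boundary that are transversal to \<open>d\<close>, the values of \<open>f\<close> are its traces and are determined almost
  everywhere with respect to the length of the boundary. Likewise \<open>f\<close> is determined almost everywhere
  on each segment transversal to \<open>d\<close>, in particular on each time slice for the evolution problem.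
\<close>

definition weak_transport ::
  "(real \<times> real) set \<Rightarrow> real \<times> real \<Rightarrow> (real \<times> real \<Rightarrow> real) \<Rightarrow> (real \<times> real \<Rightarrow> real) \<Rightarrow> bool" where
  "weak_transport D d f g \<longleftrightarrow>
     (AE p in lebesgue_on D. \<forall>a b. a \<le> b \<and> p + a *\<^sub>R d \<in> D \<and> p + b *\<^sub>R d \<in> D \<longrightarrow>
        ((\<lambda>s. g (p + s *\<^sub>R d)) has_integral (f (p + b *\<^sub>R d) - f (p + a *\<^sub>R d))) {a..b})"

definition triangle :: "(real \<times> real) set" where
  "triangle = {(x, \<xi>). 0 \<le> \<xi> \<and> \<xi> \<le> x \<and> x \<le> 1}"

definition kernel_solution ::
  "nat \<Rightarrow> nat \<Rightarrow> (nat \<Rightarrow> real) \<Rightarrow> (nat \<Rightarrow> real) \<Rightarrow>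
   (nat \<Rightarrow> nat \<Rightarrow> real) \<Rightarrow> (nat \<Rightarrow> nat \<Rightarrow> real) \<Rightarrow> (nat \<Rightarrow> nat \<Rightarrow> real) \<Rightarrow> (nat \<Rightarrow> nat \<Rightarrow> real) \<Rightarrow>
   (nat \<Rightarrow> nat \<Rightarrow> real) \<Rightarrow>
   (nat \<Rightarrow> nat \<Rightarrow> real \<times> real \<Rightarrow> real) \<Rightarrow> (nat \<Rightarrow> nat \<Rightarrow> real \<times> real \<Rightarrow> real) \<Rightarrow> bool" where
  "kernel_solution n m lam mu Spp Spm Smp Smm Q0 K L \<longleftrightarrow>
     \<comment> \<open>regularity, including the traces on the sides \<open>\<xi> = 0\<close> and \<open>x = 1\<close>\<close>
     (\<forall>i\<in>{1..m}. \<forall>j\<in>{1..n}. Linf triangle (K i j) \<and>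
        Linf {0<..<1} (\<lambda>x. K i j (x, 0)) \<and> Linf {0<..<1} (\<lambda>\<xi>. K i j (1, \<xi>))) \<and>
     (\<forall>i\<in>{1..m}. \<forall>j\<in>{1..m}. Linf triangle (L i j) \<and>
        Linf {0<..<1} (\<lambda>x. L i j (x, 0)) \<and> Linf {0<..<1} (\<lambda>\<xi>. L i j (1, \<xi>))) \<and>
     \<comment> \<open>differential equations\<close>
     (\<forall>i\<in>{1..m}. \<forall>j\<in>{1..n}. weak_transport triangle (mu i, - lam j) (K i j)
        (\<lambda>p. (\<Sum>k=1..n. Spp k j * K i k p) + (\<Sum>q=1..m. Smp q j * L i q p))) \<and>
     (\<forall>i\<in>{1..m}. \<forall>j\<in>{1..m}. weak_transport triangle (mu i, mu j) (L i j)
        (\<lambda>p. (\<Sum>q=1..m. Smm q j * L i q p) + (\<Sum>k=1..n. Spm k j * K i k p))) \<and>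
     \<comment> \<open>boundary conditions\<close>
     (\<forall>i\<in>{1..m}. \<forall>j\<in>{1..n}. AE x in lebesgue_on {0<..<1}.
        K i j (x, x) = - (Smp i j / (mu i + lam j))) \<and>
     (\<forall>i\<in>{1..m}. \<forall>j\<in>{1..m}. i \<noteq> j \<longrightarrow> (AE x in lebesgue_on {0<..<1}.
        L i j (x, x) = - (Smm i j / (mu i - mu j)))) \<and>
     (\<forall>i\<in>{1..m}. \<forall>j\<in>{1..m}. i \<le> j \<longrightarrow> (AE x in lebesgue_on {0<..<1}.
        mu j * L i j (x, 0) = (\<Sum>k=1..n. lam k * K i k (x, 0) * Q0 k j))) \<and>
     (\<forall>i\<in>{1..m}. \<forall>j\<in>{1..m}. j < i \<longrightarrow> (AE \<xi> in lebesgue_on {0<..<1}.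
        L i j (1, \<xi>) = - (Smm i j / (mu i - mu j))))"

definition feedback ::
  "nat \<Rightarrow> nat \<Rightarrow> (nat \<Rightarrow> nat \<Rightarrow> real) \<Rightarrow>
   (nat \<Rightarrow> nat \<Rightarrow> real \<times> real \<Rightarrow> real) \<Rightarrow> (nat \<Rightarrow> nat \<Rightarrow> real \<times> real \<Rightarrow> real) \<Rightarrow>
   (nat \<Rightarrow> real \<times> real \<Rightarrow> real) \<Rightarrow> (nat \<Rightarrow> real \<times> real \<Rightarrow> real) \<Rightarrow> nat \<Rightarrow> real \<Rightarrow> real" where
  "feedback n m R1 K L u v i t =
     - (\<Sum>j=1..n. R1 i j * u j (t, 1)) +
     integral {0..1} (\<lambda>\<xi>. (\<Sum>j=1..n. K i j (1, \<xi>) * u j (t, \<xi>)) + (\<Sum>j=1..m. L i j (1, \<xi>) * v j (t, \<xi>)))"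

definition system_solution ::
  "nat \<Rightarrow> nat \<Rightarrow> (nat \<Rightarrow> real) \<Rightarrow> (nat \<Rightarrow> real) \<Rightarrow>
   (nat \<Rightarrow> nat \<Rightarrow> real) \<Rightarrow> (nat \<Rightarrow> nat \<Rightarrow> real) \<Rightarrow> (nat \<Rightarrow> nat \<Rightarrow> real) \<Rightarrow> (nat \<Rightarrow> nat \<Rightarrow> real) \<Rightarrow>
   (nat \<Rightarrow> nat \<Rightarrow> real) \<Rightarrow> (nat \<Rightarrow> nat \<Rightarrow> real) \<Rightarrow> (nat \<Rightarrow> real \<Rightarrow> real) \<Rightarrow>
   (nat \<Rightarrow> real \<Rightarrow> real) \<Rightarrow> (nat \<Rightarrow> real \<Rightarrow> real) \<Rightarrow>
   (nat \<Rightarrow> real \<times> real \<Rightarrow> real) \<Rightarrow> (nat \<Rightarrow> real \<times> real \<Rightarrow> real) \<Rightarrow> bool" where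
  "system_solution n m lam mu Spp Spm Smp Smm Q0 R1 U u0 v0 u v \<longleftrightarrow>
     \<comment> \<open>regularity, including the traces on the outflow sides\<close>
     (\<forall>T>0. \<forall>i\<in>{1..n}. Linf ({0..T} \<times> {0..1}) (u i) \<and> Linf {0..T} (\<lambda>t. u i (t, 1))) \<and>
     (\<forall>T>0. \<forall>i\<in>{1..m}. Linf ({0..T} \<times> {0..1}) (v i) \<and> Linf {0..T} (\<lambda>t. v i (t, 0))) \<and>
     \<comment> \<open>differential equations, in the variables \<open>(t, x)\<close>\<close>
     (\<forall>i\<in>{1..n}. weak_transport ({0..} \<times> {0..1}) (1, lam i) (u i)
        (\<lambda>p. (\<Sum>j=1..n. Spp i j * u j p) + (\<Sum>j=1..m. Spm i j * v j p))) \<and>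
     (\<forall>i\<in>{1..m}. weak_transport ({0..} \<times> {0..1}) (1, - mu i) (v i)
        (\<lambda>p. (\<Sum>j=1..n. Smp i j * u j p) + (\<Sum>j=1..m. Smm i j * v j p))) \<and>
     \<comment> \<open>boundary conditions\<close>
     (\<forall>i\<in>{1..n}. AE t in lebesgue_on {0..}. u i (t, 0) = (\<Sum>j=1..m. Q0 i j * v j (t, 0))) \<and>
     (\<forall>i\<in>{1..m}. AE t in lebesgue_on {0..}. v i (t, 1) = (\<Sum>j=1..n. R1 i j * u j (t, 1)) + U i t) \<and>
     \<comment> \<open>initial conditions\<close>
     (\<forall>i\<in>{1..n}. AE x in lebesgue_on {0<..<1}. u i (0, x) = u0 i x) \<and>
     (\<forall>i\<in>{1..m}. AE x in lebesgue_on {0<..<1}. v i (0, x) = v0 i x)"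

end

(*
  Fix i and t0, and let s, for 0 <= s <= S, parametrise the characteristic (t0 + s, 1 - mu_i s) of
  v_i that leaves x = 1 at time t0. On the trapezoid D = {0 <= s <= S, 0 <= xi <= 1 - mu_i s} the
  product K_ij(1 - mu_i s, xi) u_j(t0 + s, xi) has a derivative in direction (1, lam_j), and
  L_ij(1 - mu_i s, xi) v_j(t0 + s, xi) has one in direction (1, -mu_j). By the kernel equations these
  derivatives sum to 0, so the boundary fluxes balance. With the boundary values of K and L and the
  feedback law this says that
    v_i(t, x) = int_0^x (K_i(x, xi) u(t, xi) + L_i(x, xi) v(t, xi)) dxi
  at (t, x) = (t0 + S, 1 - mu_i S), as soon as v_j(., 0) = 0 after t0 for all j < i. Taking x = 0,
  induction on i gives v_i(t, 0) = 0 for t >= 1/mu_1 + ... + 1/mu_i.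

  From the time T_m = 1/mu_1 + ... + 1/mu_m on, v therefore satisfies a Volterra equation in x, and u
  enters from x = 0 with value 0. On t >= T_m + x/lam_1, which contains the backward characteristics
  of every u_i down to x = 0, a bound B exp(M x) for |u| and |v| improves to (B/2) exp(M x) when M is
  large, so both vanish there.
*)

theory Submission
  imports Defs
begin

section \<open>Almost everywhere statements and bounded representatives\<close>

text \<open>The solutions are only measurable, so every function plays two roles. The given
  \<open>u\<close>, \<open>v\<close>, \<open>K\<close>, \<open>L\<close> supply end values on lines
  and on the sides of the trapezoid; bounded Borel representatives \<open>u'\<close>,
  \<open>v'\<close>, \<open>K'\<close>, \<open>L'\<close>, equal to them almost everywhere, supply
  what is integrated over areas or passed through Fubini. Each change of role costs a null set,
  which is why statements hold for generic times, abscissas and lines, and why a last argument is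
  needed to reach every \<open>t\<close>. The kernel equations act as adjoint equations: paired with
  the state they give exact derivatives, so neither a target system nor differentiability of the
  kernels is involved. On the side along the characteristic of \<open>v i\<close>, the flux of
  \<open>v j\<close> has the factor \<open>mu i - mu j\<close>; it turns the diagonal value of
  \<open>L i j\<close> into the source term of \<open>v i\<close> and removes \<open>L i i\<close>,
  whose diagonal value is not prescribed. At \<xi> = 0 the kernel condition cancels the fluxes of
  \<open>u\<close> and of \<open>v j\<close> only for j \<ge> i. The traces of \<open>v j\<close>
  with j < i are left over, hence the cascade and the sum of the travel times.\<close>

lemma AE_lebesgue_on_iff:
  fixes P :: "'a::euclidean_space \<Rightarrow> bool"
  assumes "S \<in> sets lebesgue"
  shows "(AE x in lebesgue_on S. P x) \<longleftrightarrow> (AE x in lborel. x \<in> S \<longrightarrow> P x)"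
  using assms by (simp add: AE_restrict_space_iff AE_completion_iff)

lemma AE_lborel_iff_negligible:
  fixes P :: "'a::euclidean_space \<Rightarrow> bool"
  shows "(AE x in lborel. P x) \<longleftrightarrow> negligible {x. \<not> P x}"
proof -
  have "(AE x in lborel. P x) \<longleftrightarrow> (AE x in lebesgue. P x)"
    by (simp add: AE_completion_iff)
  also have "\<dots> \<longleftrightarrow> {x. \<not> P x} \<in> null_sets lebesgue"
    using AE_iff_null_sets[of "{x. \<not> P x}" lebesgue] AE_iff_null[of lebesgue P]
    by (smt (verit) AE_completion_iff AE_iff_null_sets AE_not_in Collect_cong UNIV_I completion.complete2
        eventually_ae_filter mem_Collect_eq space_borel space_completion space_lborel subsetI)
  finally show ?thesis by (simp add: negligible_iff_null_sets)
qed

lemma has_integral_AE_cong: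
  fixes f g :: "'a::euclidean_space \<Rightarrow> real"
  assumes "AE x in lborel. x \<in> S \<longrightarrow> f x = g x" "(f has_integral I) S"
  shows "(g has_integral I) S"
  using assms unfolding AE_lborel_iff_negligible
  by (intro has_integral_spike[of "{x. \<not> (x \<in> S \<longrightarrow> f x = g x)}" S g f]) auto

text \<open>The exceptional set of \<open>P (T x)\<close> lies in the image under \<open>T'\<close>
  of that of \<open>P\<close>, and a differentiable map of a Euclidean space into itself sends
  negligible sets to negligible sets.\<close>

lemma AE_comp_inverse:
  fixes T T' :: "'a::euclidean_space \<Rightarrow> 'a"
  assumes "AE x in lborel. P x" "\<And>x. T' (T x) = x" "T' differentiable_on UNIV"
  shows "AE x in lborel. P (T x)"
proof -
  have "negligible (T' ` {x. \<not> P x})"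
    using assms(1,3) unfolding AE_lborel_iff_negligible
    by (intro negligible_differentiable_image_negligible) (auto intro: differentiable_on_subset)
  moreover have "{x. \<not> P (T x)} \<subseteq> T' ` {x. \<not> P x}"
    using assms(2) by (metis (mono_tags, lifting) image_eqI mem_Collect_eq subsetI)
  ultimately show ?thesis
    unfolding AE_lborel_iff_negligible using negligible_subset by blast
qed

lemma AE_affine1:
  fixes a c :: real
  assumes "AE x in lborel. P x" "c \<noteq> 0"
  shows "AE x in lborel. P (a + c * x)"
  using assms(2)
  by (intro AE_comp_inverse[OF assms(1), where T' = "\<lambda>x. (x - a) / c"])
     (auto intro!: derivative_eq_intros exI simp: differentiable_on_def differentiable_def)

lemma AE_pairD:
  assumes "AE p in (lborel :: (real \<times> real) measure). P p"
  shows "AE x in lborel. AE y in lborel. P (x, y)"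
  using assms unfolding lborel_prod[symmetric] by (rule lborel_pair.AE_pair)

text \<open>A set with null sections can fail to be measurable, so this converse of Fubini asks for
  a Borel predicate. It is the reason why statements proved line by line return to the plane only
  for Borel representatives.\<close>

lemma AE_pairI:
  fixes P :: "real \<times> real \<Rightarrow> bool"
  assumes "Measurable.pred borel P" "AE x in lborel. AE y in lborel. P (x, y)"
  shows "AE p in lborel. P p"
proof -
  have "{x\<in>space (lborel \<Otimes>\<^sub>M lborel). P x} \<in> sets (lborel \<Otimes>\<^sub>M (lborel :: real measure))"
    unfolding lborel_prod using assms(1) by (simp add: pred_def)
  from lborel_pair.AE_pair_measure[OF this assms(2)] show ?thesis
    unfolding lborel_prod .
qed

lemma AE_affine2:
  fixes P :: "real \<times> real \<Rightarrow> bool"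
  assumes "AE p in lborel. P p" and det: "a * d - b * c \<noteq> 0"
  shows "AE p in lborel. P (x0 + a * fst p + b * snd p, y0 + c * fst p + d * snd p)"
proof (rule AE_comp_inverse[OF assms(1)])
  let ?D = "a * d - b * c"
  let ?T' = "\<lambda>p. ((d * (fst p - x0) - b * (snd p - y0)) / ?D, (a * (snd p - y0) - c * (fst p - x0)) / ?D)"
  show "?T' differentiable_on UNIV"
    unfolding differentiable_on_def differentiable_def
    using det by (auto intro!: derivative_eq_intros exI)
  fix p :: "real \<times> real"
  have "d * (x0 + a * fst p + b * snd p - x0) - b * (y0 + c * fst p + d * snd p - y0) = ?D * fst p"
    "a * (y0 + c * fst p + d * snd p - y0) - c * (x0 + a * fst p + b * snd p - x0) = ?D * snd p"
    by (simp_all add: algebra_simps)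
  then show "?T' (x0 + a * fst p + b * snd p, y0 + c * fst p + d * snd p) = p"
    using det by (cases p) simp
qed

text \<open>Fubini in oblique coordinates: the inner variable runs along direction
  \<open>(b, d)\<close>, the outer one labels the parallel lines. With a characteristic direction as
  \<open>(b, d)\<close>, a null set of the plane is null on almost every characteristic.\<close>

lemma AE_affine2D:
  fixes P :: "real \<times> real \<Rightarrow> bool"
  assumes "AE p in lborel. P p" "a * d - b * c \<noteq> 0"
  shows "AE x in lborel. AE y in lborel. P (x0 + a * x + b * y, y0 + c * x + d * y)"
  using AE_pairD[OF AE_affine2[OF assms, of x0 y0]] by simp

lemma AE_affine2I:
  fixes P :: "real \<times> real \<Rightarrow> bool"
  assumes [measurable]: "Measurable.pred borel P" and det: "a * d - b * c \<noteq> 0"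
    and "AE x in lborel. AE y in lborel. P (x0 + a * x + b * y, y0 + c * x + d * y)"
  shows "AE p in lborel. P p"
proof -
  let ?D = "a * d - b * c"
  have "(\<lambda>p. (x0 + a * fst p + b * snd p, y0 + c * fst p + d * snd p)) \<in> borel_measurable borel"
    by (intro borel_measurable_continuous_onI continuous_intros)
  then have "Measurable.pred borel (\<lambda>p. P (x0 + a * fst p + b * snd p, y0 + c * fst p + d * snd p))"
    using assms(1) by (rule measurable_compose)
  from AE_pairI[OF this] assms(3)
  have "AE p in lborel. P (x0 + a * fst p + b * snd p, y0 + c * fst p + d * snd p)" by simp
  \<comment> \<open>The inverse matrix has determinant \<open>1 / ?D\<close>, so the change of
    variables can be undone by \<open>AE_affine2\<close> itself.\<close>
  moreover have "(d / ?D) * (a / ?D) - (- b / ?D) * (- c / ?D) \<noteq> 0"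
  proof -
    have "(d / ?D) * (a / ?D) - (- b / ?D) * (- c / ?D) = ?D / (?D * ?D)"
      by (simp add: diff_divide_distrib mult.commute)
    then show ?thesis using det by simp
  qed
  ultimately have ae: "AE p in lborel. (\<lambda>p. P (x0 + a * fst p + b * snd p, y0 + c * fst p + d * snd p))
     ((b * y0 - d * x0) / ?D + (d / ?D) * fst p + (- b / ?D) * snd p,
      (c * x0 - a * y0) / ?D + (- c / ?D) * fst p + (a / ?D) * snd p)"
    by (rule AE_affine2)
  show ?thesis
  proof (rule AE_mp[OF ae], rule AE_I2, rule impI)
    fix p :: "real \<times> real"
    define q r where "q = (b * y0 - d * x0) / ?D + (d / ?D) * fst p + (- b / ?D) * snd p"
      and "r = (c * x0 - a * y0) / ?D + (- c / ?D) * fst p + (a / ?D) * snd p"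
    have cancel: "\<Delta> * (A / \<Delta> + (B / \<Delta>) * s + (C / \<Delta>) * t) = A + B * s + C * t"
      if "\<Delta> \<noteq> 0" for \<Delta> A B C s t :: real
      using that by (simp add: field_simps)
    have q: "?D * q = b * y0 - d * x0 + d * fst p - b * snd p"
      and r: "?D * r = c * x0 - a * y0 - c * fst p + a * snd p"
      unfolding q_def r_def cancel[OF det] by simp_all
    have "?D * (x0 + a * q + b * r) = ?D * fst p"
      using arg_cong[OF q, of "(*) a"] arg_cong[OF r, of "(*) b"] by (simp add: algebra_simps)
    moreover have "?D * (y0 + c * q + d * r) = ?D * snd p"
      using arg_cong[OF q, of "(*) c"] arg_cong[OF r, of "(*) d"] by (simp add: algebra_simps)
    ultimately have "(x0 + a * q + b * r, y0 + c * q + d * r) = p"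
      using det by (cases p) simp
    moreover assume "(\<lambda>p. P (x0 + a * fst p + b * snd p, y0 + c * fst p + d * snd p))
     ((b * y0 - d * x0) / ?D + (d / ?D) * fst p + (- b / ?D) * snd p,
      (c * x0 - a * y0) / ?D + (- c / ?D) * fst p + (a / ?D) * snd p)"
    ultimately show "P p"
      by (simp only: fst_conv snd_conv q_def[symmetric] r_def[symmetric])
  qed
qed

lemma Linf_AE:
  assumes "Linf S f" "S \<in> sets lebesgue"
  obtains f' C where "f' \<in> borel_measurable borel" "\<And>x. \<bar>f' x\<bar> \<le> C" "0 \<le> C"
    "AE x in lborel. x \<in> S \<longrightarrow> f x = f' x"
proof -
  from assms obtain C where C: "AE x in lborel. x \<in> S \<longrightarrow> \<bar>f x\<bar> \<le> C"
    and f: "f \<in> borel_measurable (lebesgue_on S)"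
    unfolding Linf_def by (auto simp: AE_lebesgue_on_iff)
  have "(\<lambda>x. if x \<in> S then f x else 0) \<in> borel_measurable (completion lborel)"
    using f assms(2) by (simp add: borel_measurable_if)
  then obtain g where g: "g \<in> borel_measurable lborel"
    "AE x in lborel. (if x \<in> S then f x else 0) = g x"
    using completion_ex_borel_measurable_real by blast
  show ?thesis
  proof
    \<comment> \<open>Clamping makes the Borel version bounded everywhere. The absolute value of
      \<open>C\<close> is taken because \<open>C\<close> may be negative when \<open>S\<close> is
      null.\<close>
    show "\<bar>max (- \<bar>C\<bar>) (min \<bar>C\<bar> (g x))\<bar> \<le> \<bar>C\<bar>" for x by auto
    show "(\<lambda>x. max (- \<bar>C\<bar>) (min \<bar>C\<bar> (g x))) \<in> borel_measurable borel" using g(1) by simp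
    show "AE x in lborel. x \<in> S \<longrightarrow> f x = max (- \<bar>C\<bar>) (min \<bar>C\<bar> (g x))"
      using g(2) C by eventually_elim (auto simp: max_def min_def)
  qed auto
qed


section \<open>Functions with bounded Borel representatives on a set\<close>

text \<open>Made for traces on segments: \<open>f\<close> itself may be neither Borel nor bounded,
  off \<open>S\<close> or on a null set, while the representative is total. Sums, products and
  affine substitutions are then handled on the representatives.\<close>

definition bounded_ae :: "'a::euclidean_space set \<Rightarrow> ('a \<Rightarrow> real) \<Rightarrow> bool" where
  "bounded_ae S f \<longleftrightarrow> (\<exists>g C. g \<in> borel_measurable borel \<and> (\<forall>x. \<bar>g x\<bar> \<le> C) \<and>
     (AE x in lborel. x \<in> S \<longrightarrow> f x = g x))"

lemma bounded_aeI:
  assumes "g \<in> borel_measurable borel" "\<And>x. \<bar>g x\<bar> \<le> C" "AE x in lborel. x \<in> S \<longrightarrow> f x = g x"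
  shows "bounded_ae S f"
  using assms unfolding bounded_ae_def by blast

lemma Linf_imp_bounded_ae: "Linf S f \<Longrightarrow> S \<in> sets lebesgue \<Longrightarrow> bounded_ae S f"
  by (erule (1) Linf_AE) (rule bounded_aeI)

lemma bounded_ae_cong:
  assumes "AE x in lborel. x \<in> S \<longrightarrow> f x = h x" "bounded_ae S f"
  shows "bounded_ae S h"
proof -
  from assms(2) obtain g C where g: "g \<in> borel_measurable borel" "\<And>x. \<bar>g x\<bar> \<le> C"
    "AE x in lborel. x \<in> S \<longrightarrow> f x = g x" unfolding bounded_ae_def by blast
  have "AE x in lborel. x \<in> S \<longrightarrow> h x = g x" using assms(1) g(3) by eventually_elim auto
  with g(1,2) show ?thesis by (rule bounded_aeI)
qed

lemma bounded_ae_subset: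
  assumes "bounded_ae S f" "S' \<subseteq> S"
  shows "bounded_ae S' f"
proof -
  from assms(1) obtain g C where g: "g \<in> borel_measurable borel" "\<And>x. \<bar>g x\<bar> \<le> C"
    "AE x in lborel. x \<in> S \<longrightarrow> f x = g x" unfolding bounded_ae_def by blast
  have "AE x in lborel. x \<in> S' \<longrightarrow> f x = g x" using g(3) by eventually_elim (use assms(2) in auto)
  with g(1,2) show ?thesis by (rule bounded_aeI)
qed

lemma bounded_ae_const: "bounded_ae S (\<lambda>x. c)"
  by (rule bounded_aeI[of "\<lambda>x. c" "\<bar>c\<bar>"]) auto

lemma bounded_ae_mult:
  assumes "bounded_ae S f" "bounded_ae S h"
  shows "bounded_ae S (\<lambda>x. f x * h x)"
proof -
  from assms obtain g C g' C' where g: "g \<in> borel_measurable borel" "\<And>x. \<bar>g x\<bar> \<le> C"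
    "AE x in lborel. x \<in> S \<longrightarrow> f x = g x" and g': "g' \<in> borel_measurable borel" "\<And>x. \<bar>g' x\<bar> \<le> C'"
    "AE x in lborel. x \<in> S \<longrightarrow> h x = g' x" unfolding bounded_ae_def by blast
  have "AE x in lborel. x \<in> S \<longrightarrow> f x * h x = g x * g' x" using g(3) g'(3) by eventually_elim auto
  moreover have "\<bar>g x * g' x\<bar> \<le> C * C'" for x
    unfolding abs_mult using g(2)[of x] g'(2)[of x] by (intro mult_mono) auto
  ultimately show ?thesis using g(1) g'(1) by (intro bounded_aeI[of "\<lambda>x. g x * g' x"]) auto
qed

lemma bounded_ae_add:
  assumes "bounded_ae S f" "bounded_ae S h"
  shows "bounded_ae S (\<lambda>x. f x + h x)"
proof -
  from assms obtain g C g' C' where g: "g \<in> borel_measurable borel" "\<And>x. \<bar>g x\<bar> \<le> C"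
    "AE x in lborel. x \<in> S \<longrightarrow> f x = g x" and g': "g' \<in> borel_measurable borel" "\<And>x. \<bar>g' x\<bar> \<le> C'"
    "AE x in lborel. x \<in> S \<longrightarrow> h x = g' x" unfolding bounded_ae_def by blast
  have "AE x in lborel. x \<in> S \<longrightarrow> f x + h x = g x + g' x" using g(3) g'(3) by eventually_elim auto
  moreover have "\<bar>g x + g' x\<bar> \<le> C + C'" for x
    using g(2)[of x] g'(2)[of x] by auto
  ultimately show ?thesis using g(1) g'(1) by (intro bounded_aeI[of "\<lambda>x. g x + g' x"]) auto
qed

lemma bounded_ae_sum:
  assumes "\<And>j. j \<in> J \<Longrightarrow> bounded_ae S (f j)"
  shows "bounded_ae S (\<lambda>x. \<Sum>j\<in>J. f j x)"
  using assms by (induction J rule: infinite_finite_induct) (auto intro: bounded_ae_const bounded_ae_add)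

lemma bounded_ae_affine:
  fixes f :: "real \<Rightarrow> real"
  assumes "bounded_ae S f" "c \<noteq> 0" "\<And>x. x \<in> S' \<Longrightarrow> a + c * x \<in> S"
  shows "bounded_ae S' (\<lambda>x. f (a + c * x))"
proof -
  from assms(1) obtain g C where g: "g \<in> borel_measurable borel" "\<And>x. \<bar>g x\<bar> \<le> C"
    "AE x in lborel. x \<in> S \<longrightarrow> f x = g x" unfolding bounded_ae_def by blast
  have "AE x in lborel. x \<in> S' \<longrightarrow> f (a + c * x) = g (a + c * x)"
    using AE_affine1[OF g(3) assms(2), of a] by eventually_elim (use assms(3) in auto)
  moreover have "(\<lambda>x. g (a + c * x)) \<in> borel_measurable borel"
    using g(1) by (rule measurable_compose[rotated]) simp
  ultimately show ?thesis using g(2) by (intro bounded_aeI[of "\<lambda>x. g (a + c * x)" C]) auto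
qed

lemma bounded_borel_integrable_on:
  fixes g :: "real \<Rightarrow> real"
  assumes "g \<in> borel_measurable borel" "\<And>x. \<bar>g x\<bar> \<le> C"
  shows "g integrable_on {a..b}"
proof (rule measurable_bounded_by_integrable_imp_integrable)
  show "g \<in> borel_measurable (lebesgue_on {a..b})"
    using assms(1) by (intro measurable_restrict_space1 measurable_completion) simp
  show "(\<lambda>x. C) integrable_on {a..b}" by (rule integrable_const_ivl)
qed (use assms in auto)

lemma bounded_ae_integrable_on:
  fixes f :: "real \<Rightarrow> real"
  assumes "bounded_ae {a..b} f"
  shows "f integrable_on {a..b}"
proof -
  from assms obtain g C where g: "g \<in> borel_measurable borel" "\<And>x. \<bar>g x\<bar> \<le> C"
    "AE x in lborel. x \<in> {a..b} \<longrightarrow> f x = g x" unfolding bounded_ae_def by blast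
  from bounded_borel_integrable_on[OF g(1,2)] obtain I where "(g has_integral I) {a..b}"
    by (auto simp: integrable_on_def)
  moreover have "AE x in lborel. x \<in> {a..b} \<longrightarrow> g x = f x" using g(3) by eventually_elim auto
  ultimately show ?thesis using has_integral_AE_cong[of "{a..b}" g f I] by (auto simp: integrable_on_def)
qed

lemma bounded_ae_open_closed:
  assumes "bounded_ae {0<..<1::real} f"
  shows "bounded_ae {0..1} f"
proof -
  from assms obtain g C where g: "g \<in> borel_measurable borel" "\<And>x. \<bar>g x\<bar> \<le> C"
    and ae: "AE x in lborel. x \<in> {0<..<1} \<longrightarrow> f x = g x" unfolding bounded_ae_def by blast
  have "AE x in lborel. x \<in> {0..1} \<longrightarrow> f x = g x"
    using ae AE_lborel_singleton[of "0::real"] AE_lborel_singleton[of "1::real"] by eventually_elim auto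
  with g show ?thesis by (rule bounded_aeI)
qed

section \<open>Weak solutions along lines\<close>

lemma AE_exists_between:
  assumes "AE s in lborel. P s" "(a::real) < b"
  obtains s where "a < s" "s < b" "P s"
proof -
  have "\<not> {a<..<b} \<subseteq> {s. \<not> P s}"
  proof
    assume "{a<..<b} \<subseteq> {s. \<not> P s}"
    then have "negligible {a<..<b}"
      using assms(1) negligible_subset unfolding AE_lborel_iff_negligible by blast
    with assms(2) show False using open_not_negligible[of "{a<..<b}"] by auto
  qed
  then show ?thesis using that by auto
qed

lemma has_integral_shift:
  fixes f :: "real \<Rightarrow> real"
  assumes "(f has_integral I) {a..b}"
  shows "((\<lambda>x. f (c + x)) has_integral I) {a - c..b - c}"
  using has_integral_affinity'[of f I a b 1 c] assms by (simp add: add.commute)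

text \<open>Reversal of orientation. It serves the kernels, whose first argument
  \<open>1 - mu i * s\<close> decreases while the state moves forward in time.\<close>

lemma weak_transport_uminus:
  assumes "weak_transport D d f g"
  shows "weak_transport D (- d) f (\<lambda>p. - g p)"
  unfolding weak_transport_def
proof (rule AE_mp[OF assms[unfolded weak_transport_def]], rule AE_I2, intro impI allI)
  fix p and a b :: real
  assume *: "\<forall>a b. a \<le> b \<and> p + a *\<^sub>R d \<in> D \<and> p + b *\<^sub>R d \<in> D \<longrightarrow>
        ((\<lambda>s. g (p + s *\<^sub>R d)) has_integral (f (p + b *\<^sub>R d) - f (p + a *\<^sub>R d))) {a..b}"
    and ab: "a \<le> b \<and> p + a *\<^sub>R - d \<in> D \<and> p + b *\<^sub>R - d \<in> D"
  then have "((\<lambda>s. g (p + s *\<^sub>R d)) has_integral (f (p + (- a) *\<^sub>R d) - f (p + (- b) *\<^sub>R d))) {- b..- a}"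
    using *[rule_format, of "- b" "- a"] by simp
  then have "((\<lambda>s. g (p + (- s) *\<^sub>R d)) has_integral (f (p + (- a) *\<^sub>R d) - f (p + (- b) *\<^sub>R d))) {a..b}"
    using has_integral_reflect_real[of "\<lambda>s. g (p + s *\<^sub>R d)" "f (p + (- a) *\<^sub>R d) - f (p + (- b) *\<^sub>R d)" "- a" "- b"]
    by simp
  from has_integral_neg[OF this]
  show "((\<lambda>s. - g (p + s *\<^sub>R - d)) has_integral (f (p + b *\<^sub>R - d) - f (p + a *\<^sub>R - d))) {a..b}"
    by simp
qed

text \<open>The definition speaks of almost every base point, whereas the arguments below need
  almost every line. Since the identity depends only on the line, one good base point on a chord
  suffices; convexity keeps the whole chord in \<open>D\<close>, and Fubini makes \<open>g\<close>
  and \<open>g'\<close> agree almost everywhere on it.\<close>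

lemma weak_transport_lines:
  fixes D :: "(real \<times> real) set"
  assumes w: "weak_transport D d f g" and D: "convex D" "D \<in> sets lebesgue"
    and g: "AE p in lborel. p \<in> D \<longrightarrow> g p = g' p"
    and det: "fst e * snd d - fst d * snd e \<noteq> 0"
  shows "AE y in lborel. \<forall>a b. a \<le> b \<and> p0 + y *\<^sub>R e + a *\<^sub>R d \<in> D \<and> p0 + y *\<^sub>R e + b *\<^sub>R d \<in> D \<longrightarrow>
    ((\<lambda>s. g' (p0 + y *\<^sub>R e + s *\<^sub>R d)) has_integral
       (f (p0 + y *\<^sub>R e + b *\<^sub>R d) - f (p0 + y *\<^sub>R e + a *\<^sub>R d))) {a..b}"
proof -
  let ?P = "\<lambda>p. \<forall>a b. a \<le> b \<and> p + a *\<^sub>R d \<in> D \<and> p + b *\<^sub>R d \<in> D \<longrightarrow>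
        ((\<lambda>s. g (p + s *\<^sub>R d)) has_integral (f (p + b *\<^sub>R d) - f (p + a *\<^sub>R d))) {a..b}"
  have line: "(fst p0 + fst e * y + fst d * s, snd p0 + snd e * y + snd d * s) = p0 + y *\<^sub>R e + s *\<^sub>R d"
    for y s by (simp add: prod_eq_iff mult.commute)
  have "AE p in lborel. (p \<in> D \<longrightarrow> ?P p) \<and> (p \<in> D \<longrightarrow> g p = g' p)"
    using w g unfolding weak_transport_def AE_lebesgue_on_iff[OF D(2)] by simp
  from AE_affine2D[OF this det, of "fst p0" "snd p0"]
  have "AE y in lborel. AE s in lborel. (p0 + y *\<^sub>R e + s *\<^sub>R d \<in> D \<longrightarrow> ?P (p0 + y *\<^sub>R e + s *\<^sub>R d)) \<and>
      (p0 + y *\<^sub>R e + s *\<^sub>R d \<in> D \<longrightarrow> g (p0 + y *\<^sub>R e + s *\<^sub>R d) = g' (p0 + y *\<^sub>R e + s *\<^sub>R d))"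
    unfolding line .
  then show ?thesis
  proof (rule AE_mp, intro AE_I2 impI allI)
    fix y a b :: real
    define q where "q = p0 + y *\<^sub>R e"
    assume "AE s in lborel. (p0 + y *\<^sub>R e + s *\<^sub>R d \<in> D \<longrightarrow> ?P (p0 + y *\<^sub>R e + s *\<^sub>R d)) \<and>
      (p0 + y *\<^sub>R e + s *\<^sub>R d \<in> D \<longrightarrow> g (p0 + y *\<^sub>R e + s *\<^sub>R d) = g' (p0 + y *\<^sub>R e + s *\<^sub>R d))"
    then have ae: "AE s in lborel. (q + s *\<^sub>R d \<in> D \<longrightarrow> ?P (q + s *\<^sub>R d)) \<and>
      (q + s *\<^sub>R d \<in> D \<longrightarrow> g (q + s *\<^sub>R d) = g' (q + s *\<^sub>R d))"
      by (simp add: q_def)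
    assume "a \<le> b \<and> p0 + y *\<^sub>R e + a *\<^sub>R d \<in> D \<and> p0 + y *\<^sub>R e + b *\<^sub>R d \<in> D"
    then have ab: "a \<le> b" "q + a *\<^sub>R d \<in> D" "q + b *\<^sub>R d \<in> D" by (auto simp: q_def)
    have inD: "q + s *\<^sub>R d \<in> D" if "a \<le> s" "s \<le> b" for s
    proof (cases "a = b")
      case False
      with ab have "0 < b - a" by simp
      define r where "r = (s - a) / (b - a)"
      have "r * (b - a) = s - a" using \<open>0 < b - a\<close> by (simp add: r_def)
      then have s: "s = (1 - r) * a + r * b" by (simp add: algebra_simps)
      have r: "0 \<le> r" "r \<le> 1" using that \<open>0 < b - a\<close> by (auto simp: r_def)
      have "(1 - r) *\<^sub>R (q + a *\<^sub>R d) + r *\<^sub>R (q + b *\<^sub>R d) \<in> D"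
        using ab D(1) r by (auto simp: convex_alt)
      also have "(1 - r) *\<^sub>R (q + a *\<^sub>R d) + r *\<^sub>R (q + b *\<^sub>R d) = q + s *\<^sub>R d"
        by (simp add: s algebra_simps)
      finally show ?thesis .
    qed (use that ab in simp)
    have "((\<lambda>s. g (q + s *\<^sub>R d)) has_integral (f (q + b *\<^sub>R d) - f (q + a *\<^sub>R d))) {a..b}"
    proof (cases "a = b")
      case False
      with ab have "a < b" by simp
      \<comment> \<open>A good base point strictly inside the chord; the identity centred there is
        afterwards translated back by \<open>s\<close>.\<close>
      obtain s where s: "a < s" "s < b" and PP: "(q + s *\<^sub>R d \<in> D \<longrightarrow> ?P (q + s *\<^sub>R d)) \<and>
          (q + s *\<^sub>R d \<in> D \<longrightarrow> g (q + s *\<^sub>R d) = g' (q + s *\<^sub>R d))"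
        by (rule AE_exists_between[OF ae \<open>a < b\<close>])
      from PP have P: "q + s *\<^sub>R d \<in> D \<longrightarrow> ?P (q + s *\<^sub>R d)" by (rule conjunct1)
      have sh: "q + s *\<^sub>R d + r *\<^sub>R d = q + (s + r) *\<^sub>R d" for r by (simp add: algebra_simps)
      have "?P (q + s *\<^sub>R d)" by (rule P[THEN mp]) (use inD[of s] s in simp)
      from this[rule_format, of "a - s" "b - s", unfolded sh]
      have "((\<lambda>r. g (q + (s + r) *\<^sub>R d)) has_integral (f (q + b *\<^sub>R d) - f (q + a *\<^sub>R d))) {a - s..b - s}"
        using ab by simp
      from has_integral_shift[OF this, of "- s"] show ?thesis by simp
    qed (simp add: has_integral_refl)
    moreover have "AE s in lborel. s \<in> {a..b} \<longrightarrow> g (q + s *\<^sub>R d) = g' (q + s *\<^sub>R d)"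
      using ae by eventually_elim (use inD in auto)
    ultimately have "((\<lambda>s. g' (q + s *\<^sub>R d)) has_integral (f (q + b *\<^sub>R d) - f (q + a *\<^sub>R d))) {a..b}"
      by (rule has_integral_AE_cong[rotated])
    then show "((\<lambda>s. g' (p0 + y *\<^sub>R e + s *\<^sub>R d)) has_integral
       (f (p0 + y *\<^sub>R e + b *\<^sub>R d) - f (p0 + y *\<^sub>R e + a *\<^sub>R d))) {a..b}"
      by (simp add: q_def)
  qed
qed

section \<open>Product rule along lines\<close>

text \<open>As integrals of bounded functions, \<open>F\<close> and \<open>G\<close> are Lipschitz.
  Hence replacing them by their values at the ends of a short interval costs only an error quadratic
  in its length.\<close>

lemma integral_product_rule:
  fixes F G g h :: "real \<Rightarrow> real"
  assumes "a \<le> b"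
    and F: "\<And>x y. a \<le> x \<Longrightarrow> x \<le> y \<Longrightarrow> y \<le> b \<Longrightarrow> (g has_integral F y - F x) {x..y}"
    and G: "\<And>x y. a \<le> x \<Longrightarrow> x \<le> y \<Longrightarrow> y \<le> b \<Longrightarrow> (h has_integral G y - G x) {x..y}"
    and g: "g \<in> borel_measurable borel" "\<And>x. \<bar>g x\<bar> \<le> C"
    and h: "h \<in> borel_measurable borel" "\<And>x. \<bar>h x\<bar> \<le> C"
  shows "((\<lambda>s. F s * h s + G s * g s) has_integral F b * G b - F a * G a) {a..b}"
proof -
  have C: "0 \<le> C" using g(2)[of 0] by linarith
  have incr: "\<bar>F y - F x\<bar> \<le> C * (y - x)" "\<bar>G y - G x\<bar> \<le> C * (y - x)"
    if "a \<le> x" "x \<le> y" "y \<le> b" for x y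
    using has_integral_bound_real[OF C finite.emptyI F[OF that]] has_integral_bound_real[OF C finite.emptyI G[OF that]]
      g(2) h(2) that by auto
  have lip: "\<bar>F y - F x\<bar> \<le> C * \<bar>y - x\<bar>" "\<bar>G y - G x\<bar> \<le> C * \<bar>y - x\<bar>"
    if "x \<in> {a..b}" "y \<in> {a..b}" for x y
    using incr[of x y] incr[of y x] that by (cases "x \<le> y"; auto simp: abs_minus_commute)+
  \<comment> \<open>\<open>F\<close> and \<open>G\<close> are controlled only on
    \<open>{a..b}\<close>; composing with the projection onto this interval makes the integrand
    Borel and bounded on the whole line.\<close>
  define cl where "cl = (\<lambda>s. max a (min b s))"
  have cl: "cl s \<in> {a..b}" "s \<in> {a..b} \<Longrightarrow> cl s = s" for s using \<open>a \<le> b\<close> by (auto simp: cl_def)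
  have cont: "continuous_on {a..b} E" if "\<And>x y. x \<in> {a..b} \<Longrightarrow> y \<in> {a..b} \<Longrightarrow> \<bar>E y - E x\<bar> \<le> C * \<bar>y - x\<bar>"
    for E :: "real \<Rightarrow> real"
  proof -
    have "C-lipschitz_on {a..b} E"
      by (rule lipschitz_onI) (use that C in \<open>auto simp: dist_real_def abs_minus_commute\<close>)
    then show ?thesis by (rule lipschitz_on_continuous_on)
  qed
  have meas: "(\<lambda>s. E (cl s)) \<in> borel_measurable borel" if "continuous_on {a..b} E" for E :: "real \<Rightarrow> real"
  proof -
    have "continuous_on UNIV (\<lambda>s. E (cl s))"
      by (rule continuous_on_compose2[OF that]) (auto simp: cl_def intro!: continuous_intros \<open>a \<le> b\<close>)
    then show ?thesis by (rule borel_measurable_continuous_onI)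
  qed
  define \<psi> where "\<psi> = (\<lambda>s. F (cl s) * h s + G (cl s) * g s)"
  have bnd: "\<bar>F (cl s)\<bar> \<le> \<bar>F a\<bar> + C * (b - a)" "\<bar>G (cl s)\<bar> \<le> \<bar>G a\<bar> + C * (b - a)" for s
  proof -
    have "C * \<bar>cl s - a\<bar> \<le> C * (b - a)" using cl(1)[of s] C by (intro mult_left_mono) auto
    then show "\<bar>F (cl s)\<bar> \<le> \<bar>F a\<bar> + C * (b - a)" "\<bar>G (cl s)\<bar> \<le> \<bar>G a\<bar> + C * (b - a)"
      using lip[of a "cl s"] cl(1)[of s] \<open>a \<le> b\<close> by auto
  qed
  have int: "\<psi> integrable_on {x..y}" for x y
  proof (rule bounded_borel_integrable_on)
    show "\<psi> \<in> borel_measurable borel" unfolding \<psi>_def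
      using g(1) h(1) meas[OF cont[OF lip(1)]] meas[OF cont[OF lip(2)]] by measurable
    fix s
    have "\<bar>F (cl s) * h s\<bar> \<le> (\<bar>F a\<bar> + C * (b - a)) * C" "\<bar>G (cl s) * g s\<bar> \<le> (\<bar>G a\<bar> + C * (b - a)) * C"
      unfolding abs_mult using bnd[of s] g(2) h(2) C by (auto intro!: mult_mono)
    then show "\<bar>\<psi> s\<bar> \<le> (\<bar>F a\<bar> + C * (b - a)) * C + (\<bar>G a\<bar> + C * (b - a)) * C"
      unfolding \<psi>_def by linarith
  qed
  \<comment> \<open>\<open>F\<close> and \<open>G\<close> need not be differentiable, but \<open>\<Phi>\<close> varies quadratically and so is constant.\<close>
  define \<Phi> where "\<Phi> = (\<lambda>x. F x * G x - integral {a..x} \<psi>)"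
  have step: "\<bar>\<Phi> y - \<Phi> x\<bar> \<le> 2 * C\<^sup>2 * (y - x)\<^sup>2" if "a \<le> x" "x \<le> y" "y \<le> b" for x y
  proof -
    have "integral {a..x} \<psi> + integral {x..y} \<psi> = integral {a..y} \<psi>"
      using that int by (intro Henstock_Kurzweil_Integration.integral_combine) auto
    then have *: "integral {x..y} \<psi> = integral {a..y} \<psi> - integral {a..x} \<psi>" by simp
    \<comment> \<open>With \<open>F\<close> frozen at the right end and \<open>G\<close> at the left
      end, the integral is exactly \<open>F y * G y - F x * G x\<close>. Each freezing changes the
      integrand by at most \<open>C * (y - x) * C\<close>.\<close>
    have "((\<lambda>s. F y * h s + G x * g s - \<psi> s) has_integral
        F y * (G y - G x) + G x * (F y - F x) - (integral {a..y} \<psi> - integral {a..x} \<psi>)) {x..y}"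
      using integrable_integral[OF int[of x y], unfolded *]
      by (intro has_integral_diff has_integral_add has_integral_mult_right F G that)
    also have "F y * (G y - G x) + G x * (F y - F x) - (integral {a..y} \<psi> - integral {a..x} \<psi>) = \<Phi> y - \<Phi> x"
      by (simp add: \<Phi>_def algebra_simps)
    finally have "norm (\<Phi> y - \<Phi> x) \<le> 2 * C\<^sup>2 * (y - x) * measure lborel {x..y}"
    proof (rule has_integral_bound_real[rotated 2])
      show "0 \<le> 2 * C\<^sup>2 * (y - x)" using that by simp
      show "\<And>s. s \<in> {x..y} - {} \<Longrightarrow> norm (F y * h s + G x * g s - \<psi> s) \<le> 2 * C\<^sup>2 * (y - x)"
      proof -
        fix s assume "s \<in> {x..y} - {}"
        then have s: "x \<le> s" "s \<le> y" by auto
        have "\<bar>F y - F s\<bar> * \<bar>h s\<bar> \<le> (C * (y - x)) * C"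
          using incr(1)[of s y] s that C h(2) by (intro mult_mono) (auto intro: order_trans[OF _ mult_left_mono])
        moreover have "\<bar>G s - G x\<bar> * \<bar>g s\<bar> \<le> (C * (y - x)) * C"
          using incr(2)[of x s] s that C g(2) by (intro mult_mono) (auto intro: order_trans[OF _ mult_left_mono])
        moreover have "F y * h s + G x * g s - \<psi> s = (F y - F s) * h s - (G s - G x) * g s"
          using cl(2)[of s] s that by (simp add: \<psi>_def algebra_simps)
        moreover have "norm ((F y - F s) * h s - (G s - G x) * g s) \<le> \<bar>F y - F s\<bar> * \<bar>h s\<bar> + \<bar>G s - G x\<bar> * \<bar>g s\<bar>"
          unfolding real_norm_def abs_mult[symmetric] by (rule abs_triangle_ineq4)
        ultimately show "norm (F y * h s + G x * g s - \<psi> s) \<le> 2 * C\<^sup>2 * (y - x)"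
          by (simp add: power2_eq_square algebra_simps)
      qed
    qed simp
    then show ?thesis using that by (simp add: power2_eq_square algebra_simps)
  qed
  have "(\<Phi> has_field_derivative 0) (at x within {a..b})" if x: "x \<in> {a..b}" for x
    unfolding has_field_derivative_iff
  proof (rule Lim_null_comparison)
    show "((\<lambda>y. 2 * C\<^sup>2 * \<bar>y - x\<bar>) \<longlongrightarrow> 0) (at x within {a..b})"
      by (auto intro!: tendsto_eq_intros)
    show "\<forall>\<^sub>F y in at x within {a..b}. norm ((\<Phi> y - \<Phi> x) / (y - x)) \<le> 2 * C\<^sup>2 * \<bar>y - x\<bar>"
      unfolding eventually_at_filter
    proof (intro always_eventually allI impI)
      fix y assume y: "y \<noteq> x" "y \<in> {a..b}"
      have "\<bar>\<Phi> y - \<Phi> x\<bar> \<le> 2 * C\<^sup>2 * \<bar>y - x\<bar> * \<bar>y - x\<bar>"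
        using step[of x y] step[of y x] x y
        by (cases "x \<le> y"; auto simp: abs_minus_commute power2_eq_square algebra_simps)
      then show "norm ((\<Phi> y - \<Phi> x) / (y - x)) \<le> 2 * C\<^sup>2 * \<bar>y - x\<bar>"
        using y by (simp add: field_simps)
    qed
  qed
  then obtain c where c: "\<And>x. x \<in> {a..b} \<Longrightarrow> \<Phi> x = c"
    using has_field_derivative_zero_constant[of "{a..b}" \<Phi>] by auto
  have "integral {a..b} \<psi> = F b * G b - F a * G a"
    using c[of a] c[of b] \<open>a \<le> b\<close> by (simp add: \<Phi>_def)
  then have "(\<psi> has_integral F b * G b - F a * G a) {a..b}"
    using integrable_integral[OF int[of a b]] by simp
  then show ?thesis
    by (rule has_integral_eq[rotated]) (use cl(2) in \<open>simp add: \<psi>_def\<close>)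
qed

text \<open>The direction is normalised to \<open>(1, c)\<close> and \<open>y\<close> is the
  intercept of the line, so that states and kernels can be multiplied on a common family of
  lines.\<close>

definition transport_lines :: "(real \<times> real) set \<Rightarrow> real \<Rightarrow> (real \<times> real \<Rightarrow> real) \<Rightarrow> (real \<times> real \<Rightarrow> real) \<Rightarrow> bool"
  where "transport_lines D c f g \<longleftrightarrow>
    (AE y in lborel. \<forall>a b. a \<le> b \<and> (a, y + c * a) \<in> D \<and> (b, y + c * b) \<in> D \<longrightarrow>
      ((\<lambda>s. g (s, y + c * s)) has_integral f (b, y + c * b) - f (a, y + c * a)) {a..b})"

lemma convex_line:
  fixes D :: "(real \<times> real) set"
  assumes "convex D" "(a, y + c * a) \<in> D" "(b, y + c * b) \<in> D" "a \<le> s" "s \<le> b"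
  shows "(s, y + c * s) \<in> D"
proof (cases "a = b")
  case False
  with assms have "0 < b - a" by simp
  define r where "r = (s - a) / (b - a)"
  have "r * (b - a) = s - a" using \<open>0 < b - a\<close> by (simp add: r_def)
  then have s: "s = (1 - r) * a + r * b" by (simp add: algebra_simps)
  have r: "0 \<le> r" "r \<le> 1" using assms \<open>0 < b - a\<close> by (auto simp: r_def)
  have "(1 - r) *\<^sub>R (a, y + c * a) + r *\<^sub>R (b, y + c * b) \<in> D"
    using assms r by (auto simp: convex_alt simp del: scaleR_Pair)
  also have "(1 - r) *\<^sub>R (a, y + c * a) + r *\<^sub>R (b, y + c * b) = (s, y + c * s)"
    by (simp add: s algebra_simps)
  finally show ?thesis .
qed (use assms in simp)

lemma borel_measurable_line:
  fixes f :: "real \<times> real \<Rightarrow> real"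
  assumes "f \<in> borel_measurable borel"
  shows "(\<lambda>s. f (a + b * s, c + d * s)) \<in> borel_measurable borel"
proof (rule measurable_compose[OF _ assms])
  show "(\<lambda>s. (a + b * s, c + d * s)) \<in> borel_measurable borel"
    by (intro borel_measurable_continuous_onI continuous_intros)
qed

text \<open>The factors in the new right side are the representatives \<open>h1\<close> and
  \<open>h2\<close>, which makes it suitable for integration over the plane, while the end values
  keep the given functions.\<close>

lemma transport_lines_mult:
  assumes f: "transport_lines D c f1 g1" "transport_lines D c f2 g2" and D: "convex D"
    and g1: "g1 \<in> borel_measurable borel" "\<And>x. \<bar>g1 x\<bar> \<le> C"
    and g2: "g2 \<in> borel_measurable borel" "\<And>x. \<bar>g2 x\<bar> \<le> C"
    and eq: "AE p in lborel. p \<in> D \<longrightarrow> f1 p = h1 p" "AE p in lborel. p \<in> D \<longrightarrow> f2 p = h2 p"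
  shows "transport_lines D c (\<lambda>p. f1 p * f2 p) (\<lambda>p. h1 p * g2 p + h2 p * g1 p)"
proof -
  have "AE p in lborel. p \<in> D \<longrightarrow> f1 p = h1 p \<and> f2 p = h2 p" using eq by eventually_elim auto
  from AE_affine2D[OF this, of 0 c 1 1 0 0]
  have "AE y in lborel. AE s in lborel. (s, y + c * s) \<in> D \<longrightarrow>
      f1 (s, y + c * s) = h1 (s, y + c * s) \<and> f2 (s, y + c * s) = h2 (s, y + c * s)"
    by simp
  with f show ?thesis unfolding transport_lines_def
  proof (eventually_elim, intro allI impI)
    fix y a b :: real
    assume 1: "\<forall>a b. a \<le> b \<and> (a, y + c * a) \<in> D \<and> (b, y + c * b) \<in> D \<longrightarrow>
        ((\<lambda>s. g1 (s, y + c * s)) has_integral f1 (b, y + c * b) - f1 (a, y + c * a)) {a..b}"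
      and 2: "\<forall>a b. a \<le> b \<and> (a, y + c * a) \<in> D \<and> (b, y + c * b) \<in> D \<longrightarrow>
        ((\<lambda>s. g2 (s, y + c * s)) has_integral f2 (b, y + c * b) - f2 (a, y + c * a)) {a..b}"
      and ae: "AE s in lborel. (s, y + c * s) \<in> D \<longrightarrow>
        f1 (s, y + c * s) = h1 (s, y + c * s) \<and> f2 (s, y + c * s) = h2 (s, y + c * s)"
      and ab: "a \<le> b \<and> (a, y + c * a) \<in> D \<and> (b, y + c * b) \<in> D"
    have inD: "(s, y + c * s) \<in> D" if "a \<le> s" "s \<le> b" for s
      using convex_line[OF D _ _ that] ab by blast
    have "((\<lambda>s. f1 (s, y + c * s) * g2 (s, y + c * s) + f2 (s, y + c * s) * g1 (s, y + c * s)) has_integral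
      f1 (b, y + c * b) * f2 (b, y + c * b) - f1 (a, y + c * a) * f2 (a, y + c * a)) {a..b}"
      using borel_measurable_line[OF g1(1), of 0 1 y c] borel_measurable_line[OF g2(1), of 0 1 y c] ab g1(2) g2(2)
      by (intro integral_product_rule[where C = C] 1[rule_format] 2[rule_format]) (auto intro!: inD)
    moreover have "AE s in lborel. s \<in> {a..b} \<longrightarrow>
        f1 (s, y + c * s) * g2 (s, y + c * s) + f2 (s, y + c * s) * g1 (s, y + c * s) =
        h1 (s, y + c * s) * g2 (s, y + c * s) + h2 (s, y + c * s) * g1 (s, y + c * s)"
      using ae by eventually_elim (use inD in auto)
    ultimately show "((\<lambda>s. h1 (s, y + c * s) * g2 (s, y + c * s) + h2 (s, y + c * s) * g1 (s, y + c * s)) has_integral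
      f1 (b, y + c * b) * f2 (b, y + c * b) - f1 (a, y + c * a) * f2 (a, y + c * a)) {a..b}"
      by (rule has_integral_AE_cong[rotated])
  qed
qed

section \<open>Divergence theorem on trapezoids\<close>

text \<open>For lines that enter through one lateral side and leave through the other. The chord
  runs from max 0 \<alpha> to min S \<beta>, and excluding corners puts each end on exactly one
  side. If the chord is empty, \<open>cover\<close> excludes a lateral crossing that would leave a
  stray term.\<close>

lemma chord_lower_upper:
  fixes G H :: "real \<Rightarrow> real"
  assumes H: "\<And>a b. a \<le> b \<Longrightarrow> {a, b} \<subseteq> {s. 0 \<le> s \<and> s \<le> S \<and> \<alpha> \<le> s \<and> s \<le> \<beta>} \<Longrightarrow> (G has_integral H b - H a) {a..b}"
    and "0 < S" "\<alpha> \<noteq> 0" "\<alpha> \<noteq> S" "\<beta> \<noteq> 0" "\<beta> \<noteq> S"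
    and cover: "\<And>s. 0 \<le> s \<Longrightarrow> s \<le> S \<Longrightarrow> \<alpha> \<le> s \<or> s \<le> \<beta>"
  shows "(G has_integral (if \<alpha> < S \<and> S < \<beta> then H S else 0) - (if \<alpha> < 0 \<and> 0 < \<beta> then H 0 else 0)
     + (if 0 < \<beta> \<and> \<beta> < S then H \<beta> else 0) - (if 0 < \<alpha> \<and> \<alpha> < S then H \<alpha> else 0))
     {s. 0 \<le> s \<and> s \<le> S \<and> \<alpha> \<le> s \<and> s \<le> \<beta>}" (is "(G has_integral ?I) ?C")
proof (cases "max 0 \<alpha> \<le> min S \<beta>")
  case True
  have "?C = {max 0 \<alpha>..min S \<beta>}" by auto
  moreover have "(G has_integral H (min S \<beta>) - H (max 0 \<alpha>)) {max 0 \<alpha>..min S \<beta>}"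
    using True by (intro H) auto
  moreover have "H (min S \<beta>) - H (max 0 \<alpha>) = ?I"
    using assms True by (auto simp: max_def min_def split: if_splits)
  ultimately show ?thesis by simp
next
  case False
  then have "?C = {}" by auto
  moreover have "?I = 0"
    using cover[of 0] cover[of S] cover[of "(\<alpha> + \<beta>) / 2"] assms(2-6) False
    by (auto simp: max_def min_def split: if_splits)
  ultimately show ?thesis by (simp only: has_integral_empty)
qed

text \<open>For lines that can only leave through the lateral sides, so that every chord starts at
  the bottom; \<open>cover\<close> says that at most one exit happens before
  \<open>S\<close>.\<close>

lemma chord_upper_upper:
  fixes G H :: "real \<Rightarrow> real"
  assumes H: "\<And>a b. a \<le> b \<Longrightarrow> {a, b} \<subseteq> {s. 0 \<le> s \<and> s \<le> S \<and> s \<le> \<alpha> \<and> s \<le> \<beta>} \<Longrightarrow> (G has_integral H b - H a) {a..b}"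
    and "0 < S" "\<alpha> \<noteq> 0" "\<alpha> \<noteq> S" "\<beta> \<noteq> 0" "\<beta> \<noteq> S"
    and cover: "S \<le> \<alpha> \<or> S \<le> \<beta>"
  shows "(G has_integral (if S < \<alpha> \<and> S < \<beta> then H S else 0) - (if 0 < \<alpha> \<and> 0 < \<beta> then H 0 else 0)
     + (if 0 < \<beta> \<and> \<beta> < S then H \<beta> else 0) + (if 0 < \<alpha> \<and> \<alpha> < S then H \<alpha> else 0))
     {s. 0 \<le> s \<and> s \<le> S \<and> s \<le> \<alpha> \<and> s \<le> \<beta>}" (is "(G has_integral ?I) ?C")
proof (cases "0 \<le> min \<alpha> \<beta>")
  case True
  have "?C = {0..min S (min \<alpha> \<beta>)}" by auto
  moreover have "(G has_integral H (min S (min \<alpha> \<beta>)) - H 0) {0..min S (min \<alpha> \<beta>)}"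
    using True \<open>0 < S\<close> by (intro H) auto
  moreover have "H (min S (min \<alpha> \<beta>)) - H 0 = ?I"
    using assms True by (auto simp: min_def split: if_splits)
  ultimately show ?thesis by simp
next
  case False
  then have "?C = {}" by auto
  moreover have "?I = 0"
    using assms(2-7) False by (auto simp: min_def split: if_splits)
  ultimately show ?thesis by (simp only: has_integral_empty)
qed

text \<open>
  The four terms belong to the top, bottom, right and left side of the trapezoid; the signs of \<open>c\<close> and
  \<open>c + \<mu>\<close> tell whether the line enters or leaves through the left and the right side.
\<close>

lemma chord_integral:
  fixes G H :: "real \<Rightarrow> real"
  assumes H: "\<And>a b. a \<le> b \<Longrightarrow> {a, b} \<subseteq> {s. 0 \<le> s \<and> s \<le> S \<and> 0 \<le> y + c * s \<and> y + c * s \<le> X - \<mu> * s} \<Longrightarrow>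
      (G has_integral H b - H a) {a..b}"
    and S: "0 < S" "0 < \<mu>" "\<mu> * S \<le> X" and c: "c \<noteq> 0"
    and y: "y \<noteq> 0" "y \<noteq> - c * S" "y \<noteq> X" "y \<noteq> X - (c + \<mu>) * S"
  shows "(G has_integral (if 0 < y + c * S \<and> y + c * S < X - \<mu> * S then H S else 0)
     - (if 0 < y \<and> y < X then H 0 else 0)
     + sgn (c + \<mu>) * (if 0 < (X - y) / (c + \<mu>) \<and> (X - y) / (c + \<mu>) < S then H ((X - y) / (c + \<mu>)) else 0)
     - sgn c * (if 0 < - y / c \<and> - y / c < S then H (- y / c) else 0))
     {s. 0 \<le> s \<and> s \<le> S \<and> 0 \<le> y + c * s \<and> y + c * s \<le> X - \<mu> * s}"
proof -
  define \<alpha> where "\<alpha> = - y / c"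
  define \<beta> where "\<beta> = (X - y) / (c + \<mu>)"
  have y\<alpha>: "y = - c * \<alpha>" using c by (simp add: \<alpha>_def)
  then have y\<beta>: "X = (c + \<mu>) * \<beta> - c * \<alpha>" if "c + \<mu> \<noteq> 0" using that by (simp add: \<beta>_def)
  have \<alpha>: "\<alpha> \<noteq> 0" "\<alpha> \<noteq> S" using y y\<alpha> by auto
  have \<beta>: "\<beta> \<noteq> 0" "\<beta> \<noteq> S" if "c + \<mu> \<noteq> 0" using y y\<alpha> y\<beta>[OF that] by auto
  have A: "0 \<le> y + c * s \<longleftrightarrow> 0 \<le> c * (s - \<alpha>)" "0 < y + c * s \<longleftrightarrow> 0 < c * (s - \<alpha>)" for s
    using y\<alpha> by (auto simp: algebra_simps)
  have B: "y + c * s \<le> X - \<mu> * s \<longleftrightarrow> 0 \<le> (c + \<mu>) * (\<beta> - s)" "y + c * s < X - \<mu> * s \<longleftrightarrow> 0 < (c + \<mu>) * (\<beta> - s)"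
    if "c + \<mu> \<noteq> 0" for s
    using y\<alpha> y\<beta>[OF that] by (auto simp: algebra_simps)
  \<comment> \<open>Since \<mu> S \<le> X, the right side never gets to the left of \<xi> = 0, and
    no point of height at most \<open>S\<close> is beyond both lateral sides.\<close>
  have cover: "0 \<le> y + c * s \<or> y + c * s \<le> X - \<mu> * s" if "s \<le> S" for s
    using mult_left_mono[OF that, of \<mu>] S by linarith
  have A0: "0 < y \<longleftrightarrow> c * \<alpha> < 0" using A(2)[of 0] by simp
  have B0: "y < X \<longleftrightarrow> 0 < (c + \<mu>) * \<beta>" if "c + \<mu> \<noteq> 0" using B(2)[OF that, of 0] by simp
  \<comment> \<open>In order: entry left and exit right; exit on both sides; parallel to the right
    side; entry right and exit left.\<close>
  consider "0 < c" | "c < 0" "0 < c + \<mu>" | "c < 0" "c + \<mu> = 0" | "c < 0" "c + \<mu> < 0"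
    using c by linarith
  then show ?thesis
  proof cases
    case 1
    then have pos: "0 < c" "0 < c + \<mu>" "c + \<mu> \<noteq> 0" using S by auto
    note AB = A B[OF pos(3)]
    have "(G has_integral (if \<alpha> < S \<and> S < \<beta> then H S else 0) - (if \<alpha> < 0 \<and> 0 < \<beta> then H 0 else 0)
     + (if 0 < \<beta> \<and> \<beta> < S then H \<beta> else 0) - (if 0 < \<alpha> \<and> \<alpha> < S then H \<alpha> else 0))
     {s. 0 \<le> s \<and> s \<le> S \<and> \<alpha> \<le> s \<and> s \<le> \<beta>}"
    proof (rule chord_lower_upper)
      show "\<alpha> \<le> s \<or> s \<le> \<beta>" if "0 \<le> s" "s \<le> S" for s
        using cover[OF that(2)] pos unfolding AB by (auto simp: zero_le_mult_iff)
    qed (use S \<alpha> \<beta> pos H in \<open>auto simp: AB zero_le_mult_iff\<close>)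
    then show ?thesis
      using pos unfolding \<alpha>_def[symmetric] \<beta>_def[symmetric] AB A0 B0[OF pos(3)]
      by (simp add: zero_le_mult_iff zero_less_mult_iff mult_less_0_iff)
  next
    case 2
    then have pos: "c < 0" "\<not> 0 < c" "0 < c + \<mu>" "c + \<mu> \<noteq> 0" using S by auto
    note AB = A B[OF pos(4)]
    have "(G has_integral (if S < \<alpha> \<and> S < \<beta> then H S else 0) - (if 0 < \<alpha> \<and> 0 < \<beta> then H 0 else 0)
     + (if 0 < \<beta> \<and> \<beta> < S then H \<beta> else 0) + (if 0 < \<alpha> \<and> \<alpha> < S then H \<alpha> else 0))
     {s. 0 \<le> s \<and> s \<le> S \<and> s \<le> \<alpha> \<and> s \<le> \<beta>}"
    proof (rule chord_upper_upper)
      show "S \<le> \<alpha> \<or> S \<le> \<beta>"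
        using cover[OF order.refl] pos unfolding AB by (auto simp: zero_le_mult_iff)
    qed (use S \<alpha> \<beta> pos H in \<open>auto simp: AB zero_le_mult_iff\<close>)
    then show ?thesis
      using pos unfolding \<alpha>_def[symmetric] \<beta>_def[symmetric] AB A0 B0[OF pos(4)]
      by (simp add: zero_le_mult_iff zero_less_mult_iff mult_less_0_iff)
  next
    case 3
    then have \<mu>: "\<mu> = - c" by simp
    show ?thesis
    proof (cases "y < X")
      case True
      have "(G has_integral (if S < \<alpha> \<and> S < S + 1 then H S else 0) - (if 0 < \<alpha> \<and> 0 < S + 1 then H 0 else 0)
       + (if 0 < S + 1 \<and> S + 1 < S then H (S + 1) else 0) + (if 0 < \<alpha> \<and> \<alpha> < S then H \<alpha> else 0))
       {s. 0 \<le> s \<and> s \<le> S \<and> s \<le> \<alpha> \<and> s \<le> S + 1}"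
        by (rule chord_upper_upper) (use S \<alpha> 3 True H in \<open>auto simp: A \<mu> zero_le_mult_iff\<close>)
      moreover have "{s. 0 \<le> s \<and> s \<le> S \<and> s \<le> \<alpha> \<and> s \<le> S + 1} =
          {s. 0 \<le> s \<and> s \<le> S \<and> 0 \<le> y + c * s \<and> y + c * s \<le> X - \<mu> * s}"
        using 3 True by (auto simp: A \<mu> zero_le_mult_iff)
      ultimately show ?thesis
        using 3 True \<open>0 < S\<close> unfolding \<alpha>_def[symmetric] A A0
        by (simp add: \<mu> zero_less_mult_iff mult_less_0_iff)
    next
      case False
      then have F: "X < y" using y by simp
      \<comment> \<open>The line stays beyond the right side, so the chord is empty; it meets \<xi>
        = 0 only after the top, and the left term vanishes too.\<close>
      have "S < \<alpha>"
      proof -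
        have "X < \<mu> * \<alpha>" using F y\<alpha> \<mu> by simp
        with S(3) have "\<mu> * S < \<mu> * \<alpha>" by linarith
        then show ?thesis using S(2) by simp
      qed
      moreover have "{s. 0 \<le> s \<and> s \<le> S \<and> 0 \<le> y + c * s \<and> y + c * s \<le> X - \<mu> * s} = {}"
        using F by (auto simp: \<mu>)
      ultimately show ?thesis
        using F 3 unfolding \<alpha>_def[symmetric] by (simp add: \<mu>)
    qed
  next
    case 4
    then have neg: "c < 0" "\<not> 0 < c" "\<not> 0 < c + \<mu>" "c + \<mu> < 0" "c + \<mu> \<noteq> 0" by auto
    note AB = A B[OF neg(5)]
    have "(G has_integral (if \<beta> < S \<and> S < \<alpha> then H S else 0) - (if \<beta> < 0 \<and> 0 < \<alpha> then H 0 else 0)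
     + (if 0 < \<alpha> \<and> \<alpha> < S then H \<alpha> else 0) - (if 0 < \<beta> \<and> \<beta> < S then H \<beta> else 0))
     {s. 0 \<le> s \<and> s \<le> S \<and> \<beta> \<le> s \<and> s \<le> \<alpha>}"
    proof (rule chord_lower_upper)
      show "\<beta> \<le> s \<or> s \<le> \<alpha>" if "0 \<le> s" "s \<le> S" for s
        using cover[OF that(2)] neg unfolding AB by (auto simp: zero_le_mult_iff)
    qed (use S \<alpha> \<beta> neg H in \<open>auto simp: AB zero_le_mult_iff\<close>)
    moreover have "p - q + r - t = p - q - t + r" for p q r t :: real by simp
    ultimately show ?thesis
      using neg unfolding \<alpha>_def[symmetric] \<beta>_def[symmetric] AB A0 B0[OF neg(5)]
      by (simp add: zero_le_mult_iff zero_less_mult_iff mult_less_0_iff conj_ac)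
  qed
qed

text \<open>Turns an integral over a side of the trapezoid into one over the intercepts of the lines
  hitting that side. The strict inequalities, differing at two points only, match the side terms of
  \<open>chord_integral\<close>.\<close>

lemma has_integral_affine_UNIV:
  fixes h :: "real \<Rightarrow> real"
  assumes "(h has_integral I) {0..S}" "m \<noteq> 0"
  shows "((\<lambda>y. if 0 < m * y + k \<and> m * y + k < S then h (m * y + k) else 0) has_integral I / \<bar>m\<bar>) UNIV"
proof -
  have "((\<lambda>y. h (m * y + k)) has_integral I / \<bar>m\<bar>) {y. 0 \<le> m * y + k \<and> m * y + k \<le> S}"
  proof -
    have "(\<lambda>x. (1 / m) *\<^sub>R x + -((1 / m) *\<^sub>R k)) ` cbox 0 S = {y. 0 \<le> m * y + k \<and> m * y + k \<le> S}"
    proof (intro equalityI subsetI)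
      fix y assume "y \<in> {y. 0 \<le> m * y + k \<and> m * y + k \<le> S}"
      then show "y \<in> (\<lambda>x. (1 / m) *\<^sub>R x + -((1 / m) *\<^sub>R k)) ` cbox 0 S"
        using assms(2) by (intro image_eqI[of _ _ "m * y + k"]) (auto simp: field_simps)
    qed (use assms(2) in \<open>auto simp: field_simps\<close>)
    then show ?thesis using has_integral_affinity[of h I 0 S m k] assms by simp
  qed
  then have "((\<lambda>y. if y \<in> {y. 0 \<le> m * y + k \<and> m * y + k \<le> S} then h (m * y + k) else 0) has_integral I / \<bar>m\<bar>) UNIV"
    by (subst has_integral_restrict_UNIV)
  then show ?thesis
  proof (rule has_integral_spike[of "{- k / m, (S - k) / m}", rotated 2])
    fix y assume "y \<in> UNIV - {- k / m, (S - k) / m}"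
    then have "m * y + k \<noteq> 0" "m * y + k \<noteq> S" using assms(2) by (auto simp: field_simps)
    then show "(if 0 < m * y + k \<and> m * y + k < S then h (m * y + k) else 0) =
        (if y \<in> {y. 0 \<le> m * y + k \<and> m * y + k \<le> S} then h (m * y + k) else 0)" by auto
  qed simp
qed


lemma integrable_bounded_support:
  fixes f :: "'a::euclidean_space \<Rightarrow> real"
  assumes "f \<in> borel_measurable borel" "\<And>x. \<bar>f x\<bar> \<le> C" "\<And>x. x \<notin> cbox a b \<Longrightarrow> f x = 0"
  shows "integrable lborel f"
  by (rule integrableI_bounded_set[where A = "cbox a b" and B = C]) (use assms in \<open>auto simp: emeasure_lborel_cbox_eq\<close>)

text \<open>The chord identity is integrated over all intercepts \<open>y\<close>. Fubini turns the
  chord integrals into the area integral, and each side term becomes an integral over that side. The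
  premise on the right side is conditional because its flux factor \<open>c + \<mu>\<close> vanishes
  when the lines are parallel to it.\<close>

lemma trapezoid_balance:
  fixes f g :: "real \<times> real \<Rightarrow> real"
  defines "D \<equiv> \<lambda>S X \<mu>. {(s, \<xi>). 0 \<le> s \<and> s \<le> S \<and> 0 \<le> \<xi> \<and> \<xi> \<le> X - \<mu> * s}"
  assumes S: "0 < S" "0 < \<mu>" "\<mu> * S \<le> X" and c: "c \<noteq> 0"
    and f: "transport_lines (D S X \<mu>) c f g"
    and g: "g \<in> borel_measurable borel" "\<And>p. \<bar>g p\<bar> \<le> C"
    and top: "((\<lambda>\<xi>. f (S, \<xi>)) has_integral It) {0..X - \<mu> * S}"
    and bot: "((\<lambda>\<xi>. f (0, \<xi>)) has_integral Ib) {0..X}"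
    and left: "((\<lambda>s. f (s, 0)) has_integral Il) {0..S}"
    and right: "c + \<mu> \<noteq> 0 \<Longrightarrow> ((\<lambda>s. f (s, X - \<mu> * s)) has_integral Ir) {0..S}"
  shows "It - Ib + (c + \<mu>) * Ir - c * Il = (LINT p|lborel. indicator (D S X \<mu>) p * g p)"
proof -
  define \<phi> where "\<phi> = (\<lambda>p. indicator (D S X \<mu>) p * g p)"
  have C: "0 \<le> C" using g(2)[of 0] by linarith
  have "closed (D S X \<mu>)" unfolding D_def case_prod_beta
    by (intro closed_Collect_conj closed_Collect_le continuous_intros)
  then have \<phi>_meas: "\<phi> \<in> borel_measurable borel"
    unfolding \<phi>_def using g(1) by (intro borel_measurable_times borel_measurable_indicator) auto
  have \<phi>_bnd: "\<bar>\<phi> p\<bar> \<le> C" for p using g(2)[of p] C by (auto simp: \<phi>_def indicator_def)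
  have \<phi>_supp: "0 \<le> s \<and> s \<le> S \<and> 0 \<le> \<xi> \<and> \<xi> \<le> X" if "\<phi> (s, \<xi>) \<noteq> 0" for s \<xi>
  proof -
    have *: "(s, \<xi>) \<in> D S X \<mu>" using that by (auto simp: \<phi>_def indicator_def split: if_splits)
    then have "0 \<le> \<mu> * s" using S by (auto simp: D_def)
    with * show ?thesis by (auto simp: D_def)
  qed
  \<comment> \<open>Sheared coordinates: intercept \<open>y\<close> and parameter \<open>s\<close>.
    The shear preserves area, so no Jacobian appears.\<close>
  define \<psi> where "\<psi> = (\<lambda>p. \<phi> (snd p, fst p + c * snd p))"
  have \<psi>_meas: "\<psi> \<in> borel_measurable borel" unfolding \<psi>_def
    by (rule measurable_compose[OF _ \<phi>_meas]) (intro borel_measurable_continuous_onI continuous_intros)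
  have \<psi>_int: "integrable (lborel \<Otimes>\<^sub>M lborel) \<psi>"
    unfolding lborel_prod
  proof (rule integrable_bounded_support[of _ C "(- (\<bar>c\<bar> * S), 0)" "(X + \<bar>c\<bar> * S, S)"])
    fix p :: "real \<times> real" assume "p \<notin> cbox (- (\<bar>c\<bar> * S), 0) (X + \<bar>c\<bar> * S, S)"
    moreover have "p \<in> cbox (- (\<bar>c\<bar> * S), 0) (X + \<bar>c\<bar> * S, S)" if "\<psi> p \<noteq> 0"
    proof -
      have *: "0 \<le> snd p" "snd p \<le> S" "0 \<le> fst p + c * snd p" "fst p + c * snd p \<le> X"
        using \<phi>_supp that by (auto simp: \<psi>_def)
      have "\<bar>c * snd p\<bar> \<le> \<bar>c\<bar> * S" unfolding abs_mult using * by (intro mult_left_mono) auto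
      with * show ?thesis by (cases p) (auto simp: cbox_Pair_eq)
    qed
    ultimately show "\<psi> p = 0" by blast
  qed (use \<psi>_meas \<phi>_bnd in \<open>auto simp: \<psi>_def\<close>)
  define inner where "inner = (\<lambda>y. LINT s|lborel. \<phi> (s, y + c * s))"
  have "integrable lborel inner" and inner: "integral\<^sup>L lborel inner = (LINT s|lborel. LINT y|lborel. \<phi> (s, y + c * s))"
    using lborel_pair.integrable_fst'[OF \<psi>_int]
      lborel_pair.Fubini_integral[of "\<lambda>y s. \<phi> (s, y + c * s)", symmetric] \<psi>_int
    by (simp_all add: inner_def \<psi>_def case_prod_unfold)
  note inner
  also have "(LINT s|lborel. LINT y|lborel. \<phi> (s, y + c * s)) = (LINT s|lborel. LINT \<xi>|lborel. \<phi> (s, \<xi>))"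
    using lborel_integral_real_affine[of 1 "\<lambda>\<xi>. \<phi> (s, \<xi>)" "c * s" for s] by (simp add: add.commute)
  also have "\<dots> = integral\<^sup>L lborel \<phi>"
  proof -
    have "integrable (lborel \<Otimes>\<^sub>M lborel) \<phi>" unfolding lborel_prod
    proof (rule integrable_bounded_support[of _ C "(0, 0)" "(S, X)"])
      fix p :: "real \<times> real" assume "p \<notin> cbox (0, 0) (S, X)"
      then show "\<phi> p = 0" using \<phi>_supp[of "fst p" "snd p"] by (cases p) (auto simp: cbox_Pair_eq)
    qed (use \<phi>_meas \<phi>_bnd in auto)
    from lborel_pair.integral_fst'[OF this] show ?thesis by (simp add: lborel_prod)
  qed
  finally have "(inner has_integral integral\<^sup>L lborel \<phi>) UNIV"
    using has_integral_integral_lborel[OF \<open>integrable lborel inner\<close>] by simp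
  moreover have "(inner has_integral It - Ib + (c + \<mu>) * Ir - c * Il) UNIV"
  proof -
    let ?T = "\<lambda>y. if 0 < y + c * S \<and> y + c * S < X - \<mu> * S then f (S, y + c * S) else 0"
    let ?B = "\<lambda>y. if 0 < y \<and> y < X then f (0, y) else 0"
    let ?R = "\<lambda>y. if 0 < (X - y) / (c + \<mu>) \<and> (X - y) / (c + \<mu>) < S
       then f ((X - y) / (c + \<mu>), X - \<mu> * ((X - y) / (c + \<mu>))) else 0"
    let ?L = "\<lambda>y. if 0 < - y / c \<and> - y / c < S then f (- y / c, 0) else 0"
    have "(?T has_integral It) UNIV"
      using has_integral_affine_UNIV[OF top, of 1 "c * S"] by (simp cong: if_cong)
    moreover have "(?B has_integral Ib) UNIV"
      using has_integral_affine_UNIV[OF bot, of 1 0] by (simp cong: if_cong)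
    moreover have "((\<lambda>y. sgn (c + \<mu>) * ?R y) has_integral (c + \<mu>) * Ir) UNIV"
    proof (cases "c + \<mu> = 0")
      case False
      have eq: "- 1 / (c + \<mu>) * y + X / (c + \<mu>) = (X - y) / (c + \<mu>)" for y
        by (simp add: diff_divide_distrib)
      have "(?R has_integral Ir / \<bar>- 1 / (c + \<mu>)\<bar>) UNIV"
        using has_integral_affine_UNIV[OF right[OF False], of "- 1 / (c + \<mu>)" "X / (c + \<mu>)"] False
        unfolding eq by simp
      \<comment> \<open>The orientation sign times the Jacobian, the modulus of
        \<open>c + \<mu>\<close>, is the flux factor \<open>c + \<mu>\<close> itself.\<close>
      from has_integral_mult_right[OF this, of "sgn (c + \<mu>)"] show ?thesis
        by (simp add: mult.assoc[symmetric] sgn_mult_abs mult.commute[of Ir])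
    qed simp
    moreover have "((\<lambda>y. sgn c * ?L y) has_integral c * Il) UNIV"
    proof -
      have eq: "- 1 / c * y + 0 = - y / c" for y by simp
      have "(?L has_integral Il / \<bar>- 1 / c\<bar>) UNIV"
        using has_integral_affine_UNIV[OF left, of "- 1 / c" 0] c unfolding eq by simp
      from has_integral_mult_right[OF this, of "sgn c"] show ?thesis
        by (simp add: mult.assoc[symmetric] sgn_mult_abs mult.commute[of Il])
    qed
    ultimately have "((\<lambda>y. ?T y - ?B y + sgn (c + \<mu>) * ?R y - sgn c * ?L y) has_integral
        It - Ib + (c + \<mu>) * Ir - c * Il) UNIV"
      by (intro has_integral_diff has_integral_add)
    moreover have "AE y in lborel. y \<in> UNIV \<longrightarrow> ?T y - ?B y + sgn (c + \<mu>) * ?R y - sgn c * ?L y = inner y"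
    proof -
      \<comment> \<open>The excluded intercepts belong to the lines through the four corners of the
        trapezoid.\<close>
      have "negligible {0, - c * S, X, X - (c + \<mu>) * S}" by simp
      then have "AE y in lborel. y \<notin> {0, - c * S, X, X - (c + \<mu>) * S}"
        unfolding AE_lborel_iff_negligible not_not Collect_mem_eq .
      with f show ?thesis unfolding transport_lines_def
      proof (eventually_elim, intro impI)
        fix y
        assume line: "\<forall>a b. a \<le> b \<and> (a, y + c * a) \<in> D S X \<mu> \<and> (b, y + c * b) \<in> D S X \<mu> \<longrightarrow>
            ((\<lambda>s. g (s, y + c * s)) has_integral f (b, y + c * b) - f (a, y + c * a)) {a..b}"
          and y: "y \<notin> {0, - c * S, X, X - (c + \<mu>) * S}"
        let ?C = "{s. 0 \<le> s \<and> s \<le> S \<and> 0 \<le> y + c * s \<and> y + c * s \<le> X - \<mu> * s}"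
        have chord: "((\<lambda>s. g (s, y + c * s)) has_integral
             (if 0 < y + c * S \<and> y + c * S < X - \<mu> * S then f (S, y + c * S) else 0)
           - (if 0 < y \<and> y < X then f (0, y + c * 0) else 0)
           + sgn (c + \<mu>) * (if 0 < (X - y) / (c + \<mu>) \<and> (X - y) / (c + \<mu>) < S
               then f ((X - y) / (c + \<mu>), y + c * ((X - y) / (c + \<mu>))) else 0)
           - sgn c * (if 0 < - y / c \<and> - y / c < S then f (- y / c, y + c * (- y / c)) else 0)) ?C"
          by (rule chord_integral[where H = "\<lambda>s. f (s, y + c * s)"]) (use line S c y in \<open>auto simp: D_def\<close>)
        have "y + c * ((X - y) / (c + \<mu>)) = X - \<mu> * ((X - y) / (c + \<mu>))" if "c + \<mu> \<noteq> 0"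
        proof -
          have "(c + \<mu>) * ((X - y) / (c + \<mu>)) = X - y" using that by simp
          then show ?thesis unfolding distrib_right by linarith
        qed
        then have R: "sgn (c + \<mu>) * (if 0 < (X - y) / (c + \<mu>) \<and> (X - y) / (c + \<mu>) < S
               then f ((X - y) / (c + \<mu>), y + c * ((X - y) / (c + \<mu>))) else 0) = sgn (c + \<mu>) * ?R y"
          by (cases "c + \<mu> = 0") auto
        have L: "y + c * (- y / c) = 0" using c by simp
        from chord have "((\<lambda>s. g (s, y + c * s)) has_integral ?T y - ?B y + sgn (c + \<mu>) * ?R y - sgn c * ?L y) ?C"
          unfolding R L mult_zero_right add_0_right .
        then have "((\<lambda>s. if s \<in> ?C then g (s, y + c * s) else 0) has_integral
            ?T y - ?B y + sgn (c + \<mu>) * ?R y - sgn c * ?L y) UNIV"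
          by (subst has_integral_restrict_UNIV)
        moreover have "(\<lambda>s. if s \<in> ?C then g (s, y + c * s) else 0) = (\<lambda>s. \<phi> (s, y + c * s))"
          by (auto simp: \<phi>_def D_def indicator_def)
        ultimately have "((\<lambda>s. \<phi> (s, y + c * s)) has_integral ?T y - ?B y + sgn (c + \<mu>) * ?R y - sgn c * ?L y) UNIV"
          by simp
        moreover have "integrable lborel (\<lambda>s. \<phi> (s, y + c * s))"
        proof (rule integrable_bounded_support[of _ C 0 S])
          show "(\<lambda>s. \<phi> (s, y + c * s)) \<in> borel_measurable borel"
            using borel_measurable_line[OF \<phi>_meas, of 0 1 y c] by simp
        qed (use \<phi>_bnd \<phi>_supp in auto)
        then have "((\<lambda>s. \<phi> (s, y + c * s)) has_integral inner y) UNIV"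
          unfolding inner_def by (rule has_integral_integral_lborel)
        ultimately show "?T y - ?B y + sgn (c + \<mu>) * ?R y - sgn c * ?L y = inner y"
          by (rule has_integral_unique)
      qed
    qed
    ultimately show ?thesis by (rule has_integral_AE_cong[rotated])
  qed
  ultimately show ?thesis unfolding \<phi>_def by (rule has_integral_unique[symmetric])
qed

section \<open>Balance for products of weak solutions\<close>

definition bounded_borel :: "('a::euclidean_space \<Rightarrow> real) \<Rightarrow> bool" where
  "bounded_borel f \<longleftrightarrow> f \<in> borel_measurable borel \<and> (\<exists>C. \<forall>x. \<bar>f x\<bar> \<le> C)"

lemma bounded_borelI: "f \<in> borel_measurable borel \<Longrightarrow> (\<And>x. \<bar>f x\<bar> \<le> C) \<Longrightarrow> bounded_borel f"
  unfolding bounded_borel_def by blast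

lemma bounded_borelE:
  assumes "bounded_borel f"
  obtains C where "f \<in> borel_measurable borel" "\<forall>x. \<bar>f x\<bar> \<le> C" "0 \<le> C"
proof -
  from assms obtain C where "f \<in> borel_measurable borel" "\<forall>x. \<bar>f x\<bar> \<le> C" unfolding bounded_borel_def by blast
  moreover from this have "0 \<le> C" using order_trans[OF abs_ge_zero] by blast
  ultimately show ?thesis by (rule that)
qed

lemma bounded_borel_measurable: "bounded_borel f \<Longrightarrow> f \<in> borel_measurable borel"
  unfolding bounded_borel_def by blast

lemma bounded_borel_const: "bounded_borel (\<lambda>x. c)"
  by (rule bounded_borelI[of _ "\<bar>c\<bar>"]) auto

lemma bounded_borel_add:
  assumes "bounded_borel f" "bounded_borel g"
  shows "bounded_borel (\<lambda>x. f x + g x)"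
proof -
  from assms(1) obtain C where f: "f \<in> borel_measurable borel" "\<forall>x. \<bar>f x\<bar> \<le> C" "0 \<le> C"
    by (rule bounded_borelE)
  from assms(2) obtain C' where g: "g \<in> borel_measurable borel" "\<forall>x. \<bar>g x\<bar> \<le> C'" "0 \<le> C'"
    by (rule bounded_borelE)
  have "\<bar>f x + g x\<bar> \<le> C + C'" for x
    by (rule order_trans[OF abs_triangle_ineq]) (intro add_mono f(2)[rule_format] g(2)[rule_format])
  then show ?thesis using f(1) g(1) by (intro bounded_borelI) auto
qed

lemma bounded_borel_mult:
  assumes "bounded_borel f" "bounded_borel g"
  shows "bounded_borel (\<lambda>x. f x * g x)"
proof -
  from assms(1) obtain C where f: "f \<in> borel_measurable borel" "\<forall>x. \<bar>f x\<bar> \<le> C" "0 \<le> C"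
    by (rule bounded_borelE)
  from assms(2) obtain C' where g: "g \<in> borel_measurable borel" "\<forall>x. \<bar>g x\<bar> \<le> C'" "0 \<le> C'"
    by (rule bounded_borelE)
  have "\<bar>f x * g x\<bar> \<le> C * C'" for x
    unfolding abs_mult using f g by (intro mult_mono) auto
  then show ?thesis using f(1) g(1) by (intro bounded_borelI) auto
qed

lemma bounded_borel_uminus: "bounded_borel f \<Longrightarrow> bounded_borel (\<lambda>x. - f x)"
  using bounded_borel_mult[of "\<lambda>x. -1" f] by (simp add: bounded_borel_const)

lemma bounded_borel_diff: "bounded_borel f \<Longrightarrow> bounded_borel g \<Longrightarrow> bounded_borel (\<lambda>x. f x - g x)"
  using bounded_borel_add[of f "\<lambda>x. - g x"] by (simp add: bounded_borel_uminus)

lemma bounded_borel_sum: "(\<And>j. bounded_borel (f j)) \<Longrightarrow> bounded_borel (\<lambda>x. \<Sum>j\<in>J. f j x)"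
  by (induction J rule: infinite_finite_induct) (auto intro: bounded_borel_const bounded_borel_add)

lemma bounded_borel_affine2:
  fixes f :: "real \<times> real \<Rightarrow> real"
  assumes "bounded_borel f"
  shows "bounded_borel (\<lambda>p. f (x0 + a * fst p, snd p))"
  using assms
proof (rule bounded_borelE)
  fix C assume f: "f \<in> borel_measurable borel" "\<forall>x. \<bar>f x\<bar> \<le> C"
  have "(\<lambda>p. (x0 + a * fst p, snd p)) \<in> borel_measurable borel"
    by (intro borel_measurable_continuous_onI continuous_intros)
  then show ?thesis using f by (intro bounded_borelI[of _ C]) (auto intro: measurable_compose)
qed

lemma bounded_borel_line:
  fixes f :: "real \<times> real \<Rightarrow> real"
  assumes "bounded_borel f"
  shows "bounded_borel (\<lambda>s. f (a + b * s, c + d * s))"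
  using assms by (elim bounded_borelE) (rule bounded_borelI, rule borel_measurable_line, auto)

lemma bounded_ae_bounded_borel:
  assumes "bounded_borel g" "AE x in lborel. x \<in> S \<longrightarrow> f x = g x"
  shows "bounded_ae S f"
  using assms by (elim bounded_borelE) (rule bounded_aeI, auto)

lemma weak_transport_subset:
  assumes "weak_transport D d f g" "D' \<subseteq> D" "D \<in> sets lebesgue" "D' \<in> sets lebesgue"
  shows "weak_transport D' d f g"
  using assms(1) unfolding weak_transport_def AE_lebesgue_on_iff[OF assms(3)] AE_lebesgue_on_iff[OF assms(4)]
  by eventually_elim (use assms(2) in blast)

text \<open>Passage to the trapezoid coordinates (s, \<xi>), where the old first coordinate is
  \<open>x0 + d * s\<close>. States use \<open>x0 = t0\<close>, \<open>d = 1\<close>; kernels use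
  \<open>x0 = 1\<close>, \<open>d = - \<mu>\<close>.\<close>

lemma weak_transport_imp_transport_lines:
  assumes w: "weak_transport E (d, c) f g" and E: "convex E" "E \<in> sets lebesgue"
    and g: "AE p in lborel. p \<in> E \<longrightarrow> g p = g' p" and d: "d \<noteq> 0"
    and D: "\<And>s \<xi>. (s, \<xi>) \<in> D \<Longrightarrow> (x0 + d * s, \<xi>) \<in> E"
  shows "transport_lines D c (\<lambda>p. f (x0 + d * fst p, snd p)) (\<lambda>p. g' (x0 + d * fst p, snd p))"
proof -
  have *: "(x0, 0) + y *\<^sub>R (0, 1) + s *\<^sub>R (d, c) = (x0 + d * s, y + c * s)" for y s :: real by simp
  have det: "fst (0::real, 1::real) * snd (d, c) - fst (d, c) * snd (0::real, 1::real) \<noteq> 0" using d by simp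
  from weak_transport_lines[OF w E g det, of "(x0, 0)"] show ?thesis
    unfolding transport_lines_def * fst_conv snd_conv
    by eventually_elim (use D in blast)
qed

lemma triangle_convex: "convex triangle" and triangle_sets: "triangle \<in> sets lebesgue"
proof -
  have eq: "triangle = {p. 0 \<le> snd p} \<inter> {p. snd p \<le> fst p} \<inter> {p. fst p \<le> 1}"
    by (auto simp: triangle_def)
  show "convex triangle"
  proof (rule convexI)
    fix p q :: "real \<times> real" and u v :: real
    assume p: "p \<in> triangle" "q \<in> triangle" and uv: "0 \<le> u" "0 \<le> v" "u + v = 1"
    obtain x1 y1 x2 y2 where pq: "p = (x1, y1)" "q = (x2, y2)" by (cases p, cases q)
    with p have *: "0 \<le> y1" "y1 \<le> x1" "x1 \<le> 1" "0 \<le> y2" "y2 \<le> x2" "x2 \<le> 1" by (auto simp: triangle_def)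
    have "u * y1 + v * y2 \<le> u * x1 + v * x2" "u * x1 + v * x2 \<le> u * 1 + v * 1"
      using * uv by (intro add_mono mult_left_mono; simp)+
    then show "u *\<^sub>R p + v *\<^sub>R q \<in> triangle" using * uv by (simp add: triangle_def pq)
  qed
  have "closed triangle" unfolding eq
    by (intro closed_Int closed_Collect_le continuous_intros)
  then show "triangle \<in> sets lebesgue" by (intro sets_completionI_sets) auto
qed

text \<open>In the coordinates (s, \<xi>) the reversed kernel direction \<open>(- \<mu>, c)\<close>
  and the state direction \<open>(1, c)\<close> become the same, so the product rule and the
  trapezoid balance apply. The reversal causes the minus sign in \<phi>. The value
  \<open>c = lam j\<close> pairs \<open>K i j\<close> with \<open>u j\<close>, and
  \<open>c = - mu j\<close> pairs \<open>L i j\<close> with \<open>v j\<close>.\<close>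

lemma pair_balance:
  fixes k w k' w' gk' gw' :: "real \<times> real \<Rightarrow> real"
  assumes S: "0 < S" "0 < \<mu>" "\<mu> * S \<le> 1" and c: "c \<noteq> 0"
    and k: "weak_transport triangle (\<mu>, - c) k gk"
      "AE p in lborel. p \<in> triangle \<longrightarrow> k p = k' p" "AE p in lborel. p \<in> triangle \<longrightarrow> gk p = gk' p"
      "bounded_borel k'" "bounded_borel gk'"
    and w: "weak_transport E (1, c) w gw"
      "AE p in lborel. p \<in> E \<longrightarrow> w p = w' p" "AE p in lborel. p \<in> E \<longrightarrow> gw p = gw' p"
      "bounded_borel w'" "bounded_borel gw'"
    and E: "convex E" "E \<in> sets lebesgue" "{t0..t0 + S} \<times> {0..1} \<subseteq> E"
    and top: "((\<lambda>\<xi>. k (1 - \<mu> * S, \<xi>) * w (t0 + S, \<xi>)) has_integral It) {0..1 - \<mu> * S}"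
    and bot: "((\<lambda>\<xi>. k (1, \<xi>) * w (t0, \<xi>)) has_integral Ib) {0..1}"
    and left: "((\<lambda>s. k (1 - \<mu> * s, 0) * w (t0 + s, 0)) has_integral Il) {0..S}"
    and right: "c + \<mu> \<noteq> 0 \<Longrightarrow> ((\<lambda>s. k (1 - \<mu> * s, 1 - \<mu> * s) * w (t0 + s, 1 - \<mu> * s)) has_integral Ir) {0..S}"
  defines "\<phi> \<equiv> \<lambda>p. k' (1 - \<mu> * fst p, snd p) * gw' (t0 + fst p, snd p)
     - w' (t0 + fst p, snd p) * gk' (1 - \<mu> * fst p, snd p)"
    and "D \<equiv> {(s, \<xi>). 0 \<le> s \<and> s \<le> S \<and> 0 \<le> \<xi> \<and> \<xi> \<le> 1 - \<mu> * s}"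
  shows "It - Ib + (c + \<mu>) * Ir - c * Il = (LINT p|lborel. indicator D p * \<phi> p)"
    and "bounded_borel \<phi>"
proof -
  have D_triangle: "(1 + - \<mu> * s, \<xi>) \<in> triangle" and D_E: "(t0 + 1 * s, \<xi>) \<in> E" if "(s, \<xi>) \<in> D" for s \<xi>
  proof -
    have *: "0 \<le> s" "s \<le> S" "0 \<le> \<xi>" "\<xi> \<le> 1 - \<mu> * s" "0 \<le> \<mu> * s" using that S by (auto simp: D_def)
    then show "(1 + - \<mu> * s, \<xi>) \<in> triangle" by (auto simp: triangle_def)
    have "(t0 + s, \<xi>) \<in> {t0..t0 + S} \<times> {0..1}" using * by auto
    then show "(t0 + 1 * s, \<xi>) \<in> E" using E(3) by auto
  qed
  have D: "convex D"
  proof (rule convexI)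
    fix p q :: "real \<times> real" and u v :: real
    assume p: "p \<in> D" "q \<in> D" and uv: "0 \<le> u" "0 \<le> v" "u + v = 1"
    obtain x1 y1 x2 y2 where pq: "p = (x1, y1)" "q = (x2, y2)" by (cases p, cases q)
    with p have *: "0 \<le> x1" "x1 \<le> S" "0 \<le> y1" "y1 \<le> 1 - \<mu> * x1" "0 \<le> x2" "x2 \<le> S" "0 \<le> y2" "y2 \<le> 1 - \<mu> * x2"
      by (auto simp: D_def)
    have "u * x1 + v * x2 \<le> u * S + v * S" "u * y1 + v * y2 \<le> u * (1 - \<mu> * x1) + v * (1 - \<mu> * x2)"
      using * uv by (intro add_mono mult_left_mono; simp)+
    moreover have "u * S + v * S = S" "u * (1 - \<mu> * x1) + v * (1 - \<mu> * x2) = 1 - \<mu> * (u * x1 + v * x2)"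
    proof -
      have "u * S + v * S = (u + v) * S"
        "u * (1 - \<mu> * x1) + v * (1 - \<mu> * x2) = (u + v) - \<mu> * (u * x1 + v * x2)"
        by (simp_all add: algebra_simps)
      then show "u * S + v * S = S" "u * (1 - \<mu> * x1) + v * (1 - \<mu> * x2) = 1 - \<mu> * (u * x1 + v * x2)"
        using uv(3) by simp_all
    qed
    ultimately show "u *\<^sub>R p + v *\<^sub>R q \<in> D" using * uv by (simp add: D_def pq)
  qed
  have "weak_transport triangle (- \<mu>, c) k (\<lambda>p. - gk p)"
    using weak_transport_uminus[OF k(1)] by simp
  moreover have "AE p in lborel. p \<in> triangle \<longrightarrow> - gk p = - gk' p" using k(3) by eventually_elim simp
  ultimately have tk: "transport_lines D c (\<lambda>p. k (1 + - \<mu> * fst p, snd p)) (\<lambda>p. - gk' (1 + - \<mu> * fst p, snd p))"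
    using S(2) D_triangle
    by (intro weak_transport_imp_transport_lines[where g' = "\<lambda>p. - gk' p", OF _ triangle_convex triangle_sets]) auto
  have tw: "transport_lines D c (\<lambda>p. w (t0 + 1 * fst p, snd p)) (\<lambda>p. gw' (t0 + 1 * fst p, snd p))"
    using D_E by (intro weak_transport_imp_transport_lines[OF w(1) E(1,2) w(3)]) auto
  have "AE p in lborel. p \<in> D \<longrightarrow> k (1 + - \<mu> * fst p, snd p) = k' (1 + - \<mu> * fst p, snd p)"
  proof -
    have "- \<mu> * 1 - 0 * 0 \<noteq> 0" using S(2) by simp
    from AE_affine2[OF k(2) this, of 1 0] show ?thesis by eventually_elim (use D_triangle in auto)
  qed
  moreover have "AE p in lborel. p \<in> D \<longrightarrow> w (t0 + 1 * fst p, snd p) = w' (t0 + 1 * fst p, snd p)"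
  proof -
    have "1 * 1 - 0 * 0 \<noteq> (0 :: real)" by simp
    from AE_affine2[OF w(2) this, of t0 0] show ?thesis by eventually_elim (use D_E in auto)
  qed
  moreover have bk: "bounded_borel (\<lambda>p. - gk' (1 + - \<mu> * fst p, snd p))"
    by (intro bounded_borel_uminus bounded_borel_affine2 k(5))
  moreover have bw: "bounded_borel (\<lambda>p. gw' (t0 + 1 * fst p, snd p))"
    by (intro bounded_borel_affine2 w(5))
  ultimately have t: "transport_lines D c (\<lambda>p. k (1 + - \<mu> * fst p, snd p) * w (t0 + 1 * fst p, snd p))
      (\<lambda>p. k' (1 + - \<mu> * fst p, snd p) * gw' (t0 + 1 * fst p, snd p)
         + w' (t0 + 1 * fst p, snd p) * - gk' (1 + - \<mu> * fst p, snd p))"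
    using tk tw D
  proof -
    assume ae: "AE p in lborel. p \<in> D \<longrightarrow> k (1 + - \<mu> * fst p, snd p) = k' (1 + - \<mu> * fst p, snd p)"
      "AE p in lborel. p \<in> D \<longrightarrow> w (t0 + 1 * fst p, snd p) = w' (t0 + 1 * fst p, snd p)"
    from bk obtain C1 where C1: "(\<lambda>p. - gk' (1 + - \<mu> * fst p, snd p)) \<in> borel_measurable borel"
      "\<forall>p. \<bar>- gk' (1 + - \<mu> * fst p, snd p)\<bar> \<le> C1" by (rule bounded_borelE)
    from bw obtain C2 where C2: "(\<lambda>p. gw' (t0 + 1 * fst p, snd p)) \<in> borel_measurable borel"
      "\<forall>p. \<bar>gw' (t0 + 1 * fst p, snd p)\<bar> \<le> C2" by (rule bounded_borelE)
    show ?thesis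
      by (rule transport_lines_mult[OF tk tw D C1(1) _ C2(1) _ ae, of "max C1 C2"])
        (use C1(2) C2(2) in \<open>auto simp: le_max_iff_disj\<close>)
  qed
  have "bounded_borel (\<lambda>p. k' (1 + - \<mu> * fst p, snd p) * gw' (t0 + 1 * fst p, snd p)
         - w' (t0 + 1 * fst p, snd p) * gk' (1 + - \<mu> * fst p, snd p))"
    by (intro bounded_borel_diff bounded_borel_mult bounded_borel_affine2 k(4,5) w(4,5))
  then show \<phi>: "bounded_borel \<phi>" by (simp add: \<phi>_def)
  then obtain C where C: "\<phi> \<in> borel_measurable borel" "\<forall>p. \<bar>\<phi> p\<bar> \<le> C" by (rule bounded_borelE)
  show "It - Ib + (c + \<mu>) * Ir - c * Il = (LINT p|lborel. indicator D p * \<phi> p)"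
    unfolding D_def
    by (rule trapezoid_balance[where f = "\<lambda>p. k (1 - \<mu> * fst p, snd p) * w (t0 + fst p, snd p)", OF S c _ C(1) C(2)[rule_format]])
      (use t top bot left right in \<open>simp_all add: \<phi>_def D_def\<close>)
qed

section \<open>Estimates with an exponential weight\<close>

text \<open>Integrating exp (M \<xi>) up to \<open>x\<close> gains the factor \<open>1 / M\<close>
  against the weight at \<open>x\<close>. This gain becomes the contraction once \<open>M\<close> is
  large.\<close>

lemma integral_exp_bound:
  fixes h :: "real \<Rightarrow> real"
  assumes h: "(h has_integral I) {0..x}" and "0 \<le> x" "0 < M" "0 \<le> A"
    and bound: "AE \<xi> in lborel. \<xi> \<in> {0..x} \<longrightarrow> \<bar>h \<xi>\<bar> \<le> A * exp (M * \<xi>)"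
  shows "\<bar>I\<bar> \<le> A / M * exp (M * x)"
proof -
  \<comment> \<open>The integrand is set to 0 where the bound fails, a null set, so that the bound
    holds everywhere.\<close>
  define k where "k = (\<lambda>\<xi>. if \<bar>h \<xi>\<bar> \<le> A * exp (M * \<xi>) then h \<xi> else 0)"
  have "AE \<xi> in lborel. \<xi> \<in> {0..x} \<longrightarrow> h \<xi> = k \<xi>"
    using bound by eventually_elim (simp add: k_def)
  from has_integral_AE_cong[OF this h] have k: "(k has_integral I) {0..x}" .
  have "((\<lambda>\<xi>. A * exp (M * \<xi>)) has_integral A / M * exp (M * x) - A / M * exp (M * 0)) {0..x}"
    using assms(2,3)
    by (intro fundamental_theorem_of_calculus)
      (auto intro!: derivative_eq_intros simp flip: has_real_derivative_iff_has_vector_derivative)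
  moreover have "\<bar>k \<xi>\<bar> \<le> A * exp (M * \<xi>)" for \<xi> using assms(4) by (simp add: k_def)
  ultimately have "norm I \<le> A / M * exp (M * x) - A / M * exp (M * 0)"
    using integral_norm_bound_integral[of k "{0..x}" "\<lambda>\<xi>. A * exp (M * \<xi>)"] k
    by (auto simp: has_integral_iff)
  moreover have "0 \<le> A / M" using assms by simp
  ultimately show ?thesis by simp
qed

lemma weighted_sum_bound:
  fixes c f :: "nat \<Rightarrow> real"
  assumes "\<And>j. j \<in> J \<Longrightarrow> \<bar>c j\<bar> \<le> d j" "\<And>j. j \<in> J \<Longrightarrow> \<bar>f j\<bar> \<le> E"
  shows "\<bar>\<Sum>j\<in>J. c j * f j\<bar> \<le> (\<Sum>j\<in>J. d j) * E"
  unfolding sum_distrib_right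
proof (rule order_trans[OF sum_abs sum_mono])
  fix j assume "j \<in> J"
  with assms[of j] show "\<bar>c j * f j\<bar> \<le> d j * E"
    unfolding abs_mult by (intro mult_mono) auto
qed

section \<open>The closed loop system\<close>

text \<open>The horizon \<open>T\<close> is finite because the solution is essentially bounded only
  on bounded time intervals. The representatives are fixed once and for all, and are bounded for all
  indices, even outside the ranges.\<close>

locale backstepping =
  fixes n m :: nat
    and lam mu :: "nat \<Rightarrow> real"
    and Spp Spm Smp Smm Q0 R1 :: "nat \<Rightarrow> nat \<Rightarrow> real"
    and K L :: "nat \<Rightarrow> nat \<Rightarrow> real \<times> real \<Rightarrow> real"
    and u0 v0 :: "nat \<Rightarrow> real \<Rightarrow> real"
    and u v :: "nat \<Rightarrow> real \<times> real \<Rightarrow> real"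
    and T :: real
    and u' v' :: "nat \<Rightarrow> real \<times> real \<Rightarrow> real"
    and K' L' :: "nat \<Rightarrow> nat \<Rightarrow> real \<times> real \<Rightarrow> real"
  assumes lam_pos: "i \<in> {1..n} \<Longrightarrow> 0 < lam i"
    and lam_least: "i \<in> {1..n} \<Longrightarrow> lam 1 \<le> lam i"
    and mu_pos: "i \<in> {1..m} \<Longrightarrow> 0 < mu i"
    and mu_inj: "i \<in> {1..m} \<Longrightarrow> j \<in> {1..m} \<Longrightarrow> i \<noteq> j \<Longrightarrow> mu i \<noteq> mu j"
    and Smm_diag: "j \<in> {1..m} \<Longrightarrow> Smm j j = 0"
    and kernel: "kernel_solution n m lam mu Spp Spm Smp Smm Q0 K L"
    and system: "system_solution n m lam mu Spp Spm Smp Smm Q0 R1 (feedback n m R1 K L u v) u0 v0 u v"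
    and T_pos: "0 < T"
    and rep_bounded: "bounded_borel (u' i)" "bounded_borel (v' i)" "bounded_borel (K' i j)" "bounded_borel (L' i j)"
    and u_rep: "i \<in> {1..n} \<Longrightarrow> AE p in lborel. p \<in> {0..T} \<times> {0..1} \<longrightarrow> u i p = u' i p"
    and v_rep: "i \<in> {1..m} \<Longrightarrow> AE p in lborel. p \<in> {0..T} \<times> {0..1} \<longrightarrow> v i p = v' i p"
    and K_rep: "i \<in> {1..m} \<Longrightarrow> j \<in> {1..n} \<Longrightarrow> AE p in lborel. p \<in> triangle \<longrightarrow> K i j p = K' i j p"
    and L_rep: "i \<in> {1..m} \<Longrightarrow> j \<in> {1..m} \<Longrightarrow> AE p in lborel. p \<in> triangle \<longrightarrow> L i j p = L' i j p"
begin

section \<open>The equations on a finite time strip, in terms of representatives\<close>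

abbreviation "strip \<equiv> {0..T} \<times> {0..1::real}"

text \<open>In \<open>fu\<close> and \<open>fv\<close> the coefficient matrices act on a column of
  states, in \<open>gK\<close> and \<open>gL\<close> on a row of kernels from the other side. This
  transposition is the adjointness behind the cancellation of the interior terms.\<close>

definition "fu i p = (\<Sum>j=1..n. Spp i j * u' j p) + (\<Sum>j=1..m. Spm i j * v' j p)"
definition "fv i p = (\<Sum>j=1..n. Smp i j * u' j p) + (\<Sum>j=1..m. Smm i j * v' j p)"
definition "gK i j p = (\<Sum>k=1..n. Spp k j * K' i k p) + (\<Sum>q=1..m. Smp q j * L' i q p)"
definition "gL i j p = (\<Sum>q=1..m. Smm q j * L' i q p) + (\<Sum>k=1..n. Spm k j * K' i k p)"

lemma rhs_bounded: "bounded_borel (fu i)" "bounded_borel (fv i)" "bounded_borel (gK i j)" "bounded_borel (gL i j)"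
  unfolding fu_def[abs_def] fv_def[abs_def] gK_def[abs_def] gL_def[abs_def]
  by (intro bounded_borel_add bounded_borel_sum bounded_borel_mult bounded_borel_const rep_bounded)+

lemma strip_sets: "strip \<in> sets lebesgue" and strip_convex: "convex strip"
proof -
  show "strip \<in> sets lebesgue" by (intro sets_completionI_sets) (auto intro!: borel_closed closed_Times)
  show "convex strip" by (intro convex_Times convex_real_interval)
qed

lemma state_rep:
  "AE p in lborel. p \<in> strip \<longrightarrow> (\<forall>j\<in>{1..n}. u j p = u' j p) \<and> (\<forall>j\<in>{1..m}. v j p = v' j p)"
proof -
  have "AE p in lborel. \<forall>j\<in>{1..n}. p \<in> strip \<longrightarrow> u j p = u' j p"
    "AE p in lborel. \<forall>j\<in>{1..m}. p \<in> strip \<longrightarrow> v j p = v' j p"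
    by (intro AE_finite_allI finite_atLeastAtMost u_rep v_rep; assumption)+
  then show ?thesis by eventually_elim auto
qed

lemma kernel_rep:
  assumes "i \<in> {1..m}"
  shows "AE p in lborel. p \<in> triangle \<longrightarrow> (\<forall>j\<in>{1..n}. K i j p = K' i j p) \<and> (\<forall>j\<in>{1..m}. L i j p = L' i j p)"
proof -
  have "AE p in lborel. \<forall>j\<in>{1..n}. p \<in> triangle \<longrightarrow> K i j p = K' i j p"
    "AE p in lborel. \<forall>j\<in>{1..m}. p \<in> triangle \<longrightarrow> L i j p = L' i j p"
    by (intro AE_finite_allI finite_atLeastAtMost K_rep[OF assms] L_rep[OF assms]; assumption)+
  then show ?thesis by eventually_elim auto
qed

lemma quadrant_strip:
  assumes "weak_transport ({0..} \<times> {0..1}) d f g"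
  shows "weak_transport strip d f g"
proof (rule weak_transport_subset[OF assms])
  show "{0..} \<times> {0..1} \<in> sets (lebesgue :: (real \<times> real) measure)"
    by (intro sets_completionI_sets) (auto intro!: borel_closed closed_Times)
qed (use strip_sets in auto)

lemma u_weak:
  assumes "i \<in> {1..n}"
  shows "weak_transport strip (1, lam i) (u i) (\<lambda>p. (\<Sum>j=1..n. Spp i j * u j p) + (\<Sum>j=1..m. Spm i j * v j p))"
    and "AE p in lborel. p \<in> strip \<longrightarrow> (\<Sum>j=1..n. Spp i j * u j p) + (\<Sum>j=1..m. Spm i j * v j p) = fu i p"
proof -
  show "weak_transport strip (1, lam i) (u i) (\<lambda>p. (\<Sum>j=1..n. Spp i j * u j p) + (\<Sum>j=1..m. Spm i j * v j p))"
    using system assms by (intro quadrant_strip) (auto simp: system_solution_def)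
  show "AE p in lborel. p \<in> strip \<longrightarrow> (\<Sum>j=1..n. Spp i j * u j p) + (\<Sum>j=1..m. Spm i j * v j p) = fu i p"
    using state_rep by eventually_elim (auto simp: fu_def)
qed

lemma v_weak:
  assumes "i \<in> {1..m}"
  shows "weak_transport strip (1, - mu i) (v i) (\<lambda>p. (\<Sum>j=1..n. Smp i j * u j p) + (\<Sum>j=1..m. Smm i j * v j p))"
    and "AE p in lborel. p \<in> strip \<longrightarrow> (\<Sum>j=1..n. Smp i j * u j p) + (\<Sum>j=1..m. Smm i j * v j p) = fv i p"
proof -
  show "weak_transport strip (1, - mu i) (v i) (\<lambda>p. (\<Sum>j=1..n. Smp i j * u j p) + (\<Sum>j=1..m. Smm i j * v j p))"
    using system assms by (intro quadrant_strip) (auto simp: system_solution_def)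
  show "AE p in lborel. p \<in> strip \<longrightarrow> (\<Sum>j=1..n. Smp i j * u j p) + (\<Sum>j=1..m. Smm i j * v j p) = fv i p"
    using state_rep by eventually_elim (auto simp: fv_def)
qed

lemma K_weak:
  assumes "i \<in> {1..m}" "j \<in> {1..n}"
  shows "weak_transport triangle (mu i, - lam j) (K i j)
      (\<lambda>p. (\<Sum>k=1..n. Spp k j * K i k p) + (\<Sum>q=1..m. Smp q j * L i q p))"
    and "AE p in lborel. p \<in> triangle \<longrightarrow>
      (\<Sum>k=1..n. Spp k j * K i k p) + (\<Sum>q=1..m. Smp q j * L i q p) = gK i j p"
proof -
  show "weak_transport triangle (mu i, - lam j) (K i j)
      (\<lambda>p. (\<Sum>k=1..n. Spp k j * K i k p) + (\<Sum>q=1..m. Smp q j * L i q p))"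
    using kernel assms by (auto simp: kernel_solution_def)
  show "AE p in lborel. p \<in> triangle \<longrightarrow>
      (\<Sum>k=1..n. Spp k j * K i k p) + (\<Sum>q=1..m. Smp q j * L i q p) = gK i j p"
    using kernel_rep[OF assms(1)] by eventually_elim (auto simp: gK_def)
qed

lemma L_weak:
  assumes "i \<in> {1..m}" "j \<in> {1..m}"
  shows "weak_transport triangle (mu i, mu j) (L i j)
      (\<lambda>p. (\<Sum>q=1..m. Smm q j * L i q p) + (\<Sum>k=1..n. Spm k j * K i k p))"
    and "AE p in lborel. p \<in> triangle \<longrightarrow>
      (\<Sum>q=1..m. Smm q j * L i q p) + (\<Sum>k=1..n. Spm k j * K i k p) = gL i j p"
proof -
  show "weak_transport triangle (mu i, mu j) (L i j)
      (\<lambda>p. (\<Sum>q=1..m. Smm q j * L i q p) + (\<Sum>k=1..n. Spm k j * K i k p))"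
    using kernel assms by (auto simp: kernel_solution_def)
  show "AE p in lborel. p \<in> triangle \<longrightarrow>
      (\<Sum>q=1..m. Smm q j * L i q p) + (\<Sum>k=1..n. Spm k j * K i k p) = gL i j p"
    using kernel_rep[OF assms(1)] by eventually_elim (auto simp: gL_def)
qed

text \<open>Each coupling matrix yields one bilinear form in a kernel row and the state. The form
  arises once from the state equation and once, with opposite sign, from the kernel equation;
  exchanging the order of summation identifies the two.\<close>

lemma interior_terms_cancel:
  "(\<Sum>j=1..n. K' i j q * fu j p - u' j p * gK i j q) + (\<Sum>j=1..m. L' i j q * fv j p - v' j p * gL i j q) = 0"
proof -
  have swap: "(\<Sum>j=1..a. \<Sum>k=1..b. f j k) = (\<Sum>j=1..b. \<Sum>k=1..a. f k j)" for a b and f :: "nat \<Rightarrow> nat \<Rightarrow> real"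
    by (rule sum.swap)
  have 1: "(\<Sum>j=1..n. \<Sum>k=1..n. K' i j q * (Spp j k * u' k p)) = (\<Sum>j=1..n. \<Sum>k=1..n. u' j p * (Spp k j * K' i k q))"
    by (subst swap) (simp add: mult_ac)
  have 2: "(\<Sum>j=1..n. \<Sum>k=1..m. K' i j q * (Spm j k * v' k p)) = (\<Sum>j=1..m. \<Sum>k=1..n. v' j p * (Spm k j * K' i k q))"
    by (subst swap) (simp add: mult_ac)
  have 3: "(\<Sum>j=1..m. \<Sum>k=1..n. L' i j q * (Smp j k * u' k p)) = (\<Sum>j=1..n. \<Sum>k=1..m. u' j p * (Smp k j * L' i k q))"
    by (subst swap) (simp add: mult_ac)
  have 4: "(\<Sum>j=1..m. \<Sum>k=1..m. L' i j q * (Smm j k * v' k p)) = (\<Sum>j=1..m. \<Sum>k=1..m. v' j p * (Smm k j * L' i k q))"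
    by (subst swap) (simp add: mult_ac)
  show ?thesis
    unfolding fu_def fv_def gK_def gL_def
    by (simp only: sum_subtractf distrib_left sum.distrib sum_distrib_left 1 2 3 4)
qed

section \<open>Generic time slices, kernel slices and characteristics\<close>

definition "W i x t = integral {0..x}
  (\<lambda>\<xi>. (\<Sum>j=1..n. K i j (x, \<xi>) * u j (t, \<xi>)) + (\<Sum>j=1..m. L i j (x, \<xi>) * v j (t, \<xi>)))"

definition "slice_ok t \<longleftrightarrow> (AE \<xi> in lborel. \<xi> \<in> {0..1} \<longrightarrow>
  (\<forall>j\<in>{1..n}. u j (t, \<xi>) = u' j (t, \<xi>)) \<and> (\<forall>j\<in>{1..m}. v j (t, \<xi>) = v' j (t, \<xi>)))"

text \<open>Agreement with \<open>K'\<close> and \<open>L'\<close> is not demanded, because the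
  condition is needed on the single abscissas x = 1, where it comes from the trace assumptions, and
  x = 0, where it is trivial.\<close>

definition "kernel_slice_ok i x \<longleftrightarrow>
  (\<forall>j\<in>{1..n}. bounded_ae {0..x} (\<lambda>\<xi>. K i j (x, \<xi>))) \<and> (\<forall>j\<in>{1..m}. bounded_ae {0..x} (\<lambda>\<xi>. L i j (x, \<xi>)))"

text \<open>All that is required of a departure time: agreement with the representatives along the
  characteristic, the integrated equation of \<open>v i\<close> from its start, and the feedback law
  at its start.\<close>

definition "characteristic_ok i t0 \<longleftrightarrow>
  (AE s in lborel. (t0 + s, 1 - mu i * s) \<in> strip \<longrightarrow>
     (\<forall>j\<in>{1..n}. u j (t0 + s, 1 - mu i * s) = u' j (t0 + s, 1 - mu i * s)) \<and>
     (\<forall>j\<in>{1..m}. v j (t0 + s, 1 - mu i * s) = v' j (t0 + s, 1 - mu i * s))) \<and>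
  (\<forall>S\<ge>0. (t0, 1) \<in> strip \<and> (t0 + S, 1 - mu i * S) \<in> strip \<longrightarrow>
     ((\<lambda>s. fv i (t0 + s, 1 - mu i * s)) has_integral v i (t0 + S, 1 - mu i * S) - v i (t0, 1)) {0..S}) \<and>
  (0 \<le> t0 \<longrightarrow> v i (t0, 1) = W i 1 t0)"

lemma AE_slice_ok: "AE t in lborel. t \<in> {0..T} \<longrightarrow> slice_ok t"
  using AE_pairD[OF state_rep]
proof eventually_elim
  case (elim t)
  show ?case
  proof
    assume t: "t \<in> {0..T}"
    show "slice_ok t"
      using elim unfolding slice_ok_def by eventually_elim (use t in auto)
  qed
qed

lemma slice_okD:
  assumes "slice_ok t"
  shows "j \<in> {1..n} \<Longrightarrow> bounded_ae {0..1} (\<lambda>\<xi>. u j (t, \<xi>))" "j \<in> {1..m} \<Longrightarrow> bounded_ae {0..1} (\<lambda>\<xi>. v j (t, \<xi>))"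
proof -
  show "bounded_ae {0..1} (\<lambda>\<xi>. u j (t, \<xi>))" if "j \<in> {1..n}"
  proof (rule bounded_ae_bounded_borel)
    show "bounded_borel (\<lambda>\<xi>. u' j (t, \<xi>))" using bounded_borel_line[OF rep_bounded(1), of j t 0 0 1] by simp
    show "AE \<xi> in lborel. \<xi> \<in> {0..1} \<longrightarrow> u j (t, \<xi>) = u' j (t, \<xi>)"
      using assms unfolding slice_ok_def by eventually_elim (use that in auto)
  qed
  show "bounded_ae {0..1} (\<lambda>\<xi>. v j (t, \<xi>))" if "j \<in> {1..m}"
  proof (rule bounded_ae_bounded_borel)
    show "bounded_borel (\<lambda>\<xi>. v' j (t, \<xi>))" using bounded_borel_line[OF rep_bounded(2), of j t 0 0 1] by simp
    show "AE \<xi> in lborel. \<xi> \<in> {0..1} \<longrightarrow> v j (t, \<xi>) = v' j (t, \<xi>)"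
      using assms unfolding slice_ok_def by eventually_elim (use that in auto)
  qed
qed

lemma kernel_traces:
  assumes "i \<in> {1..m}"
  shows "j \<in> {1..n} \<Longrightarrow> bounded_ae {0..1} (\<lambda>x. K i j (x, 0))" "j \<in> {1..m} \<Longrightarrow> bounded_ae {0..1} (\<lambda>x. L i j (x, 0))"
    and "kernel_slice_ok i 1"
proof -
  have "Linf {0<..<1} (\<lambda>x. K i j (x, 0)) \<and> Linf {0<..<1} (\<lambda>\<xi>. K i j (1, \<xi>))" if "j \<in> {1..n}" for j
    using kernel assms that by (auto simp: kernel_solution_def)
  then have KK: "bounded_ae {0..1} (\<lambda>x. K i j (x, 0)) \<and> bounded_ae {0..1} (\<lambda>\<xi>. K i j (1, \<xi>))" if "j \<in> {1..n}" for j
    using that by (auto intro!: bounded_ae_open_closed Linf_imp_bounded_ae)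
  have "Linf {0<..<1} (\<lambda>x. L i j (x, 0)) \<and> Linf {0<..<1} (\<lambda>\<xi>. L i j (1, \<xi>))" if "j \<in> {1..m}" for j
    using kernel assms that by (auto simp: kernel_solution_def)
  then have LL: "bounded_ae {0..1} (\<lambda>x. L i j (x, 0)) \<and> bounded_ae {0..1} (\<lambda>\<xi>. L i j (1, \<xi>))" if "j \<in> {1..m}" for j
    using that by (auto intro!: bounded_ae_open_closed Linf_imp_bounded_ae)
  show "j \<in> {1..n} \<Longrightarrow> bounded_ae {0..1} (\<lambda>x. K i j (x, 0))" "j \<in> {1..m} \<Longrightarrow> bounded_ae {0..1} (\<lambda>x. L i j (x, 0))"
    "kernel_slice_ok i 1"
    using KK LL by (auto simp: kernel_slice_ok_def)
qed

lemma AE_kernel_slice: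
  assumes "i \<in> {1..m}"
  shows "AE x in lborel. x \<in> {0..1} \<longrightarrow> kernel_slice_ok i x \<and> (AE \<xi> in lborel. \<xi> \<in> {0..x} \<longrightarrow>
    (\<forall>j\<in>{1..n}. K i j (x, \<xi>) = K' i j (x, \<xi>)) \<and> (\<forall>j\<in>{1..m}. L i j (x, \<xi>) = L' i j (x, \<xi>)))"
  using AE_pairD[OF kernel_rep[OF assms]]
proof (eventually_elim, intro impI)
  fix x :: real
  assume ae: "AE \<xi> in lborel. (x, \<xi>) \<in> triangle \<longrightarrow>
      (\<forall>j\<in>{1..n}. K i j (x, \<xi>) = K' i j (x, \<xi>)) \<and> (\<forall>j\<in>{1..m}. L i j (x, \<xi>) = L' i j (x, \<xi>))" and x: "x \<in> {0..1}"
  have *: "AE \<xi> in lborel. \<xi> \<in> {0..x} \<longrightarrow>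
      (\<forall>j\<in>{1..n}. K i j (x, \<xi>) = K' i j (x, \<xi>)) \<and> (\<forall>j\<in>{1..m}. L i j (x, \<xi>) = L' i j (x, \<xi>))"
    using ae by eventually_elim (use x in \<open>auto simp: triangle_def\<close>)
  moreover have "kernel_slice_ok i x"
    unfolding kernel_slice_ok_def
  proof (intro conjI ballI)
    fix j
    show "bounded_ae {0..x} (\<lambda>\<xi>. K i j (x, \<xi>))" if "j \<in> {1..n}"
    proof (rule bounded_ae_bounded_borel)
      show "bounded_borel (\<lambda>\<xi>. K' i j (x, \<xi>))" using bounded_borel_line[OF rep_bounded(3), of i j x 0 0 1] by simp
      show "AE \<xi> in lborel. \<xi> \<in> {0..x} \<longrightarrow> K i j (x, \<xi>) = K' i j (x, \<xi>)" using * by eventually_elim (use that in auto)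
    qed
    show "bounded_ae {0..x} (\<lambda>\<xi>. L i j (x, \<xi>))" if "j \<in> {1..m}"
    proof (rule bounded_ae_bounded_borel)
      show "bounded_borel (\<lambda>\<xi>. L' i j (x, \<xi>))" using bounded_borel_line[OF rep_bounded(4), of i j x 0 0 1] by simp
      show "AE \<xi> in lborel. \<xi> \<in> {0..x} \<longrightarrow> L i j (x, \<xi>) = L' i j (x, \<xi>)" using * by eventually_elim (use that in auto)
    qed
  qed
  ultimately show "kernel_slice_ok i x \<and> (AE \<xi> in lborel. \<xi> \<in> {0..x} \<longrightarrow>
      (\<forall>j\<in>{1..n}. K i j (x, \<xi>) = K' i j (x, \<xi>)) \<and> (\<forall>j\<in>{1..m}. L i j (x, \<xi>) = L' i j (x, \<xi>)))" by blast
qed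

lemma AE_characteristic_ok:
  assumes i: "i \<in> {1..m}"
  shows "AE t0 in lborel. characteristic_ok i t0"
proof -
  have mu: "mu i \<noteq> 0" using mu_pos[OF i] by simp
  then have det: "1 * (- mu i) - 1 * 0 \<noteq> 0" by simp
  have det2: "fst (1::real, 0::real) * snd (1::real, - mu i) - fst (1::real, - mu i) * snd (1::real, 0::real) \<noteq> 0"
    using mu by simp
  have pt: "(0, 1) + t0 *\<^sub>R (1, 0) + s *\<^sub>R (1, - mu i) = (t0 + s, 1 - mu i * s)" for t0 s :: real by simp
  have lines: "AE t0 in lborel. \<forall>a b. a \<le> b \<and> (t0 + a, 1 - mu i * a) \<in> strip \<and> (t0 + b, 1 - mu i * b) \<in> strip \<longrightarrow>
      ((\<lambda>s. fv i (t0 + s, 1 - mu i * s)) has_integral v i (t0 + b, 1 - mu i * b) - v i (t0 + a, 1 - mu i * a)) {a..b}"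
    using weak_transport_lines[OF v_weak(1)[OF i] strip_convex strip_sets v_weak(2)[OF i] det2, of "(0, 1)"]
    unfolding pt .
  have slices: "AE t0 in lborel. AE s in lborel. (t0 + s, 1 - mu i * s) \<in> strip \<longrightarrow>
     (\<forall>j\<in>{1..n}. u j (t0 + s, 1 - mu i * s) = u' j (t0 + s, 1 - mu i * s)) \<and>
     (\<forall>j\<in>{1..m}. v j (t0 + s, 1 - mu i * s) = v' j (t0 + s, 1 - mu i * s))"
    using AE_affine2D[OF state_rep det, of 0 1] by simp
  have "AE t0 in lborel. t0 \<in> {0..} \<longrightarrow> v i (t0, 1) = (\<Sum>j=1..n. R1 i j * u j (t0, 1)) + feedback n m R1 K L u v i t0"
    using system i unfolding system_solution_def
    by (subst AE_lebesgue_on_iff[symmetric]) auto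
  \<comment> \<open>The feedback cancels the reflection \<open>R1\<close>, and its integral part is
    exactly \<open>W i 1 t0\<close>.\<close>
  then have bc: "AE t0 in lborel. 0 \<le> t0 \<longrightarrow> v i (t0, 1) = W i 1 t0"
    by eventually_elim (auto simp: feedback_def W_def)
  show ?thesis
    using lines slices bc
  proof eventually_elim
    case (elim t0)
    have "((\<lambda>s. fv i (t0 + s, 1 - mu i * s)) has_integral v i (t0 + S, 1 - mu i * S) - v i (t0, 1)) {0..S}"
      if "0 \<le> S" "(t0, 1) \<in> strip" "(t0 + S, 1 - mu i * S) \<in> strip" for S
      using elim(1)[rule_format, of 0 S] that by simp
    then show ?case using elim(2,3) unfolding characteristic_ok_def by blast
  qed
qed

section \<open>The Volterra identity at the end of a characteristic\<close>

text \<open>Summed over all kernel-state pairs, the top gives \<open>W\<close> at the end point, the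
  bottom gives \<open>W i 1 t0\<close>, the left side gives 0, and the right side gives minus the
  increment of \<open>v i\<close> along the characteristic. As
  \<open>W i 1 t0 = v i (t0, 1)\<close>, the starting value drops out of the balance.\<close>

lemma v_trace_on_characteristic:
  assumes i: "i \<in> {1..m}" and S: "0 < S" "mu i * S \<le> 1" and t0: "0 \<le> t0" "t0 + S \<le> T"
    and ok: "slice_ok t0" "slice_ok (t0 + S)" "kernel_slice_ok i (1 - mu i * S)" "characteristic_ok i t0"
    and vanish: "\<And>j. j \<in> {1..m} \<Longrightarrow> j < i \<Longrightarrow> AE t in lborel. t0 \<le> t \<and> t \<le> T \<longrightarrow> v j (t, 0) = 0"
  shows "v i (t0 + S, 1 - mu i * S) = W i (1 - mu i * S) (t0 + S)"
proof -
  define \<mu> where "\<mu> = mu i"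
  have \<mu>: "0 < \<mu>" "\<mu> * S \<le> 1" using mu_pos[OF i] S by (auto simp: \<mu>_def)
  have \<mu>s: "0 \<le> \<mu> * s" "\<mu> * s \<le> 1" if "0 \<le> s" "s \<le> S" for s
  proof -
    have "\<mu> * s \<le> \<mu> * S" using that \<mu>(1) by (intro mult_left_mono) auto
    then show "\<mu> * s \<le> 1" using \<mu>(2) by (rule order_trans)
    show "0 \<le> \<mu> * s" using \<mu> that by simp
  qed
  have in_strip: "(t0 + s, 1 - \<mu> * s) \<in> strip" if "0 \<le> s" "s \<le> S" for s
    using \<mu>s[OF that] that t0 by auto
  have sub: "{t0..t0 + S} \<times> {0..1} \<subseteq> strip" using t0 by auto
  define D where "D = {(s, \<xi>). 0 \<le> s \<and> s \<le> S \<and> 0 \<le> \<xi> \<and> \<xi> \<le> 1 - \<mu> * s}"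
  have int: "(f has_integral integral {a..b} f) {a..b}" if "bounded_ae {a..b} f" for f :: "real \<Rightarrow> real" and a b
    using bounded_ae_integrable_on[OF that] by (rule integrable_integral)
  note ok' = ok[folded \<mu>_def]
  have kerS: "bounded_ae {0..1 - \<mu> * S} (\<lambda>\<xi>. K i j (1 - \<mu> * S, \<xi>))" if "j \<in> {1..n}" for j
    using ok'(3) that by (auto simp: kernel_slice_ok_def)
  have lerS: "bounded_ae {0..1 - \<mu> * S} (\<lambda>\<xi>. L i j (1 - \<mu> * S, \<xi>))" if "j \<in> {1..m}" for j
    using ok'(3) that by (auto simp: kernel_slice_ok_def)
  have ker1: "bounded_ae {0..1} (\<lambda>\<xi>. K i j (1, \<xi>))" if "j \<in> {1..n}" for j
    using kernel_traces(3)[OF i] that by (auto simp: kernel_slice_ok_def)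
  have ler1: "bounded_ae {0..1} (\<lambda>\<xi>. L i j (1, \<xi>))" if "j \<in> {1..m}" for j
    using kernel_traces(3)[OF i] that by (auto simp: kernel_slice_ok_def)
  have subS: "{0..1 - \<mu> * S} \<subseteq> {0..1}" using \<mu> S by auto
  \<comment> \<open>The products \<open>K u\<close> and \<open>L v\<close> on the sides of \<open>D\<close>: \<open>t\<close> top, \<open>b\<close> bottom, \<open>l\<close> left, \<open>r\<close> right (the characteristic).\<close>
  define kt lt kb lb where "kt = (\<lambda>j \<xi>. K i j (1 - \<mu> * S, \<xi>) * u j (t0 + S, \<xi>))"
    and "lt = (\<lambda>j \<xi>. L i j (1 - \<mu> * S, \<xi>) * v j (t0 + S, \<xi>))"
    and "kb = (\<lambda>j \<xi>. K i j (1, \<xi>) * u j (t0, \<xi>))" and "lb = (\<lambda>j \<xi>. L i j (1, \<xi>) * v j (t0, \<xi>))"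
  have kt: "bounded_ae {0..1 - \<mu> * S} (kt j)" if "j \<in> {1..n}" for j unfolding kt_def
    by (intro bounded_ae_mult kerS bounded_ae_subset[OF slice_okD(1)[OF ok(2)] subS] that)
  have lt: "bounded_ae {0..1 - \<mu> * S} (lt j)" if "j \<in> {1..m}" for j unfolding lt_def
    by (intro bounded_ae_mult lerS bounded_ae_subset[OF slice_okD(2)[OF ok(2)] subS] that)
  have kb: "bounded_ae {0..1} (kb j)" if "j \<in> {1..n}" for j unfolding kb_def
    by (intro bounded_ae_mult ker1 slice_okD(1)[OF ok(1)] that)
  have lb: "bounded_ae {0..1} (lb j)" if "j \<in> {1..m}" for j unfolding lb_def
    by (intro bounded_ae_mult ler1 slice_okD(2)[OF ok(1)] that)
  have v0: "bounded_ae {0..T} (\<lambda>t. v j (t, 0))" if "j \<in> {1..m}" for j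
    using system that T_pos by (intro Linf_imp_bounded_ae) (auto simp: system_solution_def)
  have u0: "AE t in lborel. t \<in> {0..T} \<longrightarrow> u j (t, 0) = (\<Sum>k=1..m. Q0 j k * v k (t, 0))" if "j \<in> {1..n}" for j
  proof -
    have "AE t in lebesgue_on {0..}. u j (t, 0) = (\<Sum>k=1..m. Q0 j k * v k (t, 0))"
      using system that by (auto simp: system_solution_def)
    then have "AE t in lborel. t \<in> {0..} \<longrightarrow> u j (t, 0) = (\<Sum>k=1..m. Q0 j k * v k (t, 0))"
      by (subst AE_lebesgue_on_iff[symmetric]) auto
    then show ?thesis by eventually_elim auto
  qed
  have shift: "bounded_ae {0..S} (\<lambda>s. f (t0 + s))" if "bounded_ae {0..T} f" for f :: "real \<Rightarrow> real"
    using bounded_ae_affine[OF that, of 1 "{0..S}" t0] t0 by auto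
  have reflect: "bounded_ae {0..S} (\<lambda>s. f (1 - \<mu> * s))" if "bounded_ae {0..1} f" for f :: "real \<Rightarrow> real"
    using bounded_ae_affine[OF that, of "- \<mu>" "{0..S}" 1] \<mu> \<mu>s by auto
  define kl ll where "kl = (\<lambda>j s. K i j (1 - \<mu> * s, 0) * u j (t0 + s, 0))"
    and "ll = (\<lambda>j s. L i j (1 - \<mu> * s, 0) * v j (t0 + s, 0))"
  have kl: "bounded_ae {0..S} (kl j)" if "j \<in> {1..n}" for j unfolding kl_def
  proof (intro bounded_ae_mult)
    have "bounded_ae {0..T} (\<lambda>t. \<Sum>k=1..m. Q0 j k * v k (t, 0))"
      by (intro bounded_ae_sum bounded_ae_mult bounded_ae_const v0)
    then have "bounded_ae {0..T} (\<lambda>t. u j (t, 0))"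
      by (rule bounded_ae_cong[rotated]) (use u0[OF that] in eventually_elim, auto)
    then show "bounded_ae {0..S} (\<lambda>s. u j (t0 + s, 0))" by (rule shift)
    show "bounded_ae {0..S} (\<lambda>s. K i j (1 - \<mu> * s, 0))" by (rule reflect) (rule kernel_traces(1)[OF i that])
  qed
  have ll: "bounded_ae {0..S} (ll j)" if "j \<in> {1..m}" for j unfolding ll_def
    by (intro bounded_ae_mult shift[OF v0[OF that]] reflect[OF kernel_traces(2)[OF i that]])
  have char: "AE s in lborel. s \<in> {0..S} \<longrightarrow>
     (\<forall>j\<in>{1..n}. u j (t0 + s, 1 - \<mu> * s) = u' j (t0 + s, 1 - \<mu> * s)) \<and>
     (\<forall>j\<in>{1..m}. v j (t0 + s, 1 - \<mu> * s) = v' j (t0 + s, 1 - \<mu> * s))"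
  proof -
    have "AE s in lborel. (t0 + s, 1 - \<mu> * s) \<in> strip \<longrightarrow>
     (\<forall>j\<in>{1..n}. u j (t0 + s, 1 - \<mu> * s) = u' j (t0 + s, 1 - \<mu> * s)) \<and>
     (\<forall>j\<in>{1..m}. v j (t0 + s, 1 - \<mu> * s) = v' j (t0 + s, 1 - \<mu> * s))"
      using ok(4) unfolding characteristic_ok_def \<mu>_def by blast
    then show ?thesis by eventually_elim (use in_strip in auto)
  qed
  have diag: "AE s in lborel. s \<in> {0..S} \<longrightarrow> f (1 - \<mu> * s, 1 - \<mu> * s) = c"
    if "AE x in lebesgue_on {0<..<1}. f (x, x) = c" for f :: "real \<times> real \<Rightarrow> real" and c
  proof -
    have "AE x in lborel. x \<in> {0<..<1} \<longrightarrow> f (x, x) = c"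
      using that by (subst AE_lebesgue_on_iff[symmetric]) auto
    then have "AE x in lborel. x \<in> {0..1} \<longrightarrow> f (x, x) = c"
      using AE_lborel_singleton[of "0::real"] AE_lborel_singleton[of "1::real"] by eventually_elim auto
    from AE_affine1[OF this, of "- \<mu>" 1] \<mu>(1)
    have "AE s in lborel. 1 - \<mu> * s \<in> {0..1} \<longrightarrow> f (1 - \<mu> * s, 1 - \<mu> * s) = c" by simp
    then show ?thesis by eventually_elim (use \<mu>s in auto)
  qed
  have Kd: "AE s in lborel. s \<in> {0..S} \<longrightarrow> K i j (1 - \<mu> * s, 1 - \<mu> * s) = - (Smp i j / (\<mu> + lam j))"
    if "j \<in> {1..n}" for j
    using kernel i that by (intro diag) (auto simp: kernel_solution_def \<mu>_def)
  have Ld: "AE s in lborel. s \<in> {0..S} \<longrightarrow> L i j (1 - \<mu> * s, 1 - \<mu> * s) = - (Smm i j / (\<mu> - mu j))"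
    if "j \<in> {1..m}" "j \<noteq> i" for j
    using kernel i that by (intro diag) (auto simp: kernel_solution_def \<mu>_def)
  define kr lr where "kr = (\<lambda>j s. K i j (1 - \<mu> * s, 1 - \<mu> * s) * u j (t0 + s, 1 - \<mu> * s))"
    and "lr = (\<lambda>j s. L i j (1 - \<mu> * s, 1 - \<mu> * s) * v j (t0 + s, 1 - \<mu> * s))"
  have ur: "bounded_ae {0..S} (\<lambda>s. u j (t0 + s, 1 - \<mu> * s))" if "j \<in> {1..n}" for j
  proof (rule bounded_ae_bounded_borel)
    show "bounded_borel (\<lambda>s. u' j (t0 + s, 1 - \<mu> * s))"
      using bounded_borel_line[OF rep_bounded(1), of j t0 1 1 "- \<mu>"] by simp
    show "AE s in lborel. s \<in> {0..S} \<longrightarrow> u j (t0 + s, 1 - \<mu> * s) = u' j (t0 + s, 1 - \<mu> * s)"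
      using char by eventually_elim (use that in auto)
  qed
  have vr: "bounded_ae {0..S} (\<lambda>s. v j (t0 + s, 1 - \<mu> * s))" if "j \<in> {1..m}" for j
  proof (rule bounded_ae_bounded_borel)
    show "bounded_borel (\<lambda>s. v' j (t0 + s, 1 - \<mu> * s))"
      using bounded_borel_line[OF rep_bounded(2), of j t0 1 1 "- \<mu>"] by simp
    show "AE s in lborel. s \<in> {0..S} \<longrightarrow> v j (t0 + s, 1 - \<mu> * s) = v' j (t0 + s, 1 - \<mu> * s)"
      using char by eventually_elim (use that in auto)
  qed
  have kr: "bounded_ae {0..S} (kr j)" if "j \<in> {1..n}" for j unfolding kr_def
  proof (intro bounded_ae_mult ur that)
    show "bounded_ae {0..S} (\<lambda>s. K i j (1 - \<mu> * s, 1 - \<mu> * s))"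
      by (rule bounded_ae_cong[OF _ bounded_ae_const[of _ "- (Smp i j / (\<mu> + lam j))"]])
        (use Kd[OF that] in eventually_elim, auto)
  qed
  \<comment> \<open>The kernel equations prescribe no diagonal value of \<open>L i i\<close>; its coefficient \<open>\<mu> - mu i\<close> vanishes.\<close>
  have lr: "bounded_ae {0..S} (lr j)" if "j \<in> {1..m}" "j \<noteq> i" for j unfolding lr_def
  proof (intro bounded_ae_mult vr that)
    show "bounded_ae {0..S} (\<lambda>s. L i j (1 - \<mu> * s, 1 - \<mu> * s))"
      by (rule bounded_ae_cong[OF _ bounded_ae_const[of _ "- (Smm i j / (\<mu> - mu j))"]])
        (use Ld[OF that] in eventually_elim, auto)
  qed
  define h1 where "h1 = (\<lambda>j p. K' i j (1 - \<mu> * fst p, snd p) * fu j (t0 + fst p, snd p)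
     - u' j (t0 + fst p, snd p) * gK i j (1 - \<mu> * fst p, snd p))"
  define h2 where "h2 = (\<lambda>j p. L' i j (1 - \<mu> * fst p, snd p) * fv j (t0 + fst p, snd p)
     - v' j (t0 + fst p, snd p) * gL i j (1 - \<mu> * fst p, snd p))"
  have bal1: "integral {0..1 - \<mu> * S} (kt j) - integral {0..1} (kb j) + (lam j + \<mu>) * integral {0..S} (kr j)
      - lam j * integral {0..S} (kl j) = (LINT p|lborel. indicator D p * h1 j p)" and b1: "bounded_borel (h1 j)"
    if j: "j \<in> {1..n}" for j
  proof -
    note pb = pair_balance[of S \<mu> "lam j" "K i j" _ "K' i j" "gK i j" strip "u j" _ "u' j" "fu j" t0,
        OF S(1) \<mu> _ K_weak(1)[OF i j, folded \<mu>_def] K_rep[OF i j] K_weak(2)[OF i j] rep_bounded(3) rhs_bounded(3)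
        u_weak(1)[OF j] u_rep[OF j] u_weak(2)[OF j] rep_bounded(1) rhs_bounded(1) strip_convex strip_sets sub
        int[OF kt[OF j, unfolded kt_def]] int[OF kb[OF j, unfolded kb_def]]
        int[OF kl[OF j, unfolded kl_def]] int[OF kr[OF j, unfolded kr_def]]]
    show "integral {0..1 - \<mu> * S} (kt j) - integral {0..1} (kb j) + (lam j + \<mu>) * integral {0..S} (kr j)
      - lam j * integral {0..S} (kl j) = (LINT p|lborel. indicator D p * h1 j p)" "bounded_borel (h1 j)"
      using pb lam_pos[OF j] unfolding kt_def kb_def kl_def kr_def h1_def D_def by auto
  qed
  have bal2: "integral {0..1 - \<mu> * S} (lt j) - integral {0..1} (lb j) + (\<mu> - mu j) * integral {0..S} (lr j)
      + mu j * integral {0..S} (ll j) = (LINT p|lborel. indicator D p * h2 j p)" and b2: "bounded_borel (h2 j)"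
    if j: "j \<in> {1..m}" for j
  proof -
    have w: "weak_transport triangle (\<mu>, - (- mu j)) (L i j)
        (\<lambda>p. (\<Sum>q=1..m. Smm q j * L i q p) + (\<Sum>k=1..n. Spm k j * K i k p))"
      using L_weak(1)[OF i j] by (simp add: \<mu>_def)
    \<comment> \<open>The premise forces j \<noteq> i, and then the diagonal value of
      \<open>L i j\<close> is prescribed.\<close>
    have r: "((\<lambda>s. L i j (1 - \<mu> * s, 1 - \<mu> * s) * v j (t0 + s, 1 - \<mu> * s)) has_integral integral {0..S} (lr j)) {0..S}"
      if "- mu j + \<mu> \<noteq> 0"
      using int[OF lr[OF j]] that unfolding lr_def \<mu>_def by auto
    note pb = pair_balance[of S \<mu> "- mu j" "L i j" _ "L' i j" "gL i j" strip "v j" _ "v' j" "fv j" t0,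
        OF S(1) \<mu> _ w L_rep[OF i j] L_weak(2)[OF i j] rep_bounded(4) rhs_bounded(4)
        v_weak(1)[OF j] v_rep[OF j] v_weak(2)[OF j] rep_bounded(2) rhs_bounded(2) strip_convex strip_sets sub
        int[OF lt[OF j, unfolded lt_def]] int[OF lb[OF j, unfolded lb_def]]
        int[OF ll[OF j, unfolded ll_def]] r]
    show "integral {0..1 - \<mu> * S} (lt j) - integral {0..1} (lb j) + (\<mu> - mu j) * integral {0..S} (lr j)
      + mu j * integral {0..S} (ll j) = (LINT p|lborel. indicator D p * h2 j p)" "bounded_borel (h2 j)"
      using pb mu_pos[OF j] unfolding lt_def lb_def ll_def h2_def D_def by auto
  qed
  have total: "(\<Sum>j=1..n. LINT p|lborel. indicator D p * h1 j p) + (\<Sum>j=1..m. LINT p|lborel. indicator D p * h2 j p) = 0"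
  proof -
    have Dc: "closed D" unfolding D_def case_prod_beta
      by (intro closed_Collect_conj closed_Collect_le continuous_intros)
    have integrable: "integrable lborel (\<lambda>p. indicator D p * h p)" if "bounded_borel h" for h :: "real \<times> real \<Rightarrow> real"
    proof -
      from that obtain C where C: "h \<in> borel_measurable borel" "\<forall>x. \<bar>h x\<bar> \<le> C" "0 \<le> C" by (rule bounded_borelE)
      show ?thesis
      proof (rule integrable_bounded_support[of _ C "(0, 0)" "(S, 1)"])
        show "(\<lambda>p. indicator D p * h p) \<in> borel_measurable borel"
          using C(1) Dc by (intro borel_measurable_times borel_measurable_indicator) auto
        show "\<bar>indicator D p * h p\<bar> \<le> C" for p using C(2)[rule_format, of p] C(3) by (cases "p \<in> D") simp_all
        show "indicator D p * h p = 0" if "p \<notin> cbox (0, 0) (S, 1)" for p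
          using that \<mu>s[of "fst p"] by (cases p) (auto simp: D_def indicator_def cbox_Pair_eq)
      qed
    qed
    have "(\<Sum>j=1..n. LINT p|lborel. indicator D p * h1 j p) + (\<Sum>j=1..m. LINT p|lborel. indicator D p * h2 j p)
        = (LINT p|lborel. (\<Sum>j=1..n. indicator D p * h1 j p) + (\<Sum>j=1..m. indicator D p * h2 j p))"
    proof -
      have 1: "integrable lborel (\<lambda>p. indicator D p * h1 j p)" if "j \<in> {1..n}" for j
        by (intro integrable b1 that)
      have 2: "integrable lborel (\<lambda>p. indicator D p * h2 j p)" if "j \<in> {1..m}" for j
        by (intro integrable b2 that)
      have s1: "(LINT p|lborel. (\<Sum>j=1..n. indicator D p * h1 j p)) = (\<Sum>j=1..n. LINT p|lborel. indicator D p * h1 j p)"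
        by (rule Bochner_Integration.integral_sum) (rule 1)
      have s2: "(LINT p|lborel. (\<Sum>j=1..m. indicator D p * h2 j p)) = (\<Sum>j=1..m. LINT p|lborel. indicator D p * h2 j p)"
        by (rule Bochner_Integration.integral_sum) (rule 2)
      show ?thesis
        unfolding s1[symmetric] s2[symmetric]
        by (rule Bochner_Integration.integral_add[symmetric]) (rule Bochner_Integration.integrable_sum, erule 1 2)+
    qed
    \<comment> \<open>Only the total vanishes, pointwise; the area terms of single pairs need
      not.\<close>
    also have "(\<lambda>p. (\<Sum>j=1..n. indicator D p * h1 j p) + (\<Sum>j=1..m. indicator D p * h2 j p)) = (\<lambda>p. 0)"
      unfolding h1_def h2_def sum_distrib_left[symmetric] distrib_left[symmetric] interior_terms_cancel by simp
    finally show ?thesis by simp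
  qed
  define \<Sigma>1 where "\<Sigma>1 = (\<lambda>a. \<Sum>j=1..n. a j :: real)"
  define \<Sigma>2 where "\<Sigma>2 = (\<lambda>a. \<Sum>j=1..m. a j :: real)"
  have hi1: "((\<lambda>s. \<Sigma>1 (\<lambda>j. c j * f j s)) has_integral \<Sigma>1 (\<lambda>j. c j * integral {a..b} (f j))) {a..b}"
    if "\<And>j. j \<in> {1..n} \<Longrightarrow> bounded_ae {a..b} (f j)" for c and f :: "nat \<Rightarrow> real \<Rightarrow> real" and a b
    unfolding \<Sigma>1_def by (intro has_integral_sum has_integral_mult_right int that) auto
  \<comment> \<open>Integrability is asked only where the coefficient is nonzero: on the right side
    \<open>lr i\<close> comes with \<mu> - \<open>mu i\<close> = 0.\<close>
  have hi2: "((\<lambda>s. \<Sigma>2 (\<lambda>j. c j * f j s)) has_integral \<Sigma>2 (\<lambda>j. c j * integral {a..b} (f j))) {a..b}"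
    if "\<And>j. j \<in> {1..m} \<Longrightarrow> c j \<noteq> 0 \<Longrightarrow> bounded_ae {a..b} (f j)" for c and f :: "nat \<Rightarrow> real \<Rightarrow> real" and a b
    unfolding \<Sigma>2_def
  proof (intro has_integral_sum)
    fix j assume "j \<in> {1..m}"
    then show "((\<lambda>s. c j * f j s) has_integral c j * integral {a..b} (f j)) {a..b}"
      using has_integral_mult_right[OF int[OF that[of j]], of "c j"] by (cases "c j = 0") auto
  qed simp
  have top: "W i (1 - \<mu> * S) (t0 + S) = \<Sigma>1 (\<lambda>j. integral {0..1 - \<mu> * S} (kt j)) + \<Sigma>2 (\<lambda>j. integral {0..1 - \<mu> * S} (lt j))"
  proof -
    have "((\<lambda>\<xi>. \<Sigma>1 (\<lambda>j. 1 * kt j \<xi>) + \<Sigma>2 (\<lambda>j. 1 * lt j \<xi>)) has_integral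
        \<Sigma>1 (\<lambda>j. 1 * integral {0..1 - \<mu> * S} (kt j)) + \<Sigma>2 (\<lambda>j. 1 * integral {0..1 - \<mu> * S} (lt j))) {0..1 - \<mu> * S}"
      by (intro has_integral_add hi1 hi2 kt lt)
    from integral_unique[OF this] show ?thesis
      by (simp add: W_def \<Sigma>1_def \<Sigma>2_def kt_def lt_def)
  qed
  have bot: "W i 1 t0 = \<Sigma>1 (\<lambda>j. integral {0..1} (kb j)) + \<Sigma>2 (\<lambda>j. integral {0..1} (lb j))"
  proof -
    have "((\<lambda>\<xi>. \<Sigma>1 (\<lambda>j. 1 * kb j \<xi>) + \<Sigma>2 (\<lambda>j. 1 * lb j \<xi>)) has_integral
        \<Sigma>1 (\<lambda>j. 1 * integral {0..1} (kb j)) + \<Sigma>2 (\<lambda>j. 1 * integral {0..1} (lb j))) {0..1}"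
      by (intro has_integral_add hi1 hi2 kb lb)
    from integral_unique[OF this] show ?thesis
      by (simp add: W_def \<Sigma>1_def \<Sigma>2_def kb_def lb_def)
  qed
  \<comment> \<open>Inserting \<open>u = Q0 v\<close> at \<xi> = 0 gives \<open>v k\<close> the
    coefficient \<open>\<Sum>j. lam j * K i j * Q0 j k\<close>. For k \<ge> i the kernel condition
    makes it \<open>mu k * L i k\<close>; for k < i the trace of \<open>v k\<close> is already
    0.\<close>
  have left: "\<Sigma>1 (\<lambda>j. lam j * integral {0..S} (kl j)) - \<Sigma>2 (\<lambda>j. mu j * integral {0..S} (ll j)) = 0"
  proof -
    have "AE t in lborel. \<forall>j\<in>{1..n}. t \<in> {0..T} \<longrightarrow> u j (t, 0) = (\<Sum>k=1..m. Q0 j k * v k (t, 0))"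
      by (intro AE_finite_allI u0) auto
    from AE_affine1[OF this, of 1 t0]
    have ae1: "AE s in lborel. \<forall>j\<in>{1..n}. t0 + s \<in> {0..T} \<longrightarrow> u j (t0 + s, 0) = (\<Sum>k=1..m. Q0 j k * v k (t0 + s, 0))"
      by simp
    have "AE t in lborel. \<forall>j\<in>{j\<in>{1..m}. j < i}. t0 \<le> t \<and> t \<le> T \<longrightarrow> v j (t, 0) = 0"
      by (intro AE_finite_allI vanish) auto
    from AE_affine1[OF this, of 1 t0]
    have ae2: "AE s in lborel. \<forall>j\<in>{j\<in>{1..m}. j < i}. t0 \<le> t0 + s \<and> t0 + s \<le> T \<longrightarrow> v j (t0 + s, 0) = 0"
      by simp
    have "AE x in lborel. \<forall>j\<in>{j\<in>{1..m}. i \<le> j}. x \<in> {0<..<1} \<longrightarrow>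
        mu j * L i j (x, 0) = (\<Sum>k=1..n. lam k * K i k (x, 0) * Q0 k j)"
    proof (intro AE_finite_allI)
      fix j assume "j \<in> {j\<in>{1..m}. i \<le> j}"
      then have "AE x in lebesgue_on {0<..<1}. mu j * L i j (x, 0) = (\<Sum>k=1..n. lam k * K i k (x, 0) * Q0 k j)"
        using kernel i by (auto simp: kernel_solution_def)
      then show "AE x in lborel. x \<in> {0<..<1} \<longrightarrow> mu j * L i j (x, 0) = (\<Sum>k=1..n. lam k * K i k (x, 0) * Q0 k j)"
        by (subst AE_lebesgue_on_iff[symmetric]) auto
    qed simp
    then have "AE x in lborel. \<forall>j\<in>{j\<in>{1..m}. i \<le> j}. x \<in> {0..1} \<longrightarrow>
        mu j * L i j (x, 0) = (\<Sum>k=1..n. lam k * K i k (x, 0) * Q0 k j)"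
      using AE_lborel_singleton[of "0::real"] AE_lborel_singleton[of "1::real"] by eventually_elim auto
    from AE_affine1[OF this, of "- \<mu>" 1] \<mu>(1)
    have ae3: "AE s in lborel. \<forall>j\<in>{j\<in>{1..m}. i \<le> j}. 1 - \<mu> * s \<in> {0..1} \<longrightarrow>
        mu j * L i j (1 - \<mu> * s, 0) = (\<Sum>k=1..n. lam k * K i k (1 - \<mu> * s, 0) * Q0 k j)"
      by simp
    have "AE s in lborel. s \<in> {0..S} \<longrightarrow> \<Sigma>1 (\<lambda>j. lam j * kl j s) - \<Sigma>2 (\<lambda>j. mu j * ll j s) = 0"
      using ae1 ae2 ae3
    proof eventually_elim
      case (elim s)
      show ?case
      proof
        assume s: "s \<in> {0..S}"
        then have s1: "t0 + s \<in> {0..T}" "1 - \<mu> * s \<in> {0..1}" using t0 \<mu>s[of s] by auto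
        have "\<Sigma>1 (\<lambda>j. lam j * kl j s) = (\<Sum>j=1..n. \<Sum>k=1..m. lam j * K i j (1 - \<mu> * s, 0) * Q0 j k * v k (t0 + s, 0))"
          unfolding \<Sigma>1_def kl_def using elim(1) s1 by (simp add: sum_distrib_left mult_ac)
        also have "\<dots> = (\<Sum>k=1..m. (\<Sum>j=1..n. lam j * K i j (1 - \<mu> * s, 0) * Q0 j k) * v k (t0 + s, 0))"
          by (subst sum.swap) (simp add: sum_distrib_right)
        also have "\<dots> = \<Sigma>2 (\<lambda>k. mu k * ll k s)"
          unfolding \<Sigma>2_def ll_def
        proof (rule sum.cong[OF refl])
          fix k assume k: "k \<in> {1..m}"
          show "(\<Sum>j=1..n. lam j * K i j (1 - \<mu> * s, 0) * Q0 j k) * v k (t0 + s, 0) =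
              mu k * (L i k (1 - \<mu> * s, 0) * v k (t0 + s, 0))"
          proof (cases "k < i")
            case True
            then have "v k (t0 + s, 0) = 0" using elim(2) k s s1 by auto
            then show ?thesis by simp
          next
            case False
            then have "mu k * L i k (1 - \<mu> * s, 0) = (\<Sum>j=1..n. lam j * K i j (1 - \<mu> * s, 0) * Q0 j k)"
              using elim(3) k s1 by auto
            then show ?thesis by simp
          qed
        qed
        finally show "\<Sigma>1 (\<lambda>j. lam j * kl j s) - \<Sigma>2 (\<lambda>j. mu j * ll j s) = 0" by simp
      qed
    qed
    moreover have "((\<lambda>s. \<Sigma>1 (\<lambda>j. lam j * kl j s) - \<Sigma>2 (\<lambda>j. mu j * ll j s)) has_integral
        \<Sigma>1 (\<lambda>j. lam j * integral {0..S} (kl j)) - \<Sigma>2 (\<lambda>j. mu j * integral {0..S} (ll j))) {0..S}"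
      by (intro has_integral_diff hi1 hi2 kl ll)
    ultimately have "((\<lambda>s. 0) has_integral
        \<Sigma>1 (\<lambda>j. lam j * integral {0..S} (kl j)) - \<Sigma>2 (\<lambda>j. mu j * integral {0..S} (ll j))) {0..S}"
      by (rule has_integral_AE_cong)
    then show ?thesis by (rule has_integral_unique) simp
  qed
  \<comment> \<open>The diagonal values are designed for this: multiplied by the flux factors they
    become \<open>- Smp i j\<close> and \<open>- Smm i j\<close>, and the flux density is
    \<open>- fv i\<close>. For \<open>j = i\<close> both sides are 0 because
    \<open>Smm i i = 0\<close>.\<close>
  have right: "\<Sigma>1 (\<lambda>j. (lam j + \<mu>) * integral {0..S} (kr j)) + \<Sigma>2 (\<lambda>j. (\<mu> - mu j) * integral {0..S} (lr j))
      = - (v i (t0 + S, 1 - \<mu> * S) - v i (t0, 1))"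
  proof -
    have aeK: "AE s in lborel. \<forall>j\<in>{1..n}. s \<in> {0..S} \<longrightarrow> K i j (1 - \<mu> * s, 1 - \<mu> * s) = - (Smp i j / (\<mu> + lam j))"
      by (intro AE_finite_allI Kd) auto
    have aeL: "AE s in lborel. \<forall>j\<in>{1..m} - {i}. s \<in> {0..S} \<longrightarrow> L i j (1 - \<mu> * s, 1 - \<mu> * s) = - (Smm i j / (\<mu> - mu j))"
      by (intro AE_finite_allI Ld) auto
    have "AE s in lborel. s \<in> {0..S} \<longrightarrow>
        \<Sigma>1 (\<lambda>j. (lam j + \<mu>) * kr j s) + \<Sigma>2 (\<lambda>j. (\<mu> - mu j) * lr j s) = - fv i (t0 + s, 1 - \<mu> * s)"
      using aeK aeL char
    proof eventually_elim
      case (elim s)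
      show ?case
      proof
        assume s: "s \<in> {0..S}"
        have "\<Sigma>1 (\<lambda>j. (lam j + \<mu>) * kr j s) = (\<Sum>j=1..n. - (Smp i j * u' j (t0 + s, 1 - \<mu> * s)))"
          unfolding \<Sigma>1_def kr_def
        proof (rule sum.cong[OF refl])
          fix j assume j: "j \<in> {1..n}"
          then have "\<mu> + lam j \<noteq> 0" using lam_pos[OF j] \<mu> by simp
          then show "(lam j + \<mu>) * (K i j (1 - \<mu> * s, 1 - \<mu> * s) * u j (t0 + s, 1 - \<mu> * s)) =
              - (Smp i j * u' j (t0 + s, 1 - \<mu> * s))"
            using elim(1,3) s j by (simp add: add.commute)
        qed
        moreover have "\<Sigma>2 (\<lambda>j. (\<mu> - mu j) * lr j s) = (\<Sum>j=1..m. - (Smm i j * v' j (t0 + s, 1 - \<mu> * s)))"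
          unfolding \<Sigma>2_def lr_def
        proof (rule sum.cong[OF refl])
          fix j assume j: "j \<in> {1..m}"
          show "(\<mu> - mu j) * (L i j (1 - \<mu> * s, 1 - \<mu> * s) * v j (t0 + s, 1 - \<mu> * s)) =
              - (Smm i j * v' j (t0 + s, 1 - \<mu> * s))"
          proof (cases "j = i")
            case True
            then show ?thesis using Smm_diag[OF i] by (simp add: \<mu>_def)
          next
            case False
            then have "\<mu> - mu j \<noteq> 0" using mu_inj[OF i j] by (auto simp: \<mu>_def)
            then show ?thesis using elim(2,3) s j False by simp
          qed
        qed
        ultimately show "\<Sigma>1 (\<lambda>j. (lam j + \<mu>) * kr j s) + \<Sigma>2 (\<lambda>j. (\<mu> - mu j) * lr j s) = - fv i (t0 + s, 1 - \<mu> * s)"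
          by (simp add: fv_def sum_negf)
      qed
    qed
    moreover have "((\<lambda>s. \<Sigma>1 (\<lambda>j. (lam j + \<mu>) * kr j s) + \<Sigma>2 (\<lambda>j. (\<mu> - mu j) * lr j s)) has_integral
        \<Sigma>1 (\<lambda>j. (lam j + \<mu>) * integral {0..S} (kr j)) + \<Sigma>2 (\<lambda>j. (\<mu> - mu j) * integral {0..S} (lr j))) {0..S}"
      by (intro has_integral_add hi1 hi2 kr lr) (auto simp: \<mu>_def)
    ultimately have "((\<lambda>s. - fv i (t0 + s, 1 - \<mu> * s)) has_integral
        \<Sigma>1 (\<lambda>j. (lam j + \<mu>) * integral {0..S} (kr j)) + \<Sigma>2 (\<lambda>j. (\<mu> - mu j) * integral {0..S} (lr j))) {0..S}"
      by (rule has_integral_AE_cong)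
    moreover have "((\<lambda>s. - fv i (t0 + s, 1 - \<mu> * s)) has_integral - (v i (t0 + S, 1 - \<mu> * S) - v i (t0, 1))) {0..S}"
    proof (rule has_integral_neg)
      have "(t0, 1) \<in> strip" "(t0 + S, 1 - mu i * S) \<in> strip"
        using in_strip[of 0] in_strip[of S] S by (auto simp: \<mu>_def)
      then show "((\<lambda>s. fv i (t0 + s, 1 - \<mu> * s)) has_integral v i (t0 + S, 1 - \<mu> * S) - v i (t0, 1)) {0..S}"
        using ok(4) S(1) unfolding characteristic_ok_def \<mu>_def by auto
    qed
    ultimately show ?thesis by (rule has_integral_unique)
  qed
  have "\<Sigma>1 (\<lambda>j. integral {0..1 - \<mu> * S} (kt j)) - \<Sigma>1 (\<lambda>j. integral {0..1} (kb j))
      + \<Sigma>1 (\<lambda>j. (lam j + \<mu>) * integral {0..S} (kr j)) - \<Sigma>1 (\<lambda>j. lam j * integral {0..S} (kl j))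
      = (\<Sum>j=1..n. LINT p|lborel. indicator D p * h1 j p)"
    unfolding \<Sigma>1_def sum.distrib[symmetric] sum_subtractf[symmetric] by (rule sum.cong[OF refl bal1])
  moreover have "\<Sigma>2 (\<lambda>j. integral {0..1 - \<mu> * S} (lt j)) - \<Sigma>2 (\<lambda>j. integral {0..1} (lb j))
      + \<Sigma>2 (\<lambda>j. (\<mu> - mu j) * integral {0..S} (lr j)) + \<Sigma>2 (\<lambda>j. mu j * integral {0..S} (ll j))
      = (\<Sum>j=1..m. LINT p|lborel. indicator D p * h2 j p)"
    unfolding \<Sigma>2_def sum.distrib[symmetric] sum_subtractf[symmetric] by (rule sum.cong[OF refl bal2])
  moreover have "v i (t0, 1) = W i 1 t0" using ok(4) t0 unfolding characteristic_ok_def by blast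
  ultimately have "v i (t0 + S, 1 - \<mu> * S) = W i (1 - \<mu> * S) (t0 + S)"
    using top bot left right total by linarith
  then show ?thesis by (simp add: \<mu>_def)
qed

section \<open>Successive vanishing of the traces of v at x = 0\<close>

definition "vanish_time i = (\<Sum>j=1..i. 1 / mu j)"

lemma vanish_time_mono:
  assumes "j \<le> i" "i \<le> m"
  shows "vanish_time j \<le> vanish_time i"
  unfolding vanish_time_def using assms
  by (intro sum_mono2) (auto intro!: less_imp_le mu_pos)

lemma vanish_time_nonneg: "i \<le> m \<Longrightarrow> 0 \<le> vanish_time i"
  unfolding vanish_time_def by (intro sum_nonneg) (auto intro!: less_imp_le mu_pos)

text \<open>After \<open>vanish_time (i - 1)\<close> the traces of all \<open>v j\<close> with j < i
  have died out; for \<open>i = 1\<close> this time is 0. The duration \<open>S\<close> is fixed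
  before the generic \<open>t0\<close>, so that the end point may be put exactly at x = 0.\<close>

lemma v_trace_on_characteristic_from:
  assumes i: "i \<in> {1..m}" and S: "0 < S" "mu i * S \<le> 1" "kernel_slice_ok i (1 - mu i * S)"
    and vanish: "\<And>j. j \<in> {1..m} \<Longrightarrow> j < i \<Longrightarrow> AE t in lborel. vanish_time j \<le> t \<and> t \<le> T \<longrightarrow> v j (t, 0) = 0"
  shows "AE t0 in lborel. vanish_time (i - 1) \<le> t0 \<and> t0 + S \<le> T \<longrightarrow>
    slice_ok (t0 + S) \<and> v i (t0 + S, 1 - mu i * S) = W i (1 - mu i * S) (t0 + S)"
proof -
  from AE_affine1[OF AE_slice_ok, of 1 S]
  have "AE t0 in lborel. t0 + S \<in> {0..T} \<longrightarrow> slice_ok (t0 + S)" by (simp add: add.commute)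
  with AE_slice_ok AE_characteristic_ok[OF i] show ?thesis
  proof (eventually_elim, intro impI)
    fix t0
    assume ok: "t0 \<in> {0..T} \<longrightarrow> slice_ok t0" "characteristic_ok i t0" "t0 + S \<in> {0..T} \<longrightarrow> slice_ok (t0 + S)"
      and t0: "vanish_time (i - 1) \<le> t0 \<and> t0 + S \<le> T"
    have "i - 1 \<le> m" using i by auto
    from vanish_time_nonneg[OF this] t0 have "0 \<le> t0" by linarith
    with ok t0 S have "slice_ok t0" "slice_ok (t0 + S)" by auto
    moreover have "AE t in lborel. t0 \<le> t \<and> t \<le> T \<longrightarrow> v j (t, 0) = 0" if "j \<in> {1..m}" "j < i" for j
    proof -
      have "j \<le> i - 1" "i - 1 \<le> m" using that i by auto
      from vanish_time_mono[OF this] t0 have "vanish_time j \<le> t0" by linarith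
      with vanish[OF that] show ?thesis by (elim eventually_mono) (meson order_trans)
    qed
    ultimately show "slice_ok (t0 + S) \<and> v i (t0 + S, 1 - mu i * S) = W i (1 - mu i * S) (t0 + S)"
      using v_trace_on_characteristic[OF i S(1,2) \<open>0 \<le> t0\<close> _ _ _ S(3) ok(2)] t0 by blast
  qed
qed

lemma v_trace_vanishes:
  assumes "i \<in> {1..m}"
  shows "AE t in lborel. vanish_time i \<le> t \<and> t \<le> T \<longrightarrow> v i (t, 0) = 0"
  using assms
proof (induction i rule: less_induct)
  case (less i)
  \<comment> \<open>The full crossing time from x = 1 to x = 0, where \<open>W\<close> is an
    integral over one point.\<close>
  define S where "S = 1 / mu i"
  have \<mu>: "0 < mu i" using mu_pos[OF less.prems] .
  have S: "0 < S" "mu i * S = 1" using \<mu> by (auto simp: S_def)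
  \<comment> \<open>The kernel slice at x = 0 is a single point, so its condition is
    automatic.\<close>
  have "bounded_ae {0..0} f" for f :: "real \<Rightarrow> real"
    by (rule bounded_ae_cong[OF _ bounded_ae_const[of _ 0]])
      (use AE_lborel_singleton[of "0::real"] in eventually_elim, auto)
  then have "kernel_slice_ok i (1 - mu i * S)" using S(2) by (simp add: kernel_slice_ok_def)
  then have "AE t0 in lborel. vanish_time (i - 1) \<le> t0 \<and> t0 + S \<le> T \<longrightarrow>
    slice_ok (t0 + S) \<and> v i (t0 + S, 1 - mu i * S) = W i (1 - mu i * S) (t0 + S)"
    by (intro v_trace_on_characteristic_from less) (use S in auto)
  \<comment> \<open>Change from the departure time \<open>t0\<close> to the arrival time
    \<open>t0 + S\<close>.\<close>
  from AE_affine1[OF this one_neq_zero, of "- S"]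
  have "AE t in lborel. vanish_time (i - 1) \<le> t - S \<and> t \<le> T \<longrightarrow> v i (t, 0) = 0"
    unfolding S(2) by eventually_elim (simp add: W_def)
  moreover have "vanish_time i = vanish_time (i - 1) + S"
    using less.prems unfolding vanish_time_def S_def by (cases i) auto
  ultimately show ?case by (elim eventually_mono) simp
qed

section \<open>The Volterra equation at almost every point\<close>

definition "W' i p = (LINT \<xi>|lborel. indicator {0..snd p} \<xi> *
  ((\<Sum>j=1..n. K' i j (snd p, \<xi>) * u' j (fst p, \<xi>)) + (\<Sum>j=1..m. L' i j (snd p, \<xi>) * v' j (fst p, \<xi>))))"

lemma W'_integrand:
  "bounded_borel (\<lambda>\<xi>. (\<Sum>j=1..n. K' i j (x, \<xi>) * u' j (t, \<xi>)) + (\<Sum>j=1..m. L' i j (x, \<xi>) * v' j (t, \<xi>)))"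
proof -
  have "bounded_borel (\<lambda>\<xi>. f (a, \<xi>))" if "bounded_borel f" for f :: "real \<times> real \<Rightarrow> real" and a
    using bounded_borel_line[OF that, of a 0 0 1] by simp
  note this[OF rep_bounded(1)] this[OF rep_bounded(2)] this[OF rep_bounded(3)] this[OF rep_bounded(4)]
  then show ?thesis
    by (intro bounded_borel_add bounded_borel_sum bounded_borel_mult) auto
qed

lemma W'_has_integral:
  "((\<lambda>\<xi>. (\<Sum>j=1..n. K' i j (x, \<xi>) * u' j (t, \<xi>)) + (\<Sum>j=1..m. L' i j (x, \<xi>) * v' j (t, \<xi>)))
    has_integral W' i (t, x)) {0..x}"
proof -
  define h where "h = (\<lambda>\<xi>. (\<Sum>j=1..n. K' i j (x, \<xi>) * u' j (t, \<xi>)) + (\<Sum>j=1..m. L' i j (x, \<xi>) * v' j (t, \<xi>)))"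
  from W'_integrand[of i x t] obtain C where C: "h \<in> borel_measurable borel" "\<forall>x. \<bar>h x\<bar> \<le> C" "0 \<le> C"
    unfolding h_def by (rule bounded_borelE)
  have "integrable lborel (\<lambda>\<xi>. indicator {0..x} \<xi> * h \<xi>)"
    by (rule integrable_bounded_support[of _ C 0 x]) (use C in \<open>auto simp: indicator_def\<close>)
  from has_integral_integral_lborel[OF this]
  have "((\<lambda>\<xi>. indicator {0..x} \<xi> * h \<xi>) has_integral W' i (t, x)) UNIV" by (simp add: W'_def h_def)
  also have "(\<lambda>\<xi>. indicator {0..x} \<xi> * h \<xi>) = (\<lambda>\<xi>. if \<xi> \<in> {0..x} then h \<xi> else 0)" by (auto simp: indicator_def)
  finally show ?thesis unfolding h_def by (simp only: has_integral_restrict_UNIV)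
qed

lemma W_eq_W':
  assumes "x \<le> 1" "slice_ok t"
    and "AE \<xi> in lborel. \<xi> \<in> {0..x} \<longrightarrow>
      (\<forall>j\<in>{1..n}. K i j (x, \<xi>) = K' i j (x, \<xi>)) \<and> (\<forall>j\<in>{1..m}. L i j (x, \<xi>) = L' i j (x, \<xi>))"
  shows "W i x t = W' i (t, x)"
  unfolding W_def
proof (rule integral_unique, rule has_integral_AE_cong[OF _ W'_has_integral])
  show "AE \<xi> in lborel. \<xi> \<in> {0..x} \<longrightarrow>
      (\<Sum>j=1..n. K' i j (x, \<xi>) * u' j (t, \<xi>)) + (\<Sum>j=1..m. L' i j (x, \<xi>) * v' j (t, \<xi>)) =
      (\<Sum>j=1..n. K i j (x, \<xi>) * u j (t, \<xi>)) + (\<Sum>j=1..m. L i j (x, \<xi>) * v j (t, \<xi>))"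
    using assms(2)[unfolded slice_ok_def] assms(3) by eventually_elim (use assms(1) in auto)
qed

text \<open>Joint measurability in time and space is what \<open>W'\<close> is made for: the
  Volterra equation is proved line by line and must define a Borel predicate to hold almost
  everywhere in the plane. It follows because the integrand is jointly Borel.\<close>

lemma W'_measurable: "W' i \<in> borel_measurable borel"
proof -
  have pull: "(\<lambda>q. f (\<phi> q)) \<in> borel_measurable borel"
    if "bounded_borel f" "continuous_on UNIV \<phi>" for f :: "real \<times> real \<Rightarrow> real" and \<phi> :: "(real \<times> real) \<times> real \<Rightarrow> real \<times> real"
    using measurable_compose[OF borel_measurable_continuous_onI[OF that(2)] bounded_borel_measurable[OF that(1)]] .
  have "closed {q :: (real \<times> real) \<times> real. 0 \<le> snd q \<and> snd q \<le> snd (fst q)}"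
    by (intro closed_Collect_conj closed_Collect_le continuous_intros)
  then have "(\<lambda>q. indicator {q. 0 \<le> snd q \<and> snd q \<le> snd (fst q)} q *
      ((\<Sum>j=1..n. K' i j (snd (fst q), snd q) * u' j (fst (fst q), snd q)) +
       (\<Sum>j=1..m. L' i j (snd (fst q), snd q) * v' j (fst (fst q), snd q))))
      \<in> borel_measurable (borel :: ((real \<times> real) \<times> real) measure)"
    by (intro borel_measurable_times borel_measurable_indicator borel_measurable_add borel_measurable_sum
        pull rep_bounded continuous_intros) auto
  also have "borel_measurable (borel :: ((real \<times> real) \<times> real) measure) = borel_measurable (borel \<Otimes>\<^sub>M lborel)"
    by (intro measurable_cong_sets) (simp_all add: borel_prod[symmetric] cong: sets_pair_measure_cong)
  finally have "(\<lambda>(p, \<xi>). indicator {0..snd p} \<xi> *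
      ((\<Sum>j=1..n. K' i j (snd p, \<xi>) * u' j (fst p, \<xi>)) + (\<Sum>j=1..m. L' i j (snd p, \<xi>) * v' j (fst p, \<xi>))))
      \<in> borel_measurable (borel \<Otimes>\<^sub>M lborel)"
    by (rule back_subst[of "\<lambda>f. f \<in> _"]) (auto simp: fun_eq_iff indicator_def)
  from lborel.borel_measurable_lebesgue_integral[OF this] show ?thesis
    unfolding W'_def[abs_def] .
qed

text \<open>A point of the strip is described by the departure time \<open>t0\<close> and the
  elapsed time \<open>S\<close> of its characteristic of \<open>v i\<close>. The crossing takes at
  most \<open>1 / mu i\<close>, so arrival after \<open>vanish_time i\<close> means departure after
  \<open>vanish_time (i - 1)\<close>.\<close>

lemma v_volterra:
  assumes i: "i \<in> {1..m}"
  shows "AE p in lborel. vanish_time i \<le> fst p \<and> p \<in> strip \<longrightarrow> v' i p = W' i p"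
proof (rule AE_affine2I)
  have \<mu>: "0 < mu i" using mu_pos[OF i] .
  have [measurable]: "v' i \<in> borel_measurable borel" "W' i \<in> borel_measurable borel"
    using rep_bounded(2) W'_measurable by (auto intro: bounded_borel_measurable)
  have "closed {p. vanish_time i \<le> fst p \<and> p \<in> strip}"
    by (intro closed_Collect_conj closed_Collect_le continuous_intros) (auto intro: closed_Times)
  then have "{p. vanish_time i \<le> fst p \<and> p \<in> strip} \<in> sets borel" by (rule borel_closed)
  then have [measurable]: "Measurable.pred borel (\<lambda>p. vanish_time i \<le> fst p \<and> p \<in> strip)" by (simp add: pred_def)
  show "Measurable.pred borel (\<lambda>p. vanish_time i \<le> fst p \<and> p \<in> strip \<longrightarrow> v' i p = W' i p)" by measurable
  show "1 * 0 - 1 * (- mu i) \<noteq> 0" using \<mu> by simp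
  then have det: "1 * 0 - 1 * (- mu i) \<noteq> 0" .
  have rep: "AE S in lborel. AE t0 in lborel. (0 + 1 * S + 1 * t0, 1 + (- mu i) * S + 0 * t0) \<in> strip \<longrightarrow>
      v i (0 + 1 * S + 1 * t0, 1 + (- mu i) * S + 0 * t0) = v' i (0 + 1 * S + 1 * t0, 1 + (- mu i) * S + 0 * t0)"
    by (rule AE_affine2D[OF v_rep[OF i] det])
  from AE_affine1[OF AE_kernel_slice[OF i], of "- mu i" 1] \<mu>
  have ker: "AE S in lborel. 1 - mu i * S \<in> {0..1} \<longrightarrow> kernel_slice_ok i (1 - mu i * S) \<and>
    (AE \<xi> in lborel. \<xi> \<in> {0..1 - mu i * S} \<longrightarrow>
      (\<forall>j\<in>{1..n}. K i j (1 - mu i * S, \<xi>) = K' i j (1 - mu i * S, \<xi>)) \<and>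
      (\<forall>j\<in>{1..m}. L i j (1 - mu i * S, \<xi>) = L' i j (1 - mu i * S, \<xi>)))"
    by simp
  show "AE S in lborel. AE t0 in lborel. vanish_time i \<le> fst (0 + 1 * S + 1 * t0, 1 + (- mu i) * S + 0 * t0) \<and>
      (0 + 1 * S + 1 * t0, 1 + (- mu i) * S + 0 * t0) \<in> strip \<longrightarrow>
      v' i (0 + 1 * S + 1 * t0, 1 + (- mu i) * S + 0 * t0) = W' i (0 + 1 * S + 1 * t0, 1 + (- mu i) * S + 0 * t0)"
    using rep ker AE_lborel_singleton[of "0::real"]
  proof eventually_elim
    case (elim S)
    show ?case
    proof (cases "0 < S \<and> mu i * S \<le> 1")
      case True
      then have x: "1 - mu i * S \<in> {0..1}" using \<mu> by auto
      note k = elim(2)[rule_format, OF x]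
      have "AE t0 in lborel. vanish_time (i - 1) \<le> t0 \<and> t0 + S \<le> T \<longrightarrow>
          slice_ok (t0 + S) \<and> v i (t0 + S, 1 - mu i * S) = W i (1 - mu i * S) (t0 + S)"
        by (intro v_trace_on_characteristic_from i v_trace_vanishes conjunct1[OF k]) (use True in auto)
      with elim(1) show ?thesis
      proof (eventually_elim, intro impI)
        fix t0
        assume 1: "(0 + 1 * S + 1 * t0, 1 + (- mu i) * S + 0 * t0) \<in> strip \<longrightarrow>
            v i (0 + 1 * S + 1 * t0, 1 + (- mu i) * S + 0 * t0) = v' i (0 + 1 * S + 1 * t0, 1 + (- mu i) * S + 0 * t0)"
          and 2: "vanish_time (i - 1) \<le> t0 \<and> t0 + S \<le> T \<longrightarrow>
            slice_ok (t0 + S) \<and> v i (t0 + S, 1 - mu i * S) = W i (1 - mu i * S) (t0 + S)"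
          and 3: "vanish_time i \<le> fst (0 + 1 * S + 1 * t0, 1 + (- mu i) * S + 0 * t0) \<and>
            (0 + 1 * S + 1 * t0, 1 + (- mu i) * S + 0 * t0) \<in> strip"
        have pt: "(0 + 1 * S + 1 * t0, 1 + (- mu i) * S + 0 * t0) = (t0 + S, 1 - mu i * S)" by simp
        have "vanish_time i = vanish_time (i - 1) + 1 / mu i"
          using i unfolding vanish_time_def by (cases i) auto
        moreover have "S \<le> 1 / mu i" using True \<mu> by (simp add: field_simps)
        ultimately have "vanish_time (i - 1) \<le> t0" "t0 + S \<le> T" using 3 by auto
        with 1 2 3 have "v' i (t0 + S, 1 - mu i * S) = W i (1 - mu i * S) (t0 + S)" "slice_ok (t0 + S)"
          unfolding pt by auto
        with W_eq_W'[OF _ _ conjunct2[OF k]] x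
        show "v' i (0 + 1 * S + 1 * t0, 1 + (- mu i) * S + 0 * t0) = W' i (0 + 1 * S + 1 * t0, 1 + (- mu i) * S + 0 * t0)"
          unfolding pt by simp
      qed
    next
      \<comment> \<open>With S = 0 excluded as a null set, S < 0 or \<mu> S > 1 puts the point
        outside the strip.\<close>
      case False
      then have "1 + (- mu i) * S \<notin> {0..1}"
        using elim(3) \<mu> by (auto simp: zero_le_mult_iff)
      then show ?thesis by auto
    qed
  qed
qed

section \<open>Decay in an exponentially weighted norm\<close>

text \<open>The slope \<open>1 / lam 1\<close> belongs to the slowest component of \<open>u\<close>.
  The region is also stable under lowering x \<ge> 0 at fixed time, as the Volterra integrals
  require, and it contains the entire slices from \<open>vanish_time m + 1 / lam 1\<close> up to
  \<open>T\<close>.\<close>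

definition "quiet = {p. vanish_time m + snd p / lam 1 \<le> fst p \<and> p \<in> strip}"

definition "decay M B \<longleftrightarrow> (AE p in lborel. p \<in> quiet \<longrightarrow>
  (\<forall>j\<in>{1..n}. \<bar>u' j p\<bar> \<le> B * exp (M * snd p)) \<and> (\<forall>j\<in>{1..m}. \<bar>v' j p\<bar> \<le> B * exp (M * snd p)))"

lemma quiet_sets: "quiet \<in> sets borel"
  unfolding quiet_def divide_inverse
  by (intro borel_closed closed_Collect_conj closed_Collect_le continuous_intros) (auto intro: closed_Times)

lemma quiet_pred:
  assumes "bounded_borel f"
  shows "Measurable.pred borel (\<lambda>p. p \<in> quiet \<longrightarrow> \<bar>f p\<bar> \<le> B * exp (M * snd p))"
proof -
  note [measurable] = bounded_borel_measurable[OF assms] quiet_sets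
  have [measurable]: "(\<lambda>p :: real \<times> real. exp (M * snd p)) \<in> borel_measurable borel"
    by (intro borel_measurable_continuous_onI continuous_intros)
  show ?thesis by measurable
qed

text \<open>With zero inflow, \<open>u i\<close> is the integral of \<open>fu i\<close> along its
  characteristic, where the weight grows at rate \<open>M * lam i\<close>. The gain
  \<open>1 / (M * lam i)\<close> against the coupling coefficients is at most one half by the choice
  of \<open>M\<close>.\<close>

lemma u_decay:
  assumes i: "i \<in> {1..n}" and M: "0 < M" "0 \<le> B" and d: "decay M B"
    and C: "(\<Sum>j=1..n. \<bar>Spp i j\<bar>) + (\<Sum>j=1..m. \<bar>Spm i j\<bar>) \<le> M * lam i / 2" and "1 \<le> n"
  shows "AE p in lborel. p \<in> quiet \<longrightarrow> \<bar>u' i p\<bar> \<le> B / 2 * exp (M * snd p)"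
proof (rule AE_affine2I[OF quiet_pred[OF rep_bounded(1)]])
  define sp where "sp = lam i"
  have sp: "0 < sp" "0 < lam 1" "lam 1 \<le> sp" using lam_pos[OF i] lam_pos[of 1] lam_least[OF i] \<open>1 \<le> n\<close> by (auto simp: sp_def)
  show "1 * sp - 1 * 0 \<noteq> 0" using sp by simp
  then have det: "1 * sp - 1 * 0 \<noteq> 0" and det': "fst (1::real, 0::real) * snd (1::real, sp) - fst (1::real, sp) * snd (1::real, 0::real) \<noteq> 0"
    by simp_all
  have pt: "(0, 0) + y *\<^sub>R (1, 0) + s *\<^sub>R (1, sp) = (y + s, sp * s)" for y s :: real by simp
  have pt': "(0 + 1 * y + 1 * s, 0 + 0 * y + sp * s) = (y + s, sp * s)" for y s by simp
  have line: "AE y in lborel. \<forall>a b. a \<le> b \<and> (y + a, sp * a) \<in> strip \<and> (y + b, sp * b) \<in> strip \<longrightarrow>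
      ((\<lambda>s. fu i (y + s, sp * s)) has_integral u i (y + b, sp * b) - u i (y + a, sp * a)) {a..b}"
    using weak_transport_lines[OF u_weak(1)[OF i, folded sp_def] strip_convex strip_sets u_weak(2)[OF i] det', of "(0, 0)"]
    unfolding pt .
  have rep: "AE y in lborel. AE s in lborel. (y + s, sp * s) \<in> strip \<longrightarrow> u i (y + s, sp * s) = u' i (y + s, sp * s)"
    using AE_affine2D[OF u_rep[OF i] det, of 0 0] unfolding pt' .
  have bnd: "AE y in lborel. AE s in lborel. (y + s, sp * s) \<in> quiet \<longrightarrow>
      (\<forall>j\<in>{1..n}. \<bar>u' j (y + s, sp * s)\<bar> \<le> B * exp (M * (sp * s))) \<and>
      (\<forall>j\<in>{1..m}. \<bar>v' j (y + s, sp * s)\<bar> \<le> B * exp (M * (sp * s)))"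
    using AE_affine2D[OF d[unfolded decay_def] det, of 0 0] unfolding pt' snd_conv .
  have "AE y in lborel. \<forall>j\<in>{1..m}. vanish_time j \<le> y \<and> y \<le> T \<longrightarrow> v j (y, 0) = 0"
    by (intro AE_finite_allI v_trace_vanishes) auto
  moreover have "AE y in lborel. y \<in> {0..} \<longrightarrow> u i (y, 0) = (\<Sum>k=1..m. Q0 i k * v k (y, 0))"
    using system i by (subst AE_lebesgue_on_iff[symmetric]) (auto simp: system_solution_def)
  \<comment> \<open>From \<open>vanish_time m\<close> on all traces of \<open>v\<close> at x = 0 are
    0, and hence so is the inflow \<open>Q0 v\<close>.\<close>
  ultimately have bc: "AE y in lborel. vanish_time m \<le> y \<and> y \<le> T \<longrightarrow> u i (y, 0) = 0"
  proof eventually_elim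
    case (elim y)
    have "v k (y, 0) = 0" if "vanish_time m \<le> y \<and> y \<le> T" "k \<in> {1..m}" for k
      using elim(1) that vanish_time_mono[of k m] by auto
    moreover have "0 \<le> y" if "vanish_time m \<le> y" using that vanish_time_nonneg[of m] by linarith
    ultimately show ?case using elim(2) by auto
  qed
  show "AE y in lborel. AE s in lborel. (0 + 1 * y + 1 * s, 0 + 0 * y + sp * s) \<in> quiet \<longrightarrow>
      \<bar>u' i (0 + 1 * y + 1 * s, 0 + 0 * y + sp * s)\<bar> \<le> B / 2 * exp (M * snd (0 + 1 * y + 1 * s, 0 + 0 * y + sp * s))"
    unfolding pt' snd_conv
    using line rep bnd bc
  proof eventually_elim
    case (elim y)
    show ?case
      using elim(2)
    proof (eventually_elim, intro impI)
      fix s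
      assume eq: "(y + s, sp * s) \<in> strip \<longrightarrow> u i (y + s, sp * s) = u' i (y + s, sp * s)"
        and quiet: "(y + s, sp * s) \<in> quiet"
      then have strip: "(y + s, sp * s) \<in> strip" and time: "vanish_time m + sp * s / lam 1 \<le> y + s"
        by (auto simp: quiet_def)
      have s: "0 \<le> s" using strip sp by (auto simp: zero_le_mult_iff)
      \<comment> \<open>Going back by \<open>s - r\<close> in time lowers x / \<open>lam 1\<close>
        by \<open>sp * (s - r) / lam 1\<close>, which is at least \<open>s - r\<close> since
        \<open>lam 1 \<le> sp\<close>.\<close>
      have slower: "vanish_time m + sp * r / lam 1 \<le> y + r" if "0 \<le> r" "r \<le> s" for r
      proof -
        have "(sp / lam 1 - 1) * r \<le> (sp / lam 1 - 1) * s"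
          using sp that by (intro mult_left_mono) auto
        with time show ?thesis by (simp add: algebra_simps)
      qed
      have in_strip: "(y + r, sp * r) \<in> strip" if "0 \<le> r" "r \<le> s" for r
      proof -
        have "sp * r \<le> sp * s" using that sp by (intro mult_left_mono) auto
        moreover have "sp * s \<le> 1" using strip by auto
        ultimately have "sp * r \<le> 1" by (rule order_trans)
        moreover have "0 \<le> sp * r / lam 1" using that sp by simp
        with slower[OF that] vanish_time_nonneg[of m] have "0 \<le> y + r" by linarith
        ultimately show ?thesis using that strip sp by auto
      qed
      have "u i (y, 0) = 0" using elim(4) slower[of 0] in_strip[of 0] s by auto
      with elim(1)[rule_format, of 0 s] in_strip[of 0] in_strip[of s] s eq
      have int: "((\<lambda>s. fu i (y + s, sp * s)) has_integral u' i (y + s, sp * s)) {0..s}" by auto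
      let ?c = "(\<Sum>j=1..n. \<bar>Spp i j\<bar>) + (\<Sum>j=1..m. \<bar>Spm i j\<bar>)"
      have "AE r in lborel. r \<in> {0..s} \<longrightarrow> \<bar>fu i (y + r, sp * r)\<bar> \<le> (?c * B) * exp (M * sp * r)"
        using elim(3)
      proof (eventually_elim, intro impI)
        fix r
        assume *: "(y + r, sp * r) \<in> quiet \<longrightarrow>
          (\<forall>j\<in>{1..n}. \<bar>u' j (y + r, sp * r)\<bar> \<le> B * exp (M * (sp * r))) \<and>
          (\<forall>j\<in>{1..m}. \<bar>v' j (y + r, sp * r)\<bar> \<le> B * exp (M * (sp * r)))" and r: "r \<in> {0..s}"
        have "(y + r, sp * r) \<in> quiet" using r slower[of r] in_strip[of r] by (auto simp: quiet_def)
        with * have "\<bar>\<Sum>j=1..n. Spp i j * u' j (y + r, sp * r)\<bar> \<le> (\<Sum>j=1..n. \<bar>Spp i j\<bar>) * (B * exp (M * (sp * r)))"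
          "\<bar>\<Sum>j=1..m. Spm i j * v' j (y + r, sp * r)\<bar> \<le> (\<Sum>j=1..m. \<bar>Spm i j\<bar>) * (B * exp (M * (sp * r)))"
          by (intro weighted_sum_bound; simp)+
        then show "\<bar>fu i (y + r, sp * r)\<bar> \<le> (?c * B) * exp (M * sp * r)"
          unfolding fu_def by (simp add: distrib_right mult.assoc)
      qed
      then have "\<bar>u' i (y + s, sp * s)\<bar> \<le> ?c * B / (M * sp) * exp (M * sp * s)"
        using M sp s by (intro integral_exp_bound[OF int]) (auto intro!: mult_nonneg_nonneg add_nonneg_nonneg sum_nonneg)
      also have "?c * B / (M * sp) \<le> B / 2"
      proof -
        have "?c * B \<le> (M * sp / 2) * B" using C M unfolding sp_def by (intro mult_right_mono) auto
        then show ?thesis using M sp by (simp add: field_simps)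
      qed
      finally show "\<bar>u' i (y + s, sp * s)\<bar> \<le> B / 2 * exp (M * (sp * s))" by (simp add: mult.assoc)
    qed
  qed
qed

text \<open>The same gain for the Volterra equation, now integrating in space at fixed time, with
  the kernel bounds in place of the coupling coefficients.\<close>

lemma v_decay:
  assumes i: "i \<in> {1..m}" and M: "0 < M" "0 \<le> B" and d: "decay M B" and "1 \<le> n"
    and k: "\<And>j p. \<bar>K' i j p\<bar> \<le> k j" and l: "\<And>j p. \<bar>L' i j p\<bar> \<le> l j"
    and C: "(\<Sum>j=1..n. k j) + (\<Sum>j=1..m. l j) \<le> M / 2"
  shows "AE p in lborel. p \<in> quiet \<longrightarrow> \<bar>v' i p\<bar> \<le> B / 2 * exp (M * snd p)"
proof (rule AE_pairI[OF quiet_pred[OF rep_bounded(2)]])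
  have lam1: "0 < lam 1" using lam_pos[of 1] \<open>1 \<le> n\<close> by simp
  let ?c = "(\<Sum>j=1..n. k j) + (\<Sum>j=1..m. l j)"
  have c: "0 \<le> ?c"
    using order_trans[OF abs_ge_zero k] order_trans[OF abs_ge_zero l] by (intro add_nonneg_nonneg sum_nonneg) auto
  show "AE t in lborel. AE x in lborel. (t, x) \<in> quiet \<longrightarrow> \<bar>v' i (t, x)\<bar> \<le> B / 2 * exp (M * snd (t, x))"
    using AE_pairD[OF v_volterra[OF i]] AE_pairD[OF d[unfolded decay_def]]
  proof eventually_elim
    case (elim t)
    show ?case
      using elim(1)
    proof (eventually_elim, intro impI)
      fix x
      assume eq: "vanish_time i \<le> fst (t, x) \<and> (t, x) \<in> strip \<longrightarrow> v' i (t, x) = W' i (t, x)"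
        and quiet: "(t, x) \<in> quiet"
      then have x: "0 \<le> x" "x \<le> 1" and t: "vanish_time m + x / lam 1 \<le> t" "0 \<le> t" "t \<le> T" by (auto simp: quiet_def)
      have in_quiet: "(t, \<xi>) \<in> quiet" if "\<xi> \<in> {0..x}" for \<xi>
      proof -
        have "\<xi> / lam 1 \<le> x / lam 1" using that lam1 by (intro divide_right_mono) auto
        then show ?thesis using that x t by (auto simp: quiet_def)
      qed
      have "i \<le> m" using i by simp
      from vanish_time_mono[OF this order.refl] t(1) divide_nonneg_pos[OF x(1) lam1]
      have "vanish_time i \<le> t" by linarith
      with eq x t have v: "v' i (t, x) = W' i (t, x)" by auto
      have "AE \<xi> in lborel. \<xi> \<in> {0..x} \<longrightarrow>
          \<bar>(\<Sum>j=1..n. K' i j (x, \<xi>) * u' j (t, \<xi>)) + (\<Sum>j=1..m. L' i j (x, \<xi>) * v' j (t, \<xi>))\<bar> \<le> (?c * B) * exp (M * \<xi>)"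
        using elim(2)
      proof (eventually_elim, intro impI)
        fix \<xi>
        assume *: "(t, \<xi>) \<in> quiet \<longrightarrow> (\<forall>j\<in>{1..n}. \<bar>u' j (t, \<xi>)\<bar> \<le> B * exp (M * snd (t, \<xi>))) \<and>
            (\<forall>j\<in>{1..m}. \<bar>v' j (t, \<xi>)\<bar> \<le> B * exp (M * snd (t, \<xi>)))" and \<xi>: "\<xi> \<in> {0..x}"
        from * in_quiet[OF \<xi>]
        have "\<bar>\<Sum>j=1..n. K' i j (x, \<xi>) * u' j (t, \<xi>)\<bar> \<le> (\<Sum>j=1..n. k j) * (B * exp (M * \<xi>))"
          "\<bar>\<Sum>j=1..m. L' i j (x, \<xi>) * v' j (t, \<xi>)\<bar> \<le> (\<Sum>j=1..m. l j) * (B * exp (M * \<xi>))"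
          by (intro weighted_sum_bound k l; simp)+
        then show "\<bar>(\<Sum>j=1..n. K' i j (x, \<xi>) * u' j (t, \<xi>)) + (\<Sum>j=1..m. L' i j (x, \<xi>) * v' j (t, \<xi>))\<bar>
            \<le> (?c * B) * exp (M * \<xi>)"
          by (simp add: distrib_right mult.assoc)
      qed
      then have "\<bar>W' i (t, x)\<bar> \<le> ?c * B / M * exp (M * x)"
        using M x c by (intro integral_exp_bound[OF W'_has_integral]) auto
      also have "?c * B / M \<le> B / 2"
      proof -
        have "?c * B \<le> (M / 2) * B" using C M by (intro mult_right_mono) auto
        then show ?thesis using M by (simp add: field_simps)
      qed
      finally show "\<bar>v' i (t, x)\<bar> \<le> B / 2 * exp (M * snd (t, x))" using v by simp
    qed
  qed
qed

text \<open>A fixed \<open>M\<close> halves every admissible bound \<open>B\<close>; iterating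
  brings \<open>B\<close> below any positive number. Boundedness of the representatives starts the
  iteration.\<close>

lemma state_vanishes_on_quiet:
  assumes "1 \<le> n"
  shows "AE p in lborel. p \<in> quiet \<longrightarrow> (\<forall>j\<in>{1..n}. u' j p = 0) \<and> (\<forall>j\<in>{1..m}. v' j p = 0)"
proof -
  have "\<forall>i. \<exists>C. \<forall>p. \<bar>u' i p\<bar> \<le> C" "\<forall>i. \<exists>C. \<forall>p. \<bar>v' i p\<bar> \<le> C"
    "\<forall>i j. \<exists>C. \<forall>p. \<bar>K' i j p\<bar> \<le> C" "\<forall>i j. \<exists>C. \<forall>p. \<bar>L' i j p\<bar> \<le> C"
    using rep_bounded by (simp_all add: bounded_borel_def)
  then obtain bu bv k l where b: "\<And>i p. \<bar>u' i p\<bar> \<le> bu i" "\<And>i p. \<bar>v' i p\<bar> \<le> bv i"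
    and kl: "\<And>i j p. \<bar>K' i j p\<bar> \<le> k i j" "\<And>i j p. \<bar>L' i j p\<bar> \<le> l i j"
    by metis
  have b0: "0 \<le> bu i" "0 \<le> bv i" for i
    using order_trans[OF abs_ge_zero b(1)] order_trans[OF abs_ge_zero b(2)] by auto
  have kl0: "0 \<le> k i j" "0 \<le> l i j" for i j
    using order_trans[OF abs_ge_zero kl(1)] order_trans[OF abs_ge_zero kl(2)] by auto
  define cu where "cu i = (\<Sum>j=1..n. \<bar>Spp i j\<bar>) + (\<Sum>j=1..m. \<bar>Spm i j\<bar>)" for i
  define cv where "cv i = (\<Sum>j=1..n. k i j) + (\<Sum>j=1..m. l i j)" for i
  have c0: "0 \<le> cu i" "0 \<le> cv i" for i
    unfolding cu_def cv_def using kl0 by (auto intro!: add_nonneg_nonneg sum_nonneg)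
  \<comment> \<open>Sums of nonnegative terms dominate each of the finitely many thresholds, and the
    summand 1 keeps \<open>M\<close> positive.\<close>
  define M where "M = 1 + (\<Sum>i=1..n. 2 * cu i / lam i) + (\<Sum>i=1..m. 2 * cv i)"
  have M1: "0 \<le> (\<Sum>i=1..n. 2 * cu i / lam i)" "0 \<le> (\<Sum>i=1..m. 2 * cv i)"
    using c0 lam_pos by (auto intro!: sum_nonneg divide_nonneg_pos)
  have M: "0 < M" unfolding M_def using M1 by linarith
  have Mu: "cu i \<le> M * lam i / 2" if i: "i \<in> {1..n}" for i
  proof -
    have "2 * cu i / lam i \<le> (\<Sum>i=1..n. 2 * cu i / lam i)"
      using i c0 lam_pos by (intro member_le_sum) (auto intro!: divide_nonneg_pos)
    then have "2 * cu i / lam i \<le> M" unfolding M_def using M1 by linarith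
    then show ?thesis using lam_pos[OF i] by (simp add: field_simps)
  qed
  have Mv: "cv i \<le> M / 2" if i: "i \<in> {1..m}" for i
  proof -
    have "2 * cv i \<le> (\<Sum>i=1..m. 2 * cv i)" using i c0 by (intro member_le_sum) auto
    then have "2 * cv i \<le> M" unfolding M_def using M1 by linarith
    then show ?thesis by simp
  qed
  have halve: "decay M (B / 2)" if "0 \<le> B" "decay M B" for B
  proof -
    have "AE p in lborel. \<forall>j\<in>{1..n}. p \<in> quiet \<longrightarrow> \<bar>u' j p\<bar> \<le> B / 2 * exp (M * snd p)"
      using Mu that M assms unfolding cu_def by (intro AE_finite_allI u_decay) auto
    moreover have "AE p in lborel. \<forall>j\<in>{1..m}. p \<in> quiet \<longrightarrow> \<bar>v' j p\<bar> \<le> B / 2 * exp (M * snd p)"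
      using Mv that M assms kl unfolding cv_def by (intro AE_finite_allI v_decay) auto
    ultimately show ?thesis unfolding decay_def by eventually_elim auto
  qed
  define B where "B = (\<Sum>i=1..n. bu i) + (\<Sum>i=1..m. bv i)"
  have B: "0 \<le> B" unfolding B_def using b0 by (auto intro!: add_nonneg_nonneg sum_nonneg)
  have "decay M (B / 2 ^ N)" for N
  proof (induction N)
    case 0
    have "\<bar>u' j p\<bar> \<le> B * exp (M * snd p)" if "p \<in> quiet" "j \<in> {1..n}" for j p
    proof -
      have "bu j \<le> (\<Sum>i=1..n. bu i)" using that b0 by (intro member_le_sum) auto
      moreover have "0 \<le> (\<Sum>i=1..m. bv i)" using b0 by (auto intro!: sum_nonneg)
      ultimately have "\<bar>u' j p\<bar> \<le> B" using b(1)[of j p] unfolding B_def by linarith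
      also have "B = B * 1" by simp
      also have "\<dots> \<le> B * exp (M * snd p)" using B M that by (intro mult_left_mono) (auto simp: quiet_def)
      finally show ?thesis .
    qed
    moreover have "\<bar>v' j p\<bar> \<le> B * exp (M * snd p)" if "p \<in> quiet" "j \<in> {1..m}" for j p
    proof -
      have "bv j \<le> (\<Sum>i=1..m. bv i)" using that b0 by (intro member_le_sum) auto
      moreover have "0 \<le> (\<Sum>i=1..n. bu i)" using b0 by (auto intro!: sum_nonneg)
      ultimately have "\<bar>v' j p\<bar> \<le> B" using b(2)[of j p] unfolding B_def by linarith
      also have "B = B * 1" by simp
      also have "\<dots> \<le> B * exp (M * snd p)" using B M that by (intro mult_left_mono) (auto simp: quiet_def)
      finally show ?thesis .
    qed
    ultimately show ?case unfolding decay_def by (intro AE_I2) auto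
  next
    case (Suc N)
    have "decay M (B / 2 ^ N / 2)" using B Suc.IH by (intro halve) auto
    also have "B / 2 ^ N / 2 = B / 2 ^ Suc N" by simp
    finally show ?case .
  qed
  \<comment> \<open>The countably many exceptional sets are merged, so that the limit in
    \<open>N\<close> is taken at a fixed point.\<close>
  then have "AE p in lborel. \<forall>N. p \<in> quiet \<longrightarrow> (\<forall>j\<in>{1..n}. \<bar>u' j p\<bar> \<le> B / 2 ^ N * exp (M * snd p)) \<and>
      (\<forall>j\<in>{1..m}. \<bar>v' j p\<bar> \<le> B / 2 ^ N * exp (M * snd p))"
    unfolding decay_def by (subst AE_all_countable) blast
  then show ?thesis
  proof (eventually_elim, intro impI)
    fix p
    assume *: "\<forall>N. p \<in> quiet \<longrightarrow> (\<forall>j\<in>{1..n}. \<bar>u' j p\<bar> \<le> B / 2 ^ N * exp (M * snd p)) \<and>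
      (\<forall>j\<in>{1..m}. \<bar>v' j p\<bar> \<le> B / 2 ^ N * exp (M * snd p))" and p: "p \<in> quiet"
    have lim: "(\<lambda>N. B / 2 ^ N * exp (M * snd p)) \<longlonglongrightarrow> 0"
    proof -
      have "(\<lambda>N. (B * exp (M * snd p)) * (1 / 2) ^ N) \<longlonglongrightarrow> (B * exp (M * snd p)) * 0"
        by (intro tendsto_mult tendsto_const LIMSEQ_realpow_zero) auto
      then show ?thesis by (simp add: power_one_over field_simps)
    qed
    have "w = 0" if "\<And>N. \<bar>w\<bar> \<le> B / 2 ^ N * exp (M * snd p)" for w :: real
      using LIMSEQ_le_const[OF lim, of "\<bar>w\<bar>"] that by auto
    with * p show "(\<forall>j\<in>{1..n}. u' j p = 0) \<and> (\<forall>j\<in>{1..m}. v' j p = 0)" by blast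
  qed
qed

section \<open>From almost every point to every time slice\<close>

text \<open>A single slice is null in the plane, so vanishing almost everywhere says nothing about
  it directly. A generic characteristic leaves the slice at once and meets a later zero of
  \<open>f\<close>; as the right side is 0 along it, \<open>f\<close> is also 0 at the starting
  point.\<close>

lemma trace_vanishes:
  assumes "1 \<le> n" and t: "vanish_time m + 1 / lam 1 \<le> t" "t < T"
    and w: "weak_transport strip (1, c) f g" "AE p in lborel. p \<in> strip \<longrightarrow> g p = g' p"
    and zero: "AE p in lborel. p \<in> quiet \<longrightarrow> f p = 0 \<and> g' p = 0"
  shows "AE x in lborel. x \<in> {0<..<1} \<longrightarrow> f (t, x) = 0"
proof -
  have lam1: "0 < lam 1" using lam_pos[of 1] \<open>1 \<le> n\<close> by simp
  have t0: "0 \<le> t"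
  proof -
    have "0 \<le> 1 / lam 1" using lam1 by simp
    then show ?thesis using t vanish_time_nonneg[of m] by linarith
  qed
  have late: "(r, x) \<in> quiet" if "t \<le> r" "r \<le> T" "0 \<le> x" "x \<le> 1" for r x
  proof -
    have "x / lam 1 \<le> 1 / lam 1" using that lam1 by (intro divide_right_mono) auto
    then show ?thesis using that t t0 by (auto simp: quiet_def)
  qed
  have det: "0 * c - 1 * 1 \<noteq> (0 :: real)" and det': "fst (0::real, 1::real) * snd (1, c) - fst (1, c) * snd (0::real, 1::real) \<noteq> 0"
    by simp_all
  have pt: "(t, 0) + y *\<^sub>R (0, 1) + s *\<^sub>R (1, c) = (t + s, y + c * s)" for y s :: real by simp
  have "AE y in lborel. \<forall>a b. a \<le> b \<and> (t + a, y + c * a) \<in> strip \<and> (t + b, y + c * b) \<in> strip \<longrightarrow>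
      ((\<lambda>s. g' (t + s, y + c * s)) has_integral f (t + b, y + c * b) - f (t + a, y + c * a)) {a..b}"
    using weak_transport_lines[OF w(1) strip_convex strip_sets w(2) det', of "(t, 0)"] unfolding pt .
  moreover have "AE y in lborel. AE s in lborel. (t + s, y + c * s) \<in> quiet \<longrightarrow>
      f (t + s, y + c * s) = 0 \<and> g' (t + s, y + c * s) = 0"
    using AE_affine2D[OF zero det, of t 0] by simp
  ultimately show ?thesis
  proof (eventually_elim, intro impI)
    fix y
    assume line: "\<forall>a b. a \<le> b \<and> (t + a, y + c * a) \<in> strip \<and> (t + b, y + c * b) \<in> strip \<longrightarrow>
        ((\<lambda>s. g' (t + s, y + c * s)) has_integral f (t + b, y + c * b) - f (t + a, y + c * a)) {a..b}"
      and ae: "AE s in lborel. (t + s, y + c * s) \<in> quiet \<longrightarrow> f (t + s, y + c * s) = 0 \<and> g' (t + s, y + c * s) = 0"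
      and y: "y \<in> {0<..<1}"
    \<comment> \<open>Up to this time the line stays below \<open>T\<close> and within the strip.
      The \<open>+ 1\<close> keeps the denominator positive when \<open>c = 0\<close>.\<close>
    define h where "h = min (T - t) (min y (1 - y) / (\<bar>c\<bar> + 1))"
    have h: "0 < h" using y t by (auto simp: h_def)
    have in_box: "t \<le> t + s" "t + s \<le> T" "0 \<le> y + c * s" "y + c * s \<le> 1" if "0 \<le> s" "s \<le> h" for s
    proof -
      have "s \<le> min y (1 - y) / (\<bar>c\<bar> + 1)" using that by (simp add: h_def)
      then have "s * (\<bar>c\<bar> + 1) \<le> min y (1 - y)" by (simp add: pos_le_divide_eq)
      moreover have "\<bar>c * s\<bar> \<le> s * (\<bar>c\<bar> + 1)" using that by (simp add: abs_mult algebra_simps)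
      ultimately have "\<bar>c * s\<bar> \<le> min y (1 - y)" by linarith
      then show "0 \<le> y + c * s" "y + c * s \<le> 1" by (auto simp: abs_le_iff)
      show "t \<le> t + s" "t + s \<le> T" using that by (auto simp: h_def)
    qed
    obtain b where b: "0 < b" "b < h"
      and zb: "(t + b, y + c * b) \<in> quiet \<longrightarrow> f (t + b, y + c * b) = 0 \<and> g' (t + b, y + c * b) = 0"
      by (rule AE_exists_between[OF ae h])
    have "(t + 0, y + c * 0) \<in> strip" "(t + b, y + c * b) \<in> strip"
      using in_box[of 0] in_box[of b] b h t0 by auto
    with line[rule_format, of 0 b] b
    have "((\<lambda>s. g' (t + s, y + c * s)) has_integral f (t + b, y + c * b) - f (t, y)) {0..b}" by simp
    moreover have "AE s in lborel. s \<in> {0..b} \<longrightarrow> g' (t + s, y + c * s) = 0"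
      using ae by eventually_elim (use late in_box b in auto)
    ultimately have "((\<lambda>s. 0) has_integral f (t + b, y + c * b) - f (t, y)) {0..b}"
      by (rule has_integral_AE_cong[rotated])
    then have "f (t + b, y + c * b) - f (t, y) = 0" by (rule has_integral_unique) simp
    moreover have "f (t + b, y + c * b) = 0" using zb late in_box[of b] b by auto
    ultimately show "f (t, y) = 0" by simp
  qed
qed

lemma state_vanishes:
  assumes "1 \<le> n" "vanish_time m + 1 / lam 1 \<le> t" "t < T"
  shows "i \<in> {1..n} \<Longrightarrow> AE x in lebesgue_on {0<..<1}. u i (t, x) = 0"
    and "i \<in> {1..m} \<Longrightarrow> AE x in lebesgue_on {0<..<1}. v i (t, x) = 0"
proof -
  have quiet_strip: "p \<in> strip" if "p \<in> quiet" for p using that by (simp add: quiet_def)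
  have s: "{0<..<1::real} \<in> sets lebesgue" by (intro sets_completionI_sets) auto
  show "AE x in lebesgue_on {0<..<1}. u i (t, x) = 0" if i: "i \<in> {1..n}"
    unfolding AE_lebesgue_on_iff[OF s]
  proof (rule trace_vanishes[OF assms u_weak[OF i]])
    show "AE p in lborel. p \<in> quiet \<longrightarrow> u i p = 0 \<and> fu i p = 0"
      using state_vanishes_on_quiet[OF assms(1)] u_rep[OF i]
      by eventually_elim (use i quiet_strip in \<open>auto simp: fu_def\<close>)
  qed
  show "AE x in lebesgue_on {0<..<1}. v i (t, x) = 0" if i: "i \<in> {1..m}"
    unfolding AE_lebesgue_on_iff[OF s]
  proof (rule trace_vanishes[OF assms v_weak[OF i]])
    show "AE p in lborel. p \<in> quiet \<longrightarrow> v i p = 0 \<and> fv i p = 0"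
      using state_vanishes_on_quiet[OF assms(1)] v_rep[OF i]
      by eventually_elim (use i quiet_strip in \<open>auto simp: fv_def\<close>)
  qed
qed

end

text \<open>\<open>P\<close> is the index range. Outside it any constant serves, so the
  representatives can be chosen for all indices simultaneously and remain bounded.\<close>

lemma Linf_representative:
  assumes "P \<Longrightarrow> Linf S f" "S \<in> sets lebesgue"
  shows "\<exists>g. bounded_borel g \<and> (P \<longrightarrow> (AE x in lborel. x \<in> S \<longrightarrow> f x = g x))"
proof (cases P)
  case True
  from Linf_imp_bounded_ae[OF assms(1)[OF True] assms(2)] show ?thesis
    unfolding bounded_ae_def bounded_borel_def by blast
qed (use bounded_borel_const in blast)

theorem mainTheorem1:
  fixes n m :: nat
    and lam mu :: "nat \<Rightarrow> real"
    and Spp Spm Smp Smm Q0 R1 :: "nat \<Rightarrow> nat \<Rightarrow> real"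
    and K L :: "nat \<Rightarrow> nat \<Rightarrow> real \<times> real \<Rightarrow> real"
    and u0 v0 :: "nat \<Rightarrow> real \<Rightarrow> real"
    and u v :: "nat \<Rightarrow> real \<times> real \<Rightarrow> real"
  assumes "n \<ge> 1" and "m \<ge> 1"
    and "mono_on {1..n} lam" and "\<forall>i\<in>{1..n}. 0 < lam i"
    and "strict_mono_on {1..m} (\<lambda>j. - mu j)" and "\<forall>j\<in>{1..m}. - mu j < 0"
    and "\<forall>j\<in>{1..m}. Smm j j = 0"
    and "kernel_solution n m lam mu Spp Spm Smp Smm Q0 K L"
    and "\<forall>i\<in>{1..n}. Linf {0<..<1} (u0 i)" and "\<forall>i\<in>{1..m}. Linf {0<..<1} (v0 i)"
    and "system_solution n m lam mu Spp Spm Smp Smm Q0 R1 (feedback n m R1 K L u v) u0 v0 u v"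
  shows "\<forall>t \<ge> 1 / lam 1 + (\<Sum>j=1..m. 1 / mu j).
           (\<forall>i\<in>{1..n}. AE x in lebesgue_on {0<..<1}. u i (t, x) = 0) \<and>
           (\<forall>i\<in>{1..m}. AE x in lebesgue_on {0<..<1}. v i (t, x) = 0)"
proof (intro allI impI)
  fix t :: real assume t: "1 / lam 1 + (\<Sum>j=1..m. 1 / mu j) \<le> t"
  have "0 \<le> 1 / lam 1 + (\<Sum>j=1..m. 1 / mu j)"
    using assms(1,4,6) by (intro add_nonneg_nonneg sum_nonneg) (auto intro!: less_imp_le)
  \<comment> \<open>The horizon \<open>t + 1\<close> leaves room beyond \<open>t\<close> for the
    forward characteristics from the slice at time \<open>t\<close>.\<close>
  with t have T: "0 < t + 1" by linarith
  have strip: "{0..t + 1} \<times> {0..1::real} \<in> sets lebesgue"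
    by (intro sets_completionI_sets) (auto intro!: borel_closed closed_Times)
  let ?u = "\<lambda>i g. bounded_borel g \<and> (i \<in> {1..n} \<longrightarrow> (AE p in lborel. p \<in> {0..t + 1} \<times> {0..1} \<longrightarrow> u i p = g p))"
  let ?v = "\<lambda>i g. bounded_borel g \<and> (i \<in> {1..m} \<longrightarrow> (AE p in lborel. p \<in> {0..t + 1} \<times> {0..1} \<longrightarrow> v i p = g p))"
  let ?K = "\<lambda>i j g. bounded_borel g \<and>
    (i \<in> {1..m} \<and> j \<in> {1..n} \<longrightarrow> (AE p in lborel. p \<in> triangle \<longrightarrow> K i j p = g p))"
  let ?L = "\<lambda>i j g. bounded_borel g \<and>
    (i \<in> {1..m} \<and> j \<in> {1..m} \<longrightarrow> (AE p in lborel. p \<in> triangle \<longrightarrow> L i j p = g p))"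
  have "\<forall>i. \<exists>g. ?u i g"
  proof
    fix i
    have "Linf ({0..t + 1} \<times> {0..1}) (u i)" if "i \<in> {1..n}"
      using assms(11) T that unfolding system_solution_def by blast
    then show "\<exists>g. ?u i g" using strip by (rule Linf_representative)
  qed
  from choice[OF this] obtain u' where u': "\<forall>i. ?u i (u' i)" ..
  have "\<forall>i. \<exists>g. ?v i g"
  proof
    fix i
    have "Linf ({0..t + 1} \<times> {0..1}) (v i)" if "i \<in> {1..m}"
      using assms(11) T that unfolding system_solution_def by blast
    then show "\<exists>g. ?v i g" using strip by (rule Linf_representative)
  qed
  from choice[OF this] obtain v' where v': "\<forall>i. ?v i (v' i)" ..
  have "\<forall>q. \<exists>g. ?K (fst q) (snd q) g"
  proof
    fix q :: "nat \<times> nat"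
    obtain i j where q: "q = (i, j)" by (rule prod.exhaust)
    have "Linf triangle (K i j)" if "i \<in> {1..m} \<and> j \<in> {1..n}"
      using assms(8) that by (auto simp: kernel_solution_def)
    then show "\<exists>g. ?K (fst q) (snd q) g"
      unfolding q fst_conv snd_conv using triangle_sets by (rule Linf_representative)
  qed
  from choice[OF this] obtain FK where "\<forall>q. ?K (fst q) (snd q) (FK q)" ..
  then have K': "?K i j (FK (i, j))" for i j by (metis fst_conv snd_conv)
  have "\<forall>q. \<exists>g. ?L (fst q) (snd q) g"
  proof
    fix q :: "nat \<times> nat"
    obtain i j where q: "q = (i, j)" by (rule prod.exhaust)
    have "Linf triangle (L i j)" if "i \<in> {1..m} \<and> j \<in> {1..m}"
      using assms(8) that by (auto simp: kernel_solution_def)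
    then show "\<exists>g. ?L (fst q) (snd q) g"
      unfolding q fst_conv snd_conv using triangle_sets by (rule Linf_representative)
  qed
  from choice[OF this] obtain FL where "\<forall>q. ?L (fst q) (snd q) (FL q)" ..
  then have L': "?L i j (FL (i, j))" for i j by (metis fst_conv snd_conv)
  interpret backstepping n m lam mu Spp Spm Smp Smm Q0 R1 K L u0 v0 u v "t + 1" u' v' "\<lambda>i j. FK (i, j)" "\<lambda>i j. FL (i, j)"
  proof
    show "lam 1 \<le> lam i" if "i \<in> {1..n}" for i using assms(3) that by (auto simp: mono_on_def)
    show "mu i \<noteq> mu j" if "i \<in> {1..m}" "j \<in> {1..m}" "i \<noteq> j" for i j
      using strict_mono_on_eqD[OF assms(5), of i j] that by auto
    show "0 < lam i" if "i \<in> {1..n}" for i using assms(4) that by blast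
    show "0 < mu i" if "i \<in> {1..m}" for i using assms(6) that by auto
    show "Smm j j = 0" if "j \<in> {1..m}" for j using assms(7) that by blast
    show "bounded_borel (u' i)" "bounded_borel (v' i)" "bounded_borel (FK (i, j))" "bounded_borel (FL (i, j))" for i j
      using u' v' K' L' by blast+
    show "AE p in lborel. p \<in> {0..t + 1} \<times> {0..1} \<longrightarrow> u i p = u' i p" if "i \<in> {1..n}" for i
      using u' that by blast
    show "AE p in lborel. p \<in> {0..t + 1} \<times> {0..1} \<longrightarrow> v i p = v' i p" if "i \<in> {1..m}" for i
      using v' that by blast
    show "AE p in lborel. p \<in> triangle \<longrightarrow> K i j p = FK (i, j) p" if "i \<in> {1..m}" "j \<in> {1..n}" for i j
      using K'[of i j] that by blast
    show "AE p in lborel. p \<in> triangle \<longrightarrow> L i j p = FL (i, j) p" if "i \<in> {1..m}" "j \<in> {1..m}" for i j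
      using L'[of i j] that by blast
  qed (fact assms(8) assms(11) T)+
  show "(\<forall>i\<in>{1..n}. AE x in lebesgue_on {0<..<1}. u i (t, x) = 0) \<and>
      (\<forall>i\<in>{1..m}. AE x in lebesgue_on {0<..<1}. v i (t, x) = 0)"
    using state_vanishes[of t] t assms(1) by (auto simp: vanish_time_def)
qed

end
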